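(* Let $p$ be a sufficiently large prime and let $\mathcal{A}$ be a zero-free subset of $\mathbb{Z}/p\mathbb{Z}$ of maximal cardinality (among all zero-free subsets of $\mathbb{Z}/p\mathbb{Z}$). Then $\operatorname{card}(\mathcal{A})$ is the largest integer $k$ such that $k(k+1)/2 \le p+1$; equivalently $$\operatorname{card}(\mathcal{A}) = \left[\sqrt{2p+9/4}-1/2\right] = \left[\sqrt{2p}\right]-\delta(p), \quad \text{with } \delta(p)\in\{0,1\}.$$ Furthermore, there exists a non-zero element $d\in\mathbb{Z}/p\mathbb{Z}$ such that the set $d\cdot\mathcal{A}$ is the union of two sets $\mathcal{A}'$ and $\mathcal{A}''$ with (1) $\mathcal{A}'\subset[-2(1+\delta(p)),-1]_p$, $\mathcal{A}''\subset[1,p/2]_p$, $\mathcal{A}''\cap(-\mathcal{A}')=\emptyset$ and $\operatorname{card}(\mathcal{A}')\le 1+\delta(p)$; (2) $\sum_{a'\in\mathcal{A}'}|a'|_p\le 2(1+\delta(p))$ and $\sum_{a''\in\mathcal{A}''}|a''|_p\le p-1+3\delta(p)$.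
   Context: For a finite abelian group $G$ and $\mathcal{A}\subset G$, $\mathcal{A}^{\sharp}=\{\sum_{b\in\mathcal{B}}b : \emptyset\ne\mathcal{B}\subset\mathcal{A}\}$; $\mathcal{A}$ is zero-free if $0\notin\mathcal{A}^{\sharp}$. Let $\sigma_p:\mathbb{Z}\to\mathbb{Z}/p\mathbb{Z}$ be the canonical projection; for $a\in\mathbb{Z}/p\mathbb{Z}$, $\bar a$ is the integer in $(-p/2,p/2]$ with $\sigma_p(\bar a)=a$, and $|a|_p=|\bar a|$. For real $x\le y$, $[x,y]_p=\sigma_p([x,y]\cap\mathbb{Z})$. For $d\in\mathbb{Z}/p\mathbb{Z}$, $d\cdot\mathcal{A}=\{da:a\in\mathcal{A}\}$. $[t]$ denotes the integer part of $t$. *)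

theory Defs
  imports Complex_Main "HOL-Number_Theory.Residues"
begin

text \<open>
  The group \<open>\<int>/p\<int>\<close> is \<open>residue_ring (int p)\<close>, whose carrier is the set
  \<open>{0..p - 1}\<close> of integers; only primes \<open>p\<close> are of interest.
\<close>

abbreviation ZMod :: "nat \<Rightarrow> int ring" where
  "ZMod p \<equiv> residue_ring (int p)"

text \<open>
  Finite abelian groups are written additively: only the additive structure of the ring record is
  used here. Finiteness of \<open>\<B>\<close> matters only for infinite groups, as \<open>finsum\<close> over an infinite set
  is \<open>\<zero>\<close> by convention.
\<close>

definition subset_sums :: "('a, 'm) ring_scheme \<Rightarrow> 'a set \<Rightarrow> 'a set" where
  "subset_sums G \<A> = {(\<Oplus>\<^bsub>G\<^esub>b\<in>\<B>. b) | \<B>. finite \<B> \<and> \<B> \<noteq> {} \<and> \<B> \<subseteq> \<A>}"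

definition zero_free :: "('a, 'm) ring_scheme \<Rightarrow> 'a set \<Rightarrow> bool" where
  "zero_free G \<A> \<longleftrightarrow> \<A> \<subseteq> carrier G \<and> \<zero>\<^bsub>G\<^esub> \<notin> subset_sums G \<A>"

definition max_zero_free :: "('a, 'm) ring_scheme \<Rightarrow> 'a set \<Rightarrow> bool" where
  "max_zero_free G \<A> \<longleftrightarrow> zero_free G \<A> \<and> (\<forall>\<B>. zero_free G \<B> \<longrightarrow> card \<B> \<le> card \<A>)"

definition proj :: "nat \<Rightarrow> int \<Rightarrow> int" where
  "proj p n = n mod int p"

definition centered_rep :: "nat \<Rightarrow> int \<Rightarrow> int" where
  "centered_rep p a =
     (THE n. - real p / 2 < real_of_int n \<and> real_of_int n \<le> real p / 2 \<and> proj p n = a)"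

definition abs_mod :: "nat \<Rightarrow> int \<Rightarrow> int" where
  "abs_mod p a = \<bar>centered_rep p a\<bar>"

definition interval_mod :: "nat \<Rightarrow> real \<Rightarrow> real \<Rightarrow> int set" where
  "interval_mod p x y = proj p ` {n. x \<le> real_of_int n \<and> real_of_int n \<le> y}"

definition dilate :: "nat \<Rightarrow> int \<Rightarrow> int set \<Rightarrow> int set" where
  "dilate p d \<A> = (\<lambda>a. d \<otimes>\<^bsub>ZMod p\<^esub> a) ` \<A>"

end

theory Submission
  imports Defs
begin

text \<open>
  Let \<open>A\<close> be zero-free of size \<open>k\<close> of order \<open>\<surd>p\<close>. The Erdos--Heilbronn argument (via Cauchy--Davenport) shows
  that few elements of \<open>A\<close> already have a set \<open>S\<close> of subset sums of positive density, and some such \<open>S\<close>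
  grows by only \<open>O(k)\<close> when translated by any other \<open>a \<in> A\<close>, hence by \<open>O(i k)\<close> under \<open>i a\<close>. By Parseval a
  single dilation maps almost all \<open>i a\<close> with \<open>i\<close> up to a small multiple of \<open>k\<close> close to \<open>0\<close>, so
  that almost all of \<open>A\<close> is mapped into an interval \<open>[-O(k), O(k)]\<close>.

  A small part of such a dense set has subset sums containing a progression with difference \<open>g\<close> and
  length \<open>O(k)\<close>, where \<open>g\<close> divides all remaining elements. After division by \<open>g\<close> the progression
  is an interval, and adding the remaining elements one by one prolongs it by their absolute
  values. It never contains \<open>0\<close>, so these absolute values have sum below \<open>p \<approx> k\<^sup>2/2\<close>; being distinct,
  they almost fill \<open>[1, k]\<close>. The same argument with integer sums shows that almost all signs agree.

  Finally the positive elements in \<open>[1, k]\<close> represent all integers except those near both ends of the range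
  of their sums, which pins the sums of the positive and of the negative elements down to \<open>p + o(k)\<close> and
  \<open>o(k)\<close>. At most one small number is then missing among the absolute values, and a short
  combinatorial argument gives the exact bounds.
\<close>

subsection \<open>Sumsets and translates modulo a prime\<close>

text \<open>The Fourier step needs a set of sums \<open>S\<close> for which |S| (p - |S|) is of
  order p^2, so positive density alone is not enough. Zero-freeness supplies the rest: the sums of a
  part of \<open>A\<close> and the negated sums of the remaining part meet only in 0, and as the
  remaining part has many sums too, \<open>S\<close> misses a positive proportion of the residues.

  Every loss is a prescribed fraction 1/E or 1/M of k, because the last argument starts from at most
  k/100 missing elements. Two estimates bound the square of a loss by k times an earlier loss, so
  the earlier steps are run with E of order M^2.

  The inequality carried through is 2p < k^2 + 3k. It comes from the zero-freeness of {1..n} for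
  n(n+1) < 2p and from primality, which excludes two boundary values. The upper bound on k has no
  proof of its own: it drops out of the final inequalities for the sums of the positive and negative
  elements. Of the two alternatives obtained there, the weaker one can only occur when 2p >=
  (k+1)^2, that is, when \<delta>(p) = 1.\<close>

lemma inj_on_translate_mod:
  fixes p c :: int
  shows "inj_on (\<lambda>a. (a + c) mod p) {0..<p}"
proof (rule inj_onI)
  fix a b assume "a \<in> {0..<p}" "b \<in> {0..<p}" "(a + c) mod p = (b + c) mod p"
  then have "a mod p = b mod p"
    by (metis add_diff_cancel_right' mod_diff_left_eq)
  then show "a = b" using \<open>a \<in> _\<close> \<open>b \<in> _\<close> by simp
qed

definition sumset_mod :: "int \<Rightarrow> int set \<Rightarrow> int set \<Rightarrow> int set" where
  "sumset_mod p A B = (\<lambda>(a, b). (a + b) mod p) ` (A \<times> B)"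

lemma sumset_modI: "a \<in> A \<Longrightarrow> b \<in> B \<Longrightarrow> (a + b) mod p \<in> sumset_mod p A B"
  unfolding sumset_mod_def by force

lemma sumset_modE:
  assumes "x \<in> sumset_mod p A B"
  obtains a b where "a \<in> A" "b \<in> B" "x = (a + b) mod p"
  using assms unfolding sumset_mod_def by force

lemma sumset_mod_subset: "p > 0 \<Longrightarrow> sumset_mod p A B \<subseteq> {0..<p}"
  unfolding sumset_mod_def by auto

lemma card_translate_mod:
  fixes p c :: int
  assumes "A \<subseteq> {0..<p}"
  shows "card ((\<lambda>a. (a + c) mod p) ` A) = card A"
  by (rule card_image, rule inj_on_subset[OF inj_on_translate_mod assms])

lemma card_le_sumset_mod:
  assumes "p > 0" "A \<subseteq> {0..<p}" "B \<noteq> {}"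
  shows "card A \<le> card (sumset_mod p A B)"
proof -
  obtain b where b: "b \<in> B" using assms by auto
  have "(\<lambda>a. (a + b) mod p) ` A \<subseteq> sumset_mod p A B"
    using b by (auto intro: sumset_modI)
  moreover have "finite (sumset_mod p A B)"
    using sumset_mod_subset[OF assms(1)] finite_subset by blast
  ultimately show ?thesis
    using card_mono card_translate_mod[OF assms(2)] by metis
qed

text \<open>As \<open>c\<close> is invertible modulo \<open>p\<close>, its multiples added to one
  element reach every residue. This is where Cauchy--Davenport uses primality.\<close>

lemma closed_translate_full:
  fixes p c :: int
  assumes p: "prime p" and A: "A \<subseteq> {0..<p}" "A \<noteq> {}" and c: "\<not> p dvd c"
    and cl: "\<And>a. a \<in> A \<Longrightarrow> (a + c) mod p \<in> A"
  shows "A = {0..<p}"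
proof -
  have p0: "p > 0" using p prime_gt_0_int by blast
  obtain a0 where a0: "a0 \<in> A" using A by auto
  have it: "(a0 + int i * c) mod p \<in> A" for i
  proof (induction i)
    case 0 then show ?case using a0 A by (auto simp: subset_iff)
  next
    case (Suc i)
    have "((a0 + int i * c) mod p + c) mod p = (a0 + int (Suc i) * c) mod p"
      by (simp add: mod_simps algebra_simps)
    then show ?case using cl[OF Suc] by simp
  qed
  have "y \<in> A" if y: "y \<in> {0..<p}" for y
  proof -
    have "coprime c p" using prime_imp_coprime[OF p c] by (simp add: coprime_commute)
    then obtain z where z: "[c * z = 1] (mod p)" using cong_solve_coprime_int by blast
    define i where "i = nat ((z * (y - a0)) mod p)"
    have i: "int i = (z * (y - a0)) mod p" unfolding i_def using p0 by simp
    have "[a0 + int i * c = a0 + (z * (y - a0)) * c] (mod p)"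
      unfolding i by (intro cong_add cong_mult) (auto simp: cong_def)
    also have "a0 + (z * (y - a0)) * c = a0 + (c * z) * (y - a0)" by (simp add: algebra_simps)
    also have "[a0 + (c * z) * (y - a0) = a0 + 1 * (y - a0)] (mod p)"
      by (intro cong_add cong_mult cong_refl z)
    finally have "(a0 + int i * c) mod p = y mod p" by (simp add: cong_def)
    then show ?thesis using it[of i] y by simp
  qed
  then show ?thesis using A by auto
qed

text \<open>Dyson's e-transform: moving to \<open>A'\<close> and \<open>B'\<close> keeps the total
  size and does not enlarge the sumset. For e = a - b the element \<open>b\<close> stays in
  \<open>B'\<close>, while \<open>b'\<close> leaves it, so induction on \<open>card B\<close>
  applies. If no such choice exists, \<open>A\<close> is closed under translation by differences of
  elements of \<open>B\<close> and is everything, unless \<open>B\<close> is a singleton.\<close>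

theorem cauchy_davenport:
  fixes p :: int
  assumes p: "prime p"
  shows "A \<subseteq> {0..<p} \<Longrightarrow> B \<subseteq> {0..<p} \<Longrightarrow> A \<noteq> {} \<Longrightarrow> B \<noteq> {} \<Longrightarrow>
     min (nat p) (card A + card B - 1) \<le> card (sumset_mod p A B)"
proof (induction "card B" arbitrary: A B rule: less_induct)
  case less
  note A = less.prems(1) and B = less.prems(2)
  have p0: "p > 0" using p prime_gt_0_int by blast
  have fA: "finite A" and fB: "finite B" using A B finite_subset by blast+
  have fin: "finite (sumset_mod p X Y)" for X Y
    using sumset_mod_subset[OF p0] finite_subset by blast
  show ?case
  proof (cases "\<exists>a\<in>A. \<exists>b\<in>B. \<exists>b'\<in>B. (b' + (a - b)) mod p \<notin> A")
    case True
    then obtain a b b' where ab: "a \<in> A" "b \<in> B" "b' \<in> B" "(b' + (a - b)) mod p \<notin> A" by auto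
    define e where "e = a - b"
    define A' where "A' = A \<union> (\<lambda>b. (b + e) mod p) ` B"
    define B' where "B' = {b \<in> B. (b + e) mod p \<in> A}"
    have bB': "b \<in> B'" using ab A unfolding B'_def e_def by (auto simp: subset_iff)
    have "b' \<notin> B'" using ab unfolding B'_def e_def by auto
    then have "B' \<subset> B" using ab unfolding B'_def by auto
    then have lt: "card B' < card B" using fB psubset_card_mono by blast
    have A's: "A' \<subseteq> {0..<p}" unfolding A'_def using A p0 by auto
    have B's: "B' \<subseteq> {0..<p}" unfolding B'_def using B by auto
    have "A' = A \<union> (\<lambda>b. (b + e) mod p) ` (B - B')" unfolding A'_def B'_def by auto
    moreover have "A \<inter> (\<lambda>b. (b + e) mod p) ` (B - B') = {}" unfolding B'_def by auto
    ultimately have "card A' = card A + card ((\<lambda>b. (b + e) mod p) ` (B - B'))"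
      using fA fB by (simp add: card_Un_disjoint)
    also have "card ((\<lambda>b. (b + e) mod p) ` (B - B')) = card (B - B')"
      by (rule card_translate_mod) (use B in auto)
    also have "\<dots> = card B - card B'"
      by (rule card_Diff_subset) (use fB in \<open>auto simp: B'_def\<close>)
    finally have cc: "card A' + card B' = card A + card B" using lt by simp
    have "sumset_mod p A' B' \<subseteq> sumset_mod p A B"
    proof
      fix x assume "x \<in> sumset_mod p A' B'"
      then obtain u v where uv: "u \<in> A'" "v \<in> B'" "x = (u + v) mod p" by (rule sumset_modE)
      show "x \<in> sumset_mod p A B"
      proof (cases "u \<in> A")
        case True
        then show ?thesis using uv unfolding B'_def by (auto intro: sumset_modI)
      next
        case False
        then obtain w where w: "w \<in> B" "u = (w + e) mod p" using uv unfolding A'_def by auto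
        have "x = ((v + e) mod p + w) mod p" unfolding uv(3) w(2) by (simp add: mod_simps algebra_simps)
        then show ?thesis using w uv unfolding B'_def by (auto intro: sumset_modI)
      qed
    qed
    then have "card (sumset_mod p A' B') \<le> card (sumset_mod p A B)" by (rule card_mono[OF fin])
    moreover have "min (nat p) (card A' + card B' - 1) \<le> card (sumset_mod p A' B')"
      by (rule less.hyps[OF lt A's B's]) (use bB' less.prems in \<open>auto simp: A'_def\<close>)
    ultimately show ?thesis using cc by simp
  next
    case False
    show ?thesis
    proof (cases "card B = 1")
      case True
      then show ?thesis using card_le_sumset_mod[OF p0 A less.prems(4)] by simp
    next
      case nB: False
      have "card B \<noteq> 0" using fB less.prems(4) by simp
      then have "\<not> card B \<le> 1" using nB by linarith
      then obtain b b' where bb: "b \<in> B" "b' \<in> B" "b \<noteq> b'"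
        using card_le_Suc0_iff_eq[OF fB] by auto
      have "\<not> p dvd (b' - b)"
      proof
        assume "p dvd b' - b"
        then have "b' mod p = b mod p" by (simp add: mod_eq_dvd_iff)
        then show False using bb B by (auto simp: subset_iff)
      qed
      then have "A = {0..<p}"
        by (rule closed_translate_full[OF p A less.prems(3)])
           (use False bb in \<open>force simp: algebra_simps\<close>)
      then have "card A = nat p" by simp
      then show ?thesis using card_le_sumset_mod[OF p0 A less.prems(4)] by simp
    qed
  qed
qed

section \<open>Elements gained and kept under a translation\<close>

text \<open>The Erdos--Heilbronn counting function: if \<open>S\<close> is the set of subset sums of
  \<open>Y\<close>, then adjoining a new element \<open>x\<close> to \<open>Y\<close> creates
  exactly this many new sums.\<close>

definition shift_gain :: "int \<Rightarrow> int set \<Rightarrow> int \<Rightarrow> nat" where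
  "shift_gain p S x = card {s \<in> S. (s + x) mod p \<notin> S}"

lemma shift_gain_mod: "shift_gain p S (x mod p) = shift_gain p S x"
  unfolding shift_gain_def by (simp add: mod_simps)

lemma shift_gain_cong: "x mod p = y mod p \<Longrightarrow> shift_gain p S x = shift_gain p S y"
  by (metis shift_gain_mod)

text \<open>An element that leaves \<open>S\<close> under x + y leaves it at the first translation,
  or stays and leaves at the second; the latter elements are counted after translating them by
  \<open>x\<close>.\<close>

lemma shift_gain_add:
  assumes S: "S \<subseteq> {0..<p}"
  shows "shift_gain p S (x + y) \<le> shift_gain p S x + shift_gain p S y"
proof -
  have fS: "finite S" using S finite_subset by blast
  define T where "T = {s \<in> S. (s + x) mod p \<in> S \<and> (s + x + y) mod p \<notin> S}"
  have "{s \<in> S. (s + (x + y)) mod p \<notin> S} \<subseteq> {s \<in> S. (s + x) mod p \<notin> S} \<union> T"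
    unfolding T_def by (auto simp: algebra_simps)
  then have "shift_gain p S (x + y) \<le> card ({s \<in> S. (s + x) mod p \<notin> S} \<union> T)"
    unfolding shift_gain_def by (rule card_mono[rotated]) (use fS in \<open>auto simp: T_def\<close>)
  also have "\<dots> \<le> shift_gain p S x + card T" unfolding shift_gain_def by (rule card_Un_le)
  also have "card T = card ((\<lambda>s. (s + x) mod p) ` T)"
    by (rule card_translate_mod[symmetric]) (use S in \<open>auto simp: T_def\<close>)
  also have "\<dots> \<le> shift_gain p S y" unfolding shift_gain_def
    by (rule card_mono) (use fS in \<open>auto simp: T_def mod_simps\<close>)
  finally show ?thesis by simp
qed

lemma shift_gain_0: "S \<subseteq> {0..<p} \<Longrightarrow> shift_gain p S 0 = 0"
proof -
  assume "S \<subseteq> {0..<p}"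
  then have "{s \<in> S. (s + 0) mod p \<notin> S} = {}" by (auto simp: subset_iff)
  then show ?thesis unfolding shift_gain_def by (simp only: card.empty)
qed

lemma shift_gain_mult:
  assumes S: "S \<subseteq> {0..<p}"
  shows "shift_gain p S (int i * x) \<le> i * shift_gain p S x"
proof (induction i)
  case 0 then show ?case using shift_gain_0[OF S] by simp
next
  case (Suc i)
  have "shift_gain p S (int (Suc i) * x) = shift_gain p S (int i * x + x)" by (simp add: algebra_simps)
  also have "\<dots> \<le> shift_gain p S (int i * x) + shift_gain p S x" by (rule shift_gain_add[OF S])
  finally show ?case using Suc by simp
qed

lemma card_Un_translate:
  assumes S: "S \<subseteq> {0..<p}"
  shows "card (S \<union> (\<lambda>s. (s + x) mod p) ` S) = card S + shift_gain p S x"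
proof -
  have fS: "finite S" using S finite_subset by blast
  let ?T = "{s \<in> S. (s + x) mod p \<notin> S}"
  have "S \<union> (\<lambda>s. (s + x) mod p) ` S = S \<union> (\<lambda>s. (s + x) mod p) ` ?T" by auto
  moreover have "S \<inter> (\<lambda>s. (s + x) mod p) ` ?T = {}" by auto
  ultimately have "card (S \<union> (\<lambda>s. (s + x) mod p) ` S) = card S + card ((\<lambda>s. (s + x) mod p) ` ?T)"
    using fS by (simp add: card_Un_disjoint)
  also have "card ((\<lambda>s. (s + x) mod p) ` ?T) = card ?T"
    by (rule card_translate_mod) (use S in auto)
  finally show ?thesis unfolding shift_gain_def .
qed

definition shift_overlap :: "int \<Rightarrow> int set \<Rightarrow> int \<Rightarrow> nat" where
  "shift_overlap p S x = card {s \<in> S. (s + x) mod p \<in> S}"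

lemma shift_overlap_add_shift_gain:
  assumes "finite S"
  shows "shift_overlap p S x + shift_gain p S x = card S"
proof -
  have "card S = card ({s \<in> S. (s + x) mod p \<in> S} \<union> {s \<in> S. (s + x) mod p \<notin> S})"
    by (rule arg_cong[where f = card]) auto
  also have "\<dots> = shift_overlap p S x + shift_gain p S x" unfolding shift_overlap_def shift_gain_def
    by (rule card_Un_disjoint) (use assms in auto)
  finally show ?thesis by simp
qed

text \<open>Double counting: the pairs (s, s + x) with both entries in \<open>S\<close> determine
  \<open>x\<close>.\<close>

lemma sum_shift_overlap_le:
  assumes S: "S \<subseteq> {0..<p}" and U: "U \<subseteq> {0..<p}"
  shows "(\<Sum>x\<in>U. shift_overlap p S x) \<le> card S ^ 2"
proof -
  have fS: "finite S" and fU: "finite U" using S U finite_subset by blast+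
  have "(\<Sum>x\<in>U. shift_overlap p S x) = card (SIGMA x:U. {s \<in> S. (s + x) mod p \<in> S})"
    unfolding shift_overlap_def using fS fU by simp
  also have "\<dots> \<le> card (S \<times> S)"
  proof (rule card_inj_on_le[where f = "\<lambda>(x, s). (s, (s + x) mod p)"])
    show "inj_on (\<lambda>(x, s). (s, (s + x) mod p)) (SIGMA x:U. {s \<in> S. (s + x) mod p \<in> S})"
      using U inj_on_translate_mod[of _ p]
      by (auto simp: inj_on_def subset_iff add.commute)
  qed (use fS in auto)
  finally show ?thesis by (simp add: card_cartesian_product power2_eq_square)
qed

fun iter_sumset :: "int \<Rightarrow> int set \<Rightarrow> nat \<Rightarrow> int set" where
  "iter_sumset p V 0 = {0}"
| "iter_sumset p V (Suc j) = sumset_mod p (iter_sumset p V j) V"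

lemma card_iter_sumset:
  assumes p: "prime p" and V: "V \<subseteq> {0..<p}" "card V = Suc b"
  shows "iter_sumset p V j \<subseteq> {0..<p} \<and> iter_sumset p V j \<noteq> {} \<and>
    min (nat p) (j * b + 1) \<le> card (iter_sumset p V j)"
proof (induction j)
  case 0
  have p0: "p > 0" using p prime_gt_0_int by blast
  then show ?case by auto
next
  case (Suc j)
  have p0: "p > 0" using p prime_gt_0_int by blast
  have Vn: "V \<noteq> {}" using V by auto
  have "min (nat p) (card (iter_sumset p V j) + card V - 1) \<le> card (sumset_mod p (iter_sumset p V j) V)"
    using cauchy_davenport[OF p] Suc V Vn by blast
  then have c: "min (nat p) (Suc j * b + 1) \<le> card (sumset_mod p (iter_sumset p V j) V)"
    using Suc V(2) by auto
  show ?case using c sumset_mod_subset[OF p0] Suc Vn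
    by (auto simp: sumset_mod_def)
qed

lemma shift_gain_iter_sumset:
  assumes S: "S \<subseteq> {0..<p}" and V: "\<And>v. v \<in> V \<Longrightarrow> shift_gain p S v \<le> K"
  shows "x \<in> iter_sumset p V j \<Longrightarrow> shift_gain p S x \<le> j * K"
proof (induction j arbitrary: x)
  case 0 then show ?case using shift_gain_0[OF S] by simp
next
  case (Suc j)
  then obtain a v where av: "a \<in> iter_sumset p V j" "v \<in> V" "x = (a + v) mod p"
    by (auto elim: sumset_modE)
  have "shift_gain p S x = shift_gain p S (a + v)" unfolding av(3) by (rule shift_gain_mod)
  also have "\<dots> \<le> shift_gain p S a + shift_gain p S v" by (rule shift_gain_add[OF S])
  finally show ?case using Suc.IH[OF av(1)] V[OF av(2)] by simp
qed

text \<open>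
  The translates of \<open>S\<close> by the elements of any set \<open>U\<close> with \<open>\<bar>U\<bar> \<ge> 2\<bar>S\<bar>\<close> leave \<open>S\<close> by \<open>\<bar>S\<bar> / 2\<close> elements on
  average. Here \<open>U\<close> is an iterated sumset of \<open>B \<union> {0}\<close>, on which subadditivity bounds the gain.
\<close>

lemma shift_gain_lower_bound:
  assumes p: "prime p" and S: "S \<subseteq> {0..<p}" "2 * int (card S) \<le> p"
    and B: "B \<subseteq> {1..<p}" "card B \<le> 2 * card S" "B \<noteq> {}"
    and K: "\<And>x. x \<in> B \<Longrightarrow> shift_gain p S x \<le> K"
  shows "card B \<le> 8 * K"
proof -
  have p0: "p > 0" using p prime_gt_0_int by blast
  define b where "b = card B"
  have fB: "finite B" using B finite_subset by blast
  have b0: "b > 0" unfolding b_def using B fB by auto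
  have s0: "card S > 0" using b0 B unfolding b_def by linarith
  \<comment> \<open>Adjoining 0, whose gain is 0, lets Cauchy--Davenport add \<open>b\<close> rather
    than b - 1 elements with each summand.\<close>
  define V where "V = insert 0 B"
  have V: "V \<subseteq> {0..<p}" unfolding V_def using B p0 by auto
  have "0 \<notin> B" using B by auto
  then have cV: "card V = Suc b" unfolding V_def b_def using fB by simp
  \<comment> \<open>The least number of summands with j * b > 2 |S|. Together with b <= 2 |S| it
    keeps j * b at most 4 |S|, which is the source of the factor 8.\<close>
  define j where "j = 2 * card S div b + 1"
  define U where "U = iter_sumset p V j"
  have "2 * card S < j * b" unfolding j_def using b0
    by (metis Suc_eq_plus1 dividend_less_div_times mult.commute mult_Suc add.commute)
  moreover have U: "U \<subseteq> {0..<p}" "min (nat p) (j * b + 1) \<le> card U"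
    unfolding U_def using card_iter_sumset[OF p V cV] by auto
  ultimately have cU: "2 * card S \<le> card U" using S(2) by linarith
  have lamV: "shift_gain p S v \<le> K" if "v \<in> V" for v
    using that K shift_gain_0[OF S(1)] unfolding V_def by auto
  have fS: "finite S" using S finite_subset by blast
  have "(\<Sum>x\<in>U. card S) \<le> (\<Sum>x\<in>U. shift_overlap p S x + j * K)"
  proof (rule sum_mono)
    fix x assume "x \<in> U"
    then have "shift_gain p S x \<le> j * K" unfolding U_def using shift_gain_iter_sumset[OF S(1) lamV] by blast
    then show "card S \<le> shift_overlap p S x + j * K" using shift_overlap_add_shift_gain[OF fS, of p x] by linarith
  qed
  also have "\<dots> \<le> card S ^ 2 + card U * (j * K)"
    using sum_shift_overlap_le[OF S(1) U(1)] by (simp add: sum.distrib)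
  finally have 1: "card U * card S \<le> card S ^ 2 + card U * (j * K)" by simp
  have "card S \<le> 2 * (j * K)"
  proof (rule ccontr)
    assume "\<not> ?thesis"
    then have "2 * (j * K) < card S" by simp
    then have "card U * (2 * (j * K)) < card U * card S" using cU s0 by simp
    moreover have "2 * card S ^ 2 \<le> card U * card S"
      using mult_right_mono[OF cU, of "card S"] by (simp add: power2_eq_square)
    ultimately show False using 1 by linarith
  qed
  then have "b * card S \<le> b * (2 * (j * K))" by (rule mult_le_mono2)
  also have "\<dots> = 2 * (b * j) * K" by simp
  also have "b * j \<le> 2 * card S + b" unfolding j_def by simp
  then have "b * j \<le> 4 * card S" using B(2) unfolding b_def by linarith
  then have "2 * (b * j) * K \<le> 2 * (4 * card S) * K" by (intro mult_le_mono1 mult_le_mono2)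
  finally have "b * card S \<le> (8 * K) * card S" by (simp add: ac_simps)
  then show ?thesis using s0 unfolding b_def by simp
qed

subsection \<open>Growth of subset sums\<close>

definition sums_mod :: "int \<Rightarrow> int set \<Rightarrow> int set" where
  "sums_mod p Y = (\<lambda>Z. (\<Sum>Z) mod p) ` Pow Y"

text \<open>The elements are integers rather than residues, so that the centred representatives of a
  dilate form a set of the same kind; injectivity keeps them distinct modulo
  \<open>p\<close>.\<close>

definition zero_free_mod :: "int \<Rightarrow> int set \<Rightarrow> bool" where
  "zero_free_mod p Y \<longleftrightarrow> finite Y \<and> inj_on (\<lambda>y. y mod p) Y \<and> (\<forall>Z\<subseteq>Y. Z \<noteq> {} \<longrightarrow> \<not> p dvd \<Sum>Z)"

lemma zero_free_mod_subset: "zero_free_mod p A \<Longrightarrow> Y \<subseteq> A \<Longrightarrow> zero_free_mod p Y"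
  unfolding zero_free_mod_def by (meson finite_subset inj_on_subset subset_trans)

lemma sums_mod_range: "p > 0 \<Longrightarrow> sums_mod p Y \<subseteq> {0..<p}"
  unfolding sums_mod_def by auto

lemma sums_mod_finite: "p > 0 \<Longrightarrow> finite (sums_mod p Y)"
  using sums_mod_range finite_subset by blast

lemma sums_mod_mono: "Y \<subseteq> Y' \<Longrightarrow> sums_mod p Y \<subseteq> sums_mod p Y'"
  unfolding sums_mod_def by auto

lemma sums_mod_insert:
  assumes "finite Y" "a \<notin> Y"
  shows "sums_mod p (insert a Y) = sums_mod p Y \<union> (\<lambda>s. (s + a) mod p) ` sums_mod p Y"
proof -
  have "(\<lambda>s. (s + a) mod p) ` sums_mod p Y = (\<lambda>Z. (\<Sum>Z) mod p) ` (insert a ` Pow Y)"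
    unfolding sums_mod_def image_image
  proof (rule image_cong[OF refl])
    fix Z assume "Z \<in> Pow Y"
    then have "finite Z" "a \<notin> Z" using assms finite_subset by auto
    then show "((\<Sum>Z) mod p + a) mod p = (\<Sum>(insert a Z)) mod p" by (simp add: mod_simps add.commute)
  qed
  then show ?thesis unfolding sums_mod_def Pow_insert image_Un by simp
qed

lemma card_sums_mod_insert:
  assumes "p > 0" "finite Y" "a \<notin> Y"
  shows "card (sums_mod p (insert a Y)) = card (sums_mod p Y) + shift_gain p (sums_mod p Y) a"
  unfolding sums_mod_insert[OF assms(2,3)] by (rule card_Un_translate[OF sums_mod_range[OF assms(1)]])

lemma card_sums_mod_ge:
  assumes "p > 0" "zero_free_mod p Y"
  shows "card Y \<le> card (sums_mod p Y)"
proof -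
  have "(\<lambda>y. y mod p) ` Y \<subseteq> sums_mod p Y"
  proof
    fix x assume "x \<in> (\<lambda>y. y mod p) ` Y"
    then obtain y where "y \<in> Y" "x = (\<Sum>{y}) mod p" by auto
    then show "x \<in> sums_mod p Y" unfolding sums_mod_def by blast
  qed
  then have "card ((\<lambda>y. y mod p) ` Y) \<le> card (sums_mod p Y)"
    by (rule card_mono[OF sums_mod_finite[OF assms(1)]])
  then show ?thesis using assms(2) unfolding zero_free_mod_def by (simp add: card_image)
qed

lemma card_sums_mod_le: "p > 0 \<Longrightarrow> card (sums_mod p Y) \<le> nat p"
  using card_mono[OF _ sums_mod_range, of p Y] by simp

text \<open>A common element of the sums of \<open>Y\<close> and the negated sums of A - Y would
  combine into a vanishing sum over a subset of \<open>A\<close>, which must be empty. Only 0, the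
  empty sum, can be shared; this accounts for the + 1.\<close>

lemma card_sums_mod_complement:
  assumes p: "p > 0" and A: "zero_free_mod p A" and Y: "Y \<subseteq> A"
  shows "card (sums_mod p Y) + card (sums_mod p (A - Y)) \<le> nat p + 1"
proof -
  let ?n = "\<lambda>s. (- s) mod p"
  have fA: "finite A" using A unfolding zero_free_mod_def by auto
  have inj: "inj_on ?n {0..<p}"
  proof (rule inj_onI)
    fix x y assume "x \<in> {0..<p}" "y \<in> {0..<p}" "(- x) mod p = (- y) mod p"
    then have "(-(-x)) mod p = (-(-y)) mod p" by (metis mod_minus_eq)
    then show "x = y" using \<open>x \<in> _\<close> \<open>y \<in> _\<close> by simp
  qed
  have "sums_mod p Y \<inter> ?n ` sums_mod p (A - Y) \<subseteq> {0}"
  proof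
    fix x assume "x \<in> sums_mod p Y \<inter> ?n ` sums_mod p (A - Y)"
    then obtain Z Z' where Z: "Z \<subseteq> Y" "x = (\<Sum>Z) mod p" "Z' \<subseteq> A - Y" "x = (- ((\<Sum>Z') mod p)) mod p"
      unfolding sums_mod_def by blast
    have "(\<Sum>Z) mod p = (- \<Sum>Z') mod p" using Z by (simp add: mod_simps)
    then have "p dvd \<Sum>Z + \<Sum>Z'" by (metis diff_minus_eq_add mod_eq_dvd_iff)
    moreover have "finite Z" using finite_subset[OF _ fA, of Z] Z(1) Y by auto
    moreover have "finite Z'" using finite_subset[OF _ fA, of Z'] Z(3) by auto
    moreover have "Z \<inter> Z' = {}" using Z by auto
    ultimately have "p dvd \<Sum>(Z \<union> Z')" by (simp add: sum.union_disjoint)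
    moreover have "Z \<union> Z' \<subseteq> A" using Z Y by blast
    ultimately have "Z \<union> Z' = {}" using A unfolding zero_free_mod_def by blast
    then show "x \<in> {0}" using Z by simp
  qed
  then have 1: "card (sums_mod p Y \<inter> ?n ` sums_mod p (A - Y)) \<le> 1"
    using card_mono[of "{0::int}"] by simp
  have "card (?n ` sums_mod p (A - Y)) = card (sums_mod p (A - Y))"
    by (rule card_image, rule inj_on_subset[OF inj sums_mod_range[OF p]])
  moreover have "card (sums_mod p Y \<union> ?n ` sums_mod p (A - Y)) \<le> card {0..<p}"
    by (rule card_mono) (use sums_mod_range[OF p, of Y] p in auto)
  moreover have "card (sums_mod p Y) + card (?n ` sums_mod p (A - Y))
     = card (sums_mod p Y \<union> ?n ` sums_mod p (A - Y)) + card (sums_mod p Y \<inter> ?n ` sums_mod p (A - Y))"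
    by (rule card_Un_Int) (use sums_mod_finite[OF p] in auto)
  ultimately show ?thesis using 1 by simp
qed

text \<open>Elements of gain above \<open>K\<close> are adjoined as long as there are any, each
  creating more than \<open>K\<close> new sums. So either many are adjoined and the set of sums is
  large, or the process stops early with every other element having small gain.\<close>

lemma greedy_extension:
  assumes p: "p > 0" and A: "finite A"
  shows "Y0 \<subseteq> A \<Longrightarrow> \<exists>Y. Y0 \<subseteq> Y \<and> Y \<subseteq> A \<and>
     card (sums_mod p Y0) + K * (card Y - card Y0) \<le> card (sums_mod p Y) \<and> (\<forall>a\<in>A - Y. shift_gain p (sums_mod p Y) a \<le> K)"
proof (induction "card (A - Y0)" arbitrary: Y0 rule: less_induct)
  case less
  show ?case
  proof (cases "\<forall>a\<in>A - Y0. shift_gain p (sums_mod p Y0) a \<le> K")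
    case True
    then show ?thesis using less.prems by (intro exI[of _ Y0]) auto
  next
    case False
    then obtain a where a: "a \<in> A" "a \<notin> Y0" "K < shift_gain p (sums_mod p Y0) a" by auto
    have fY0: "finite Y0" using less.prems A finite_subset by blast
    have "A - insert a Y0 \<subset> A - Y0" using a by auto
    then have "card (A - insert a Y0) < card (A - Y0)" by (rule psubset_card_mono[rotated]) (use A in auto)
    then obtain Y where Y: "insert a Y0 \<subseteq> Y" "Y \<subseteq> A"
        "card (sums_mod p (insert a Y0)) + K * (card Y - card (insert a Y0)) \<le> card (sums_mod p Y)"
        "\<forall>b\<in>A - Y. shift_gain p (sums_mod p Y) b \<le> K"
      using less.hyps[of "insert a Y0"] a less.prems by auto
    have cY: "card (insert a Y0) \<le> card Y" by (rule card_mono) (use Y A finite_subset in auto)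
    have ci: "card (insert a Y0) = Suc (card Y0)" using fY0 a by simp
    have "card Y - card Y0 = Suc (card Y - card (insert a Y0))" using cY ci by linarith
    then have "K * (card Y - card Y0) = K + K * (card Y - card (insert a Y0))" by simp
    moreover have "card (sums_mod p Y0) + K \<le> card (sums_mod p (insert a Y0))"
      using card_sums_mod_insert[OF p fY0 a(2)] a(3) by simp
    ultimately have "card (sums_mod p Y0) + K * (card Y - card Y0) \<le> card (sums_mod p Y)"
      using Y(3) by linarith
    then show ?thesis using Y by (intro exI[of _ Y]) auto
  qed
qed

lemma zero_free_mod_residues:
  assumes p: "p > 0" and A: "zero_free_mod p A"
  shows "(\<lambda>y. y mod p) ` A \<subseteq> {1..<p}"
proof
  fix x assume "x \<in> (\<lambda>y. y mod p) ` A"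
  then obtain y where y: "y \<in> A" "x = y mod p" by auto
  have "\<not> p dvd \<Sum>{y}" using A y unfolding zero_free_mod_def by blast
  then have "x \<noteq> 0" using y by (simp add: dvd_eq_mod_eq_0)
  moreover have "0 \<le> x" "x < p" using y p by auto
  ultimately show "x \<in> {1..<p}" by auto
qed

text \<open>With K close to h / 8 this is quadratic growth. If the greedy process adjoins fewer than
  \<open>h\<close> elements, then at least \<open>h\<close> elements of gain at most
  \<open>K\<close> are left over, which \<open>shift_gain_lower_bound\<close> forbids for 8 * K < h
  unless the sums fill more than half of the residues. The \<open>h\<close> elements put in at the
  start ensure |S| >= h, as needed for the size condition there.\<close>

lemma sums_mod_growth:
  assumes p: "prime p" and A: "zero_free_mod p A" and h: "3 * h \<le> card A" "8 * K < h"
  shows "K * h \<le> card (sums_mod p A) \<or> p < 2 * int (card (sums_mod p A))"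
proof -
  have p0: "p > 0" using p prime_gt_0_int by blast
  have fA: "finite A" using A unfolding zero_free_mod_def by auto
  obtain Y0 where Y0: "Y0 \<subseteq> A" "card Y0 = h"
    using obtain_subset_with_card_n[of h A] h by auto
  obtain Y where Y: "Y0 \<subseteq> Y" "Y \<subseteq> A" "card (sums_mod p Y0) + K * (card Y - card Y0) \<le> card (sums_mod p Y)"
      "\<forall>a\<in>A - Y. shift_gain p (sums_mod p Y) a \<le> K"
    using greedy_extension[OF p0 fA Y0(1)] by metis
  have mono: "card (sums_mod p Y) \<le> card (sums_mod p A)"
    by (rule card_mono[OF sums_mod_finite[OF p0] sums_mod_mono[OF Y(2)]])
  have fY: "finite Y" using Y fA finite_subset by blast
  show ?thesis
  proof (cases "2 * h \<le> card Y")
    case True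
    then have "h \<le> card Y - card Y0" using Y0(2) by linarith
    then have "K * h \<le> K * (card Y - card Y0)" by (rule mult_le_mono2)
    then show ?thesis using Y(3) mono by linarith
  next
    case False
    have "card (A - Y) = card A - card Y" by (rule card_Diff_subset[OF fY Y(2)])
    then have "h \<le> card (A - Y)" using False h by linarith
    then obtain B' where B': "B' \<subseteq> A - Y" "card B' = h"
      using obtain_subset_with_card_n by metis
    define B where "B = (\<lambda>y. y mod p) ` B'"
    have zB: "zero_free_mod p B'" using zero_free_mod_subset[OF A, of B'] B' by auto
    have cB: "card B = h" unfolding B_def using zB B' by (simp add: zero_free_mod_def card_image)
    have BB: "B \<subseteq> {1..<p}" unfolding B_def by (rule zero_free_mod_residues[OF p0 zB])
    have "h \<le> card (sums_mod p Y0)" using card_sums_mod_ge[OF p0 zero_free_mod_subset[OF A Y0(1)]] Y0 by simp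
    then have cS: "h \<le> card (sums_mod p Y)" using Y(3) by linarith
    have "shift_gain p (sums_mod p Y) x \<le> K" if "x \<in> B" for x
      using that Y(4) B' unfolding B_def by (auto simp: shift_gain_mod)
    moreover have "B \<noteq> {}" using cB h by auto
    ultimately have "\<not> 2 * int (card (sums_mod p Y)) \<le> p"
      using shift_gain_lower_bound[OF p sums_mod_range[OF p0] _ BB, of Y K] cB cS h by auto
    then show ?thesis using mono by linarith
  qed
qed

text \<open>A greedy process with threshold \<open>K2\<close>, at least p / h, stops after at most
  \<open>h\<close> steps, as there are only \<open>p\<close> residues. The at least 3 * h elements
  left over have \<open>m\<close> sums themselves, which keeps the sums of \<open>Y\<close> away
  from the whole group.\<close>

lemma sums_mod_stationary:
  assumes p: "prime p" and A: "zero_free_mod p A" and h: "7 * h \<le> card A" "8 * K < h"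
    and K2: "nat p \<le> K2 * h" and m: "m \<le> K * h" "2 * int m \<le> p"
  shows "\<exists>Y\<subseteq>A. card Y \<le> 4 * h \<and> m \<le> card (sums_mod p Y) \<and> card (sums_mod p Y) + m \<le> nat p + 1
     \<and> (\<forall>a\<in>A - Y. shift_gain p (sums_mod p Y) a \<le> K2)"
proof -
  have p0: "p > 0" using p prime_gt_0_int by blast
  have fA: "finite A" using A unfolding zero_free_mod_def by auto
  have g: "m \<le> card (sums_mod p X)" if "X \<subseteq> A" "3 * h \<le> card X" for X
    using sums_mod_growth[OF p zero_free_mod_subset[OF A that(1)] that(2) h(2)] m by linarith
  obtain Y0 where Y0: "Y0 \<subseteq> A" "card Y0 = 3 * h"
    using obtain_subset_with_card_n[of "3 * h" A] h by auto
  obtain Y where Y: "Y0 \<subseteq> Y" "Y \<subseteq> A" "card (sums_mod p Y0) + K2 * (card Y - card Y0) \<le> card (sums_mod p Y)"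
      "\<forall>a\<in>A - Y. shift_gain p (sums_mod p Y) a \<le> K2"
    using greedy_extension[OF p0 fA Y0(1)] by metis
  have fY: "finite Y" using Y fA finite_subset by blast
  have "K2 * (card Y - card Y0) \<le> K2 * h"
    using Y(3) card_sums_mod_le[OF p0, of Y] K2 by linarith
  moreover have "K2 > 0" using K2 p0 by (cases K2) auto
  ultimately have cY: "card Y \<le> 4 * h" using Y0 by simp
  have "card (A - Y) = card A - card Y" by (rule card_Diff_subset[OF fY Y(2)])
  then have "m \<le> card (sums_mod p (A - Y))" using g[of "A - Y"] cY h by auto
  then have "card (sums_mod p Y) + m \<le> nat p + 1"
    using card_sums_mod_complement[OF p0 A Y(2)] by linarith
  moreover have "3 * h \<le> card Y" using card_mono[OF fY Y(1)] Y0 by simp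
  ultimately show ?thesis using g[of Y] cY Y by (intro exI[of _ Y]) auto
qed

subsection \<open>Concentration of a dilate\<close>

definition additive_char :: "int \<Rightarrow> int \<Rightarrow> complex" where
  "additive_char p x = cis (2 * pi * real_of_int x / real_of_int p)"

lemma additive_char_add: "additive_char p (x + y) = additive_char p x * additive_char p y"
  unfolding additive_char_def by (simp add: cis_mult ring_distribs add_divide_distrib)

lemma additive_char_0 [simp]: "additive_char p 0 = 1" unfolding additive_char_def by simp

lemma additive_char_cnj: "cnj (additive_char p x) = additive_char p (- x)"
  unfolding additive_char_def by (simp add: cis_cnj)

lemma additive_char_power: "additive_char p (int n * x) = additive_char p x ^ n"
  unfolding additive_char_def by (simp add: DeMoivre algebra_simps)

lemma additive_char_eq_1_iff:
  assumes "p > 0"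
  shows "additive_char p x = 1 \<longleftrightarrow> p dvd x"
proof
  assume "additive_char p x = 1"
  then have "cos (2 * pi * real_of_int x / real_of_int p) = 1"
    unfolding additive_char_def by (simp add: cis.code complex_eq_iff)
  then obtain n :: int where "2 * pi * real_of_int x / real_of_int p = real_of_int n * 2 * pi"
    using cos_one_2pi_int by blast
  then have "real_of_int x = real_of_int (n * p)" using assms by (simp add: field_simps)
  then have "x = n * p" by (simp only: of_int_eq_iff)
  then show "p dvd x" by simp
next
  assume "p dvd x"
  then obtain n where "x = p * n" by auto
  then have "2 * pi * real_of_int x / real_of_int p = 2 * pi * of_int n" using assms by simp
  then have "additive_char p x = cis (2 * pi * of_int n)" unfolding additive_char_def by (simp only:)
  then show "additive_char p x = 1" by (simp add: complex_eq_iff)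
qed

lemma sum_additive_char:
  assumes "p > 0"
  shows "(\<Sum>t\<in>{0..<p}. additive_char p (t * x)) = (if p dvd x then of_int p else 0)"
proof -
  have "{0..<p} = int ` {0..<nat p}" using assms by (simp add: image_int_atLeastLessThan)
  then have "(\<Sum>t\<in>{0..<p}. additive_char p (t * x)) = (\<Sum>n\<in>{0..<nat p}. additive_char p (int n * x))"
    by (simp add: sum.reindex)
  also have "\<dots> = (\<Sum>n<nat p. additive_char p x ^ n)" by (simp add: additive_char_power atLeast0LessThan)
  also have "\<dots> = (if p dvd x then of_int p else 0)"
  proof (cases "p dvd x")
    case True
    then have "additive_char p x = 1" using additive_char_eq_1_iff[OF assms] by simp
    then show ?thesis using True assms by simp
  next
    case False
    then have 1: "additive_char p x \<noteq> 1" using additive_char_eq_1_iff[OF assms] by simp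
    have "additive_char p x ^ nat p = additive_char p (p * x)" using additive_char_power[of p "nat p" x] assms by simp
    also have "\<dots> = 1" using additive_char_eq_1_iff[OF assms] by simp
    finally show ?thesis using False 1 by (simp add: geometric_sum)
  qed
  finally show ?thesis .
qed

definition fourier_weight :: "int \<Rightarrow> int set \<Rightarrow> int \<Rightarrow> real" where
  "fourier_weight p S t = (cmod (\<Sum>s\<in>S. additive_char p (t * s)))\<^sup>2"

lemma fourier_weight_nonneg: "0 \<le> fourier_weight p S t"
  unfolding fourier_weight_def by simp

text \<open>The squared moduli of the Fourier coefficients of \<open>S\<close> have its
  autocorrelation as transform; x = 0 is Parseval's identity.\<close>

lemma sum_fourier_weight_cos:
  assumes p: "p > 0" and S: "S \<subseteq> {0..<p}"
  shows "(\<Sum>t\<in>{0..<p}. fourier_weight p S t * cos (2 * pi * real_of_int (t * x) / real_of_int p))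
     = real_of_int p * real (shift_overlap p S x)"
proof -
  have fS: "finite S" using S finite_subset by blast
  have w: "complex_of_real (fourier_weight p S t) = (\<Sum>s\<in>S. \<Sum>s'\<in>S. additive_char p (t * (s - s')))" for t
  proof -
    have "complex_of_real (fourier_weight p S t) = (\<Sum>s\<in>S. additive_char p (t * s)) * cnj (\<Sum>s\<in>S. additive_char p (t * s))"
      unfolding fourier_weight_def by (simp only: complex_norm_square)
    also have "\<dots> = (\<Sum>s\<in>S. \<Sum>s'\<in>S. additive_char p (t * s) * additive_char p (- (t * s')))"
      by (simp add: sum_product additive_char_cnj)
    also have "\<dots> = (\<Sum>s\<in>S. \<Sum>s'\<in>S. additive_char p (t * (s - s')))"
      by (simp add: additive_char_add[symmetric] right_diff_distrib)
    finally show ?thesis .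
  qed
  have "(\<Sum>t\<in>{0..<p}. complex_of_real (fourier_weight p S t) * additive_char p (t * x))
     = (\<Sum>t\<in>{0..<p}. \<Sum>s\<in>S. \<Sum>s'\<in>S. additive_char p (t * (s + x - s')))"
  proof (rule sum.cong[OF refl])
    fix t
    have "additive_char p (t * (s - s')) * additive_char p (t * x) = additive_char p (t * (s + x - s'))" for s s'
      unfolding additive_char_add[symmetric] by (simp add: algebra_simps)
    then show "complex_of_real (fourier_weight p S t) * additive_char p (t * x)
       = (\<Sum>s\<in>S. \<Sum>s'\<in>S. additive_char p (t * (s + x - s')))"
      unfolding w sum_distrib_right by simp
  qed
  also have "\<dots> = (\<Sum>s\<in>S. \<Sum>s'\<in>S. \<Sum>t\<in>{0..<p}. additive_char p (t * (s + x - s')))"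
    by (subst sum.swap, rule sum.cong[OF refl], subst sum.swap, rule refl)
  also have "\<dots> = (\<Sum>s\<in>S. \<Sum>s'\<in>S. if s' = (s + x) mod p then of_int p else 0)"
  proof (intro sum.cong refl)
    fix s s' assume "s \<in> S" "s' \<in> S"
    then have "s' mod p = s'" using S by (auto simp: subset_iff)
    then have "p dvd (s + x - s') \<longleftrightarrow> s' = (s + x) mod p" by (metis mod_eq_dvd_iff)
    then show "(\<Sum>t\<in>{0..<p}. additive_char p (t * (s + x - s'))) = (if s' = (s + x) mod p then of_int p else 0)"
      using sum_additive_char[OF p] by simp
  qed
  also have "\<dots> = (\<Sum>s\<in>S. if (s + x) mod p \<in> S then of_int p else 0)"
    using fS by (simp add: sum.delta)
  also have "\<dots> = of_int p * of_nat (shift_overlap p S x)"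
    unfolding shift_overlap_def using fS by (simp add: sum.If_cases Int_def)
  finally have "Re (\<Sum>t\<in>{0..<p}. complex_of_real (fourier_weight p S t) * additive_char p (t * x))
     = Re (of_int p * of_nat (shift_overlap p S x))" by simp
  then show ?thesis by (simp add: additive_char_def)
qed

text \<open>p times the gain of \<open>x\<close> is the sum of the weights times 1 - cos(2 pi t x /
  p), where t = 0 contributes nothing. The weights at t \<noteq> 0 have total |S| (p - |S|), so some
  t \<noteq> 0 does no worse than the weighted average.\<close>

lemma exists_small_dilation:
  assumes p: "p > 1" and S: "S \<subseteq> {0..<p}" "S \<noteq> {}" "int (card S) < p"
  shows "\<exists>t\<in>{1..<p}. (\<Sum>i\<in>I. 1 - cos (2 * pi * real_of_int (t * x i) / real_of_int p)) *
       (real (card S) * (real_of_int p - real (card S))) \<le> real_of_int p * (\<Sum>i\<in>I. real (shift_gain p S (x i)))"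
proof (rule ccontr)
  assume "\<not> ?thesis"
  then have neg: "real_of_int p * (\<Sum>i\<in>I. real (shift_gain p S (x i))) <
     (\<Sum>i\<in>I. 1 - cos (2 * pi * real_of_int (t * x i) / real_of_int p)) *
       (real (card S) * (real_of_int p - real (card S)))" if "t \<in> {1..<p}" for t
    using that by (auto simp: not_le)
  have p0: "p > 0" using p by simp
  have fS: "finite S" using S finite_subset by blast
  define W where "W = fourier_weight p S"
  define D where "D = (\<lambda>t y. 1 - cos (2 * pi * real_of_int (t * y) / real_of_int p))"
  define n where "n = real (card S)"
  define q where "q = real_of_int p"
  have split: "{0..<p} = insert 0 {1..<p}" using p by auto
  have W0: "W 0 = n^2" unfolding W_def fourier_weight_def n_def by simp
  have "(\<Sum>t\<in>{0..<p}. W t) = q * n"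
  proof -
    have "shift_overlap p S 0 = card S" unfolding shift_overlap_def
      by (rule arg_cong[where f = card]) (use S in \<open>auto simp: subset_iff\<close>)
    then show ?thesis using sum_fourier_weight_cos[OF p0 S(1), of 0] by (simp add: W_def q_def n_def)
  qed
  note tot = this
  have tot': "(\<Sum>t\<in>{1..<p}. W t) = n * (q - n)"
    using tot W0 unfolding split by (simp add: algebra_simps power2_eq_square)
  have npos: "n * (q - n) > 0" unfolding n_def q_def using S fS
    by (simp add: card_gt_0_iff)
  have lamW: "q * real (shift_gain p S y) = (\<Sum>t\<in>{1..<p}. W t * D t y)" for y
  proof -
    have "real (shift_gain p S y) = n - real (shift_overlap p S y)" using shift_overlap_add_shift_gain[OF fS, of p y] unfolding n_def by linarith
    then have "q * real (shift_gain p S y) = q * n - q * real (shift_overlap p S y)" by (simp only: right_diff_distrib)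
    also have "\<dots> = (\<Sum>t\<in>{0..<p}. W t * D t y)"
      unfolding tot[symmetric] using sum_fourier_weight_cos[OF p0 S(1), of y]
      by (simp add: W_def q_def D_def algebra_simps sum_subtractf)
    also have "\<dots> = (\<Sum>t\<in>{1..<p}. W t * D t y)" unfolding split by (simp add: D_def)
    finally show ?thesis .
  qed
  define M where "M = q * (\<Sum>i\<in>I. real (shift_gain p S (x i)))"
  have "M = (\<Sum>t\<in>{1..<p}. W t * (\<Sum>i\<in>I. D t (x i)))"
    unfolding M_def sum_distrib_left lamW by (rule sum.swap)
  then have "M * (n * (q - n)) = (\<Sum>t\<in>{1..<p}. W t * ((\<Sum>i\<in>I. D t (x i)) * (n * (q - n))))"
    by (simp add: sum_distrib_right mult.assoc)
  moreover have "(\<Sum>t\<in>{1..<p}. W t * M) < (\<Sum>t\<in>{1..<p}. W t * ((\<Sum>i\<in>I. D t (x i)) * (n * (q - n))))"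
  proof (rule sum_strict_mono_ex1)
    show "\<forall>t\<in>{1..<p}. W t * M \<le> W t * ((\<Sum>i\<in>I. D t (x i)) * (n * (q - n)))"
      using less_imp_le[OF neg] fourier_weight_nonneg[of p S] unfolding W_def M_def D_def n_def q_def
      by (intro ballI mult_left_mono) auto
    have "\<exists>t\<in>{1..<p}. W t > 0"
    proof (rule ccontr)
      assume "\<not> ?thesis"
      then have "(\<Sum>t\<in>{1..<p}. W t) \<le> 0" by (intro sum_nonpos) (auto simp: not_less)
      then show False using tot' npos by simp
    qed
    then obtain t where t: "t \<in> {1..<p}" "W t > 0" by auto
    then have "W t * M < W t * ((\<Sum>i\<in>I. D t (x i)) * (n * (q - n)))"
      using neg[OF t(1)] unfolding M_def D_def n_def q_def by simp
    then show "\<exists>t\<in>{1..<p}. W t * M < W t * ((\<Sum>i\<in>I. D t (x i)) * (n * (q - n)))" using t by blast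
  qed simp
  moreover have "(\<Sum>t\<in>{1..<p}. W t * M) = M * (n * (q - n))"
    unfolding tot'[symmetric] by (simp add: sum_distrib_left mult.commute)
  ultimately show False by simp
qed

section \<open>Cosine sums\<close>

lemma sin_lower:
  assumes "0 \<le> x" "x \<le> pi / 2"
  shows "x / 3 \<le> sin x"
proof -
  have "\<bar>sin x - (\<Sum>m<3. sin_coeff m * x ^ m)\<bar> \<le> inverse (fact 3) * \<bar>x\<bar> ^ 3"
    by (rule Maclaurin_sin_bound)
  then have 1: "\<bar>sin x - x\<bar> \<le> x ^ 3 / 6"
    using assms by (simp add: eval_nat_numeral sin_coeff_def)
  have x2: "x \<le> 2" using assms pi_less_4 by linarith
  have "x * x \<le> 2 * 2" using mult_mono[OF x2 x2] assms(1) by simp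
  then have "x * (x * x) \<le> x * 4" using assms by (intro mult_left_mono) auto
  moreover have "x ^ 3 = x * (x * x)" by (simp add: power3_eq_cube)
  ultimately show ?thesis using 1 by linarith
qed

text \<open>The Dirichlet kernel, multiplied out so that sin (y / 2) may vanish.\<close>

lemma sum_cos_sin:
  "2 * sin (y / 2) * (\<Sum>i=1..j. cos (real i * y)) = sin ((real j + 1 / 2) * y) - sin (y / 2)"
proof (induction j)
  case (Suc j)
  have "2 * sin (y / 2) * (\<Sum>i=1..Suc j. cos (real i * y))
     = sin ((real j + 1 / 2) * y) - sin (y / 2) + 2 * sin (y / 2) * cos (real (Suc j) * y)"
    using Suc by (simp add: algebra_simps)
  also have "2 * sin (y / 2) * cos (real (Suc j) * y)
      = sin (y / 2 + real (Suc j) * y) + sin (y / 2 - real (Suc j) * y)"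
    by (simp add: sin_add sin_diff)
  also have "sin (y / 2 - real (Suc j) * y) = - sin ((real j + 1 / 2) * y)"
    by (subst sin_minus[symmetric]) (simp add: algebra_simps)
  finally show ?case by (simp add: algebra_simps)
qed simp

text \<open>Only multiples \<open>i\<close> up to \<open>j\<close> are summed, hence any \<open>c\<close> beyond \<open>2p/j\<close> is detected.\<close>

lemma sum_cos_le:
  fixes c p :: real
  assumes p: "p > 0" and c: "2 * \<bar>c\<bar> \<le> p" "2 * p \<le> real j * \<bar>c\<bar>"
  shows "(\<Sum>i=1..j. cos (2 * pi * (real i * c) / p)) \<le> real j / 2"
proof -
  define y where "y = 2 * pi * \<bar>c\<bar> / p"
  have cpos: "\<bar>c\<bar> > 0" using p c(2) by (cases "c = 0") auto
  have "cos (2 * pi * (real i * c) / p) = cos (real i * y)" for i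
  proof (cases "c \<ge> 0")
    case True then show ?thesis unfolding y_def by (simp add: algebra_simps)
  next
    case False
    then have "2 * pi * (real i * c) / p = - (real i * y)" unfolding y_def by (simp add: algebra_simps)
    then show ?thesis by simp
  qed
  then have eq: "(\<Sum>i=1..j. cos (2 * pi * (real i * c) / p)) = (\<Sum>i=1..j. cos (real i * y))" by simp
  have y0: "0 < y / 2" unfolding y_def using p cpos by simp
  have "\<bar>c\<bar> / p \<le> 1 / 2" using c p by (simp add: field_simps)
  then have "pi * (\<bar>c\<bar> / p) \<le> pi * (1 / 2)" by (intro mult_left_mono) auto
  then have yu: "y / 2 \<le> pi / 2" unfolding y_def by simp
  have s: "y / 6 \<le> sin (y / 2)" using sin_lower[of "y / 2"] y0 yu by simp
  then have spos: "sin (y / 2) > 0" using y0 by linarith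
  have "pi * (real j * \<bar>c\<bar> / p) \<ge> 2 * 2"
    by (intro mult_mono) (use pi_ge_two p c in \<open>auto simp: field_simps\<close>)
  then have jy: "real j * (y / 6) \<ge> 1" unfolding y_def by (simp add: field_simps)
  then have js: "real j * sin (y / 2) \<ge> 1"
    using mult_left_mono[OF s, of "real j"] by linarith
  have "2 * sin (y / 2) * (\<Sum>i=1..j. cos (real i * y)) \<le> 1 - sin (y / 2)"
    unfolding sum_cos_sin using sin_le_one by simp
  also have "\<dots> \<le> real j * sin (y / 2)" using js spos by linarith
  finally have "sin (y / 2) * (2 * (\<Sum>i=1..j. cos (real i * y))) \<le> sin (y / 2) * real j"
    by (simp add: algebra_simps)
  then have "2 * (\<Sum>i=1..j. cos (real i * y)) \<le> real j" using spos by simp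
  then show ?thesis using eq by simp
qed

text \<open>For odd \<open>p\<close> this is the representative in \<open>(-p/2, p/2)\<close>.\<close>

definition centred :: "int \<Rightarrow> int \<Rightarrow> int" where
  "centred p x = (x + p div 2) mod p - p div 2"

lemma centred_cong: "centred p x mod p = x mod p"
  unfolding centred_def by (simp add: mod_simps)

lemma centred_bounds:
  assumes "p > 0" "odd p"
  shows "2 * \<bar>centred p x\<bar> < p"
proof -
  have "0 \<le> (x + p div 2) mod p" "(x + p div 2) mod p < p" using assms by auto
  moreover have "p = 2 * (p div 2) + 1" using assms by simp
  ultimately show ?thesis unfolding centred_def abs_if by (auto split: if_splits)
qed

lemma cos_mod_p:
  fixes p a b :: int
  assumes "p > 0" "a mod p = b mod p"
  shows "cos (2 * pi * real_of_int a / real_of_int p) = cos (2 * pi * real_of_int b / real_of_int p)"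
proof -
  obtain n where "a - b = p * n" using assms(2) by (metis mod_eq_dvd_iff dvdE)
  then have "a = b + p * n" by simp
  then have "2 * pi * real_of_int a / real_of_int p
     = 2 * pi * real_of_int b / real_of_int p + (2 * pi) * of_int n"
    using assms(1) by (simp add: field_simps)
  then show ?thesis by (simp add: cos_add cos_int_2pin sin_int_2pin)
qed

text \<open>Markov's inequality. An element dilated to distance at least 2p / j from 0 contributes
  at least j / 2 to the sum of 1 - cos over its multiples up to \<open>j\<close>, while
  subadditivity bounds the gains of these multiples by K (1 + ... + j).\<close>

lemma concentrated_dilation:
  assumes p: "p > 1" "odd p" and S: "S \<subseteq> {0..<p}" "S \<noteq> {}" "int (card S) < p"
    and B: "finite B" "\<And>a. a \<in> B \<Longrightarrow> shift_gain p S a \<le> K" and j: "j > 0"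
  shows "\<exists>t\<in>{1..<p}. real (card {a \<in> B. 2 * p \<le> int j * \<bar>centred p (t * a)\<bar>}) *
       (real (card S) * (real_of_int p - real (card S))) \<le> real (card B) * real K * (real j + 1) * real_of_int p"
proof -
  have p0: "p > 0" using p by simp
  define I where "I = B \<times> {1..j}"
  define x where "x = (\<lambda>(a::int, i::nat). int i * a)"
  define D where "D = real (card S) * (real_of_int p - real (card S))"
  have D0: "D \<ge> 0" unfolding D_def using S by simp
  obtain t where t: "t \<in> {1..<p}"
    "(\<Sum>i\<in>I. 1 - cos (2 * pi * real_of_int (t * x i) / real_of_int p)) * D
       \<le> real_of_int p * (\<Sum>i\<in>I. real (shift_gain p S (x i)))"
    using exists_small_dilation[OF p(1) S] unfolding D_def by blast
  have gauss: "(\<Sum>i=1..j. real i) = real j * (real j + 1) / 2"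
    by (induction j) (simp_all add: field_simps)
  have "(\<Sum>i\<in>I. real (shift_gain p S (x i))) = (\<Sum>a\<in>B. \<Sum>i=1..j. real (shift_gain p S (int i * a)))"
    unfolding I_def x_def sum.cartesian_product by (simp add: split_def)
  also have "\<dots> \<le> (\<Sum>a\<in>B. \<Sum>i=1..j. real i * real K)"
  proof (intro sum_mono)
    fix a i assume "a \<in> B"
    have "shift_gain p S (int i * a) \<le> i * shift_gain p S a" by (rule shift_gain_mult[OF S(1)])
    also have "\<dots> \<le> i * K" using B(2)[OF \<open>a \<in> B\<close>] by simp
    finally show "real (shift_gain p S (int i * a)) \<le> real i * real K"
      by (metis of_nat_le_iff of_nat_mult)
  qed
  also have "\<dots> = real (card B) * (real j * (real j + 1) / 2 * real K)"
    using gauss by (simp add: sum_distrib_right[symmetric])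
  finally have up: "(\<Sum>i\<in>I. real (shift_gain p S (x i))) \<le> real (card B) * (real j * (real j + 1) / 2 * real K)" .
  define bad where "bad = {a \<in> B. 2 * p \<le> int j * \<bar>centred p (t * a)\<bar>}"
  define T where "T = (\<lambda>a. \<Sum>i=1..j. 1 - cos (2 * pi * real_of_int (t * (int i * a)) / real_of_int p))"
  have T0: "T a \<ge> 0" for a unfolding T_def by (intro sum_nonneg) auto
  have Tbad: "T a \<ge> real j / 2" if "a \<in> bad" for a
  proof -
    define c where "c = centred p (t * a)"
    have "cos (2 * pi * real_of_int (t * (int i * a)) / real_of_int p)
       = cos (2 * pi * (real i * real_of_int c) / real_of_int p)" for i
    proof -
      have "(t * (int i * a)) mod p = (int i * ((t * a) mod p)) mod p"
        by (simp add: mod_simps algebra_simps)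
      also have "\<dots> = (int i * c) mod p"
        unfolding c_def using centred_cong[of p "t * a"] by (metis mod_mult_right_eq)
      finally show ?thesis using cos_mod_p[OF p0] by fastforce
    qed
    moreover have "(\<Sum>i=1..j. cos (2 * pi * (real i * real_of_int c) / real_of_int p)) \<le> real j / 2"
    proof (rule sum_cos_le)
      show "0 < real_of_int p" using p0 by simp
      show "2 * \<bar>real_of_int c\<bar> \<le> real_of_int p" using centred_bounds[OF p0 p(2), of "t * a"] unfolding c_def by linarith
      have "2 * p \<le> int j * \<bar>c\<bar>" using that unfolding bad_def c_def by simp
      then have "real_of_int (2 * p) \<le> real_of_int (int j * \<bar>c\<bar>)" by (simp only: of_int_le_iff)
      then show "2 * real_of_int p \<le> real j * \<bar>real_of_int c\<bar>" by simp
    qed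
    ultimately show ?thesis unfolding T_def by (simp add: sum_subtractf)
  qed
  have "real (card bad) * (real j / 2) = (\<Sum>a\<in>bad. real j / 2)" by simp
  also have "\<dots> \<le> (\<Sum>a\<in>bad. T a)" by (intro sum_mono Tbad)
  also have "\<dots> \<le> (\<Sum>a\<in>B. T a)"
    by (rule sum_mono2[OF B(1)]) (use T0 in \<open>auto simp: bad_def\<close>)
  also have "\<dots> = (\<Sum>i\<in>I. 1 - cos (2 * pi * real_of_int (t * x i) / real_of_int p))"
    unfolding I_def x_def T_def by (simp add: sum.cartesian_product split_def)
  finally have "real (card bad) * (real j / 2) * D \<le>
     (\<Sum>i\<in>I. 1 - cos (2 * pi * real_of_int (t * x i) / real_of_int p)) * D"
    using D0 by (rule mult_right_mono)
  also have "\<dots> \<le> real_of_int p * (real (card B) * (real j * (real j + 1) / 2 * real K))"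
    using t(2) mult_left_mono[OF up, of "real_of_int p"] p0 by linarith
  finally have "(real j / 2) * (real (card bad) * D)
     \<le> (real j / 2) * (real (card B) * real K * (real j + 1) * real_of_int p)"
    by (simp add: algebra_simps)
  then have "real (card bad) * D \<le> real (card B) * real K * (real j + 1) * real_of_int p"
    using j by simp
  then show ?thesis using t(1) unfolding bad_def D_def by blast
qed

lemma nat_div_lower:
  fixes a b :: nat
  assumes "b > 0" "b \<le> a"
  shows "real a \<le> 2 * real b * real (a div b)"
proof -
  have "a < b * (a div b) + b" using assms(1) by (metis add.commute dividend_less_div_times mult.commute)
  moreover have "1 \<le> a div b" using assms by (simp add: Suc_le_eq div_greater_zero_iff)
  then have "b \<le> b * (a div b)" by simp
  ultimately have "a \<le> 2 * b * (a div b)" by linarith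
  then have "real a \<le> real (2 * b * (a div b))" by (simp only: of_nat_le_iff)
  then show ?thesis by simp
qed

lemma nat_div_upper: "real b * real (a div b) \<le> real a" for a b :: nat
proof -
  have "b * (a div b) \<le> a" by simp
  then have "real (b * (a div b)) \<le> real a" by (simp only: of_nat_le_iff)
  then show ?thesis by simp
qed

lemma zero_free_dilation:
  fixes E :: nat
  assumes E: "E \<ge> 1"
  shows "\<exists>C N. C \<ge> 1 \<and> (\<forall>p A. prime p \<longrightarrow> int N \<le> p \<longrightarrow> odd p \<longrightarrow> zero_free_mod p A \<longrightarrow> p \<le> (int (card A))\<^sup>2 \<longrightarrow>
     (\<exists>t\<in>{1..<p}. E * card {a \<in> A. int (C * card A) < \<bar>centred p (t * a)\<bar>} \<le> card A))"
proof -
  \<comment> \<open>With h >= k / (16 E) and K >= h / 32, k^2 is at most (16 E)^2 * 32 * K * h = c0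
    * K * h, so that m = p div c0 lies within the quadratic growth. \<open>C\<close> is 2 * 16 E *
    128 E * c0, which turns the lower bound for \<open>j\<close> below into 2p / j <= C * k.\<close>
  define c0 :: nat where "c0 = 8192 * E\<^sup>2"
  define k0 :: nat where "k0 = 16 * E * (64 * E * c0)"
  define C :: nat where "C = 4096 * E\<^sup>2 * c0"
  have c0: "c0 \<ge> 8192" "c0 > 0" unfolding c0_def using E by auto
  have k0: "k0 \<ge> 16 * E * 16" "k0 \<ge> 4 * c0" "k0 > 0"
    unfolding k0_def using E c0 by (auto simp: algebra_simps)
  have "\<exists>t\<in>{1..<p}. E * card {a \<in> A. int (C * card A) < \<bar>centred p (t * a)\<bar>} \<le> card A"
    if p: "prime p" "int (k0\<^sup>2) \<le> p" "odd p" and A: "zero_free_mod p A" and kp: "p \<le> (int (card A))\<^sup>2" for p A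
  proof -
    have p1: "p > 1" using p prime_gt_1_int by blast
    then have p0: "p > 0" by simp
    have fA: "finite A" using A unfolding zero_free_mod_def by auto
    define k where "k = card A"
    define P where "P = real_of_int p"
    have P0: "P > 0" unfolding P_def using p0 by simp
    have "int (k0\<^sup>2) \<le> (int k)\<^sup>2" using p kp unfolding k_def by linarith
    then have "k0\<^sup>2 \<le> k\<^sup>2" by (metis of_nat_le_iff of_nat_power)
    then have k: "k0 \<le> k" by (simp add: power2_nat_le_eq_le)
    have kpos: "real k > 0" using k k0 by simp
    have kP: "k \<le> nat p" unfolding k_def using card_sums_mod_ge[OF p0 A] card_sums_mod_le[OF p0, of A] by linarith
    have Pk: "P \<le> real k * real k"
    proof -
      have "real_of_int p \<le> real_of_int ((int k)\<^sup>2)" using kp unfolding k_def by (simp only: of_int_le_iff)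
      then show ?thesis unfolding P_def by (simp add: power2_eq_square)
    qed
    have k0p: "int k0 \<le> p"
    proof -
      have "int k0 \<le> int (k0\<^sup>2)" using k0(3) by (simp add: power2_eq_square)
      then show ?thesis using p by linarith
    qed
    define h where "h = k div (8 * E)"
    have hk: "real k \<le> 16 * real E * real h"
      using nat_div_lower[of "8 * E" k] E k k0 unfolding h_def by simp
    have hk2: "8 * real E * real h \<le> real k"
      using nat_div_upper[of "8 * E" k] unfolding h_def by simp
    have hk3: "8 * E * h \<le> k" unfolding h_def by simp
    have "real (16 * E * (64 * E * c0)) \<le> 16 * real E * real h" using hk k unfolding k0_def by linarith
    then have "(16 * real E) * real (64 * E * c0) \<le> (16 * real E) * real h" by simp
    then have "real (64 * E * c0) \<le> real h" using E by (subst (asm) mult_le_cancel_left_pos) auto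
    then have hb: "64 * E * c0 \<le> h" by (simp only: of_nat_le_iff)
    have "64 * 1 * 8192 \<le> 64 * E * c0" using E c0 by (intro mult_le_mono) auto
    then have h16: "16 \<le> h" using hb by linarith
    define K where "K = h div 16"
    have K8: "8 * K < h" unfolding K_def using h16 by linarith
    have KK: "real h \<le> 32 * real K" using nat_div_lower[of 16 h] h16 unfolding K_def by simp
    define m where "m = nat p div c0"
    have pc0: "4 * c0 \<le> nat p" using k0p k0 by linarith
    have mu: "real c0 * real m \<le> P" using nat_div_upper[of c0 "nat p"] p0 unfolding m_def P_def by simp
    have "nat p < c0 * m + c0" unfolding m_def using c0 by (metis add.commute dividend_less_div_times mult.commute)
    then have "real (nat p) < real (c0 * m + c0)" by (simp only: of_nat_less_iff)
    then have ml: "P < real c0 * (real m + 1)" unfolding P_def using p0 by (simp add: algebra_simps)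
    have P4: "4 * real c0 \<le> P"
    proof -
      have "real (4 * c0) \<le> real (nat p)" using pc0 by (simp only: of_nat_le_iff)
      then show ?thesis unfolding P_def using p0 by simp
    qed
    have mKh: "m \<le> K * h"
    proof -
      have "real k * real k \<le> (16 * real E * real h) * (16 * real E * real h)"
        using hk by (intro mult_mono) auto
      also have "\<dots> \<le> (16 * real E * real h) * (16 * real E * (32 * real K))"
        using KK by (intro mult_left_mono) auto
      also have "\<dots> = real c0 * (real K * real h)" unfolding c0_def by (simp add: power2_eq_square)
      finally have "real c0 * real m \<le> real c0 * (real K * real h)" using mu Pk by linarith
      then have "real m \<le> real (K * h)" using c0 by simp
      then show ?thesis by (simp only: of_nat_le_iff)
    qed
    have m2: "2 * int m \<le> p"
    proof -
      have "2 * real m \<le> real c0 * real m" using c0 by (intro mult_right_mono) auto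
      then have "real_of_int (2 * int m) \<le> real_of_int p" using mu unfolding P_def by simp
      then show ?thesis by (simp only: of_int_le_iff)
    qed
    define K2 where "K2 = nat p div h + 1"
    have hpos: "h > 0" using h16 by simp
    have K2a: "nat p \<le> K2 * h" unfolding K2_def using hpos
      by (metis Suc_eq_plus1 dividend_less_div_times less_imp_le mult.commute mult_Suc add.commute)
    have K2b: "real h * real K2 \<le> 2 * P"
    proof -
      have "real h * real (nat p div h) \<le> P" using nat_div_upper[of h "nat p"] p0 unfolding P_def by simp
      moreover have "real h \<le> P"
      proof -
        have "h \<le> k" unfolding h_def by simp
        then have "int h \<le> p" using kP p0 by linarith
        then have "real_of_int (int h) \<le> real_of_int p" by (simp only: of_int_le_iff)
        then show ?thesis unfolding P_def by simp
      qed
      ultimately show ?thesis unfolding K2_def by (simp add: algebra_simps)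
    qed
    have "8 * 1 * h \<le> 8 * E * h" using E by (intro mult_le_mono) auto
    then have "7 * h \<le> card A" using hk3 unfolding k_def by linarith
    then obtain Y where Y: "Y \<subseteq> A" "card Y \<le> 4 * h" "m \<le> card (sums_mod p Y)" "card (sums_mod p Y) + m \<le> nat p + 1"
        "\<forall>a\<in>A - Y. shift_gain p (sums_mod p Y) a \<le> K2"
      using sums_mod_stationary[OF p(1) A _ K8 K2a mKh m2] by auto
    define S where "S = sums_mod p Y"
    define s where "s = real (card S)"
    have s1: "real m \<le> s" unfolding s_def S_def using Y by simp
    have s2: "real m - 1 \<le> P - s"
    proof -
      have "real (card (sums_mod p Y) + m) \<le> real (nat p + 1)" using Y(4) by (simp only: of_nat_le_iff)
      then show ?thesis unfolding s_def S_def P_def using p0 by simp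
    qed
    have cm: "P \<le> 4 * real c0 * (real m - 1)"
    proof -
      have "4 * real c0 * (real m - 1) = 4 * (real c0 * (real m + 1)) - 8 * real c0" by (simp add: algebra_simps)
      then show ?thesis using ml P4 by linarith
    qed
    then have m1: "real m - 1 > 0" using P0 c0
      by (metis (no_types) less_le_trans mult_le_0_iff not_le of_nat_0_less_iff zero_less_mult_pos zero_less_numeral
          mult_pos_pos)
    \<comment> \<open>Both factors are at least of order P / c0, and one of them is at least P /
      2.\<close>
    have D: "P * P \<le> 8 * real c0 * (s * (P - s))"
    proof (cases "2 * s \<ge> P")
      case True
      have "P * P \<le> (2 * s) * (4 * real c0 * (real m - 1))"
        by (intro mult_mono) (use True cm P0 s1 in auto)
      also have "\<dots> = 8 * real c0 * (s * (real m - 1))" by simp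
      also have "\<dots> \<le> 8 * real c0 * (s * (P - s))"
        by (intro mult_left_mono) (use s2 s1 in auto)
      finally show ?thesis .
    next
      case False
      have "P * P \<le> (4 * real c0 * s) * (2 * (P - s))"
      proof (intro mult_mono)
        have "4 * real c0 * (real m - 1) \<le> 4 * real c0 * s" using s1 by (intro mult_left_mono) auto
        then show "P \<le> 4 * real c0 * s" using cm by linarith
      qed (use False s1 P0 in auto)
      then show ?thesis by (simp add: algebra_simps)
    qed
    have Sr: "S \<subseteq> {0..<p}" unfolding S_def by (rule sums_mod_range[OF p0])
    have Sn: "S \<noteq> {}" using s1 m1 unfolding s_def by auto
    have "s < P" using s2 m1 by linarith
    then have Sp: "int (card S) < p" unfolding s_def P_def by linarith
    \<comment> \<open>Small enough that the bad elements number at most k / (2E), as do the 4 * h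
      elements of \<open>Y\<close>; large enough that 2p / j stays below C * k.\<close>
    define j where "j = h div (64 * E * c0)"
    have Ec: "64 * E * c0 > 0" using E c0 by simp
    have j1: "1 \<le> j" unfolding j_def using hb Ec by (simp add: Suc_le_eq div_greater_zero_iff)
    have ju: "64 * real E * real c0 * real j \<le> real h"
      using nat_div_upper[of "64 * E * c0" h] unfolding j_def by simp
    have jl: "real h \<le> 128 * real E * real c0 * real j"
      using nat_div_lower[OF Ec hb] unfolding j_def by simp
    define bad where "bad = (\<lambda>t. {a \<in> A - Y. 2 * p \<le> int j * \<bar>centred p (t * a)\<bar>})"
    obtain t where t: "t \<in> {1..<p}" "real (card (bad t)) * (s * (P - s)) \<le> real (card (A - Y)) * real K2 * (real j + 1) * P"
      using concentrated_dilation[OF p1 p(3) Sr Sn Sp, of "A - Y" K2 j] fA Y(5) j1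
      unfolding s_def P_def bad_def S_def by auto
    have "real (card (A - Y)) \<le> real k" unfolding k_def using card_mono[OF fA, of "A - Y"] by simp
    then have "real (card (A - Y)) * real K2 * (real j + 1) * P \<le> real k * real K2 * (2 * real j) * P"
      using j1 P0 by (intro mult_mono) auto
    then have "(64 * real E * real c0) * (real (card (bad t)) * (s * (P - s)))
       \<le> (64 * real E * real c0) * (real k * real K2 * (2 * real j) * P)"
      using t(2) by (intro mult_left_mono) auto
    also have "\<dots> = (64 * real E * real c0 * real j) * (2 * real k * real K2 * P)" by (simp add: algebra_simps)
    also have "\<dots> \<le> real h * (2 * real k * real K2 * P)" using ju P0 by (intro mult_right_mono) auto
    also have "\<dots> = (real h * real K2) * (2 * real k * P)" by (simp add: algebra_simps)
    also have "\<dots> \<le> (2 * P) * (2 * real k * P)" using K2b P0 by (intro mult_right_mono) auto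
    finally have b1: "(8 * real E * real (card (bad t))) * (8 * real c0 * (s * (P - s))) \<le> (P * P) * (4 * real k)"
      by (simp add: algebra_simps)
    have "(8 * real E * real (card (bad t))) * (P * P) \<le> (8 * real E * real (card (bad t))) * (8 * real c0 * (s * (P - s)))"
      using D by (intro mult_left_mono) auto
    then have "(P * P) * (8 * real E * real (card (bad t))) \<le> (P * P) * (4 * real k)" using b1 by (simp add: mult.commute)
    then have "8 * real E * real (card (bad t)) \<le> 4 * real k" using P0 by simp
    then have "real (2 * (E * card (bad t))) \<le> real k" by simp
    then have b2: "2 * (E * card (bad t)) \<le> k" by (simp only: of_nat_le_iff)
    have sub: "{a \<in> A. int (C * card A) < \<bar>centred p (t * a)\<bar>} \<subseteq> Y \<union> bad t"
    proof
      fix a assume a: "a \<in> {a \<in> A. int (C * card A) < \<bar>centred p (t * a)\<bar>}"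
      show "a \<in> Y \<union> bad t"
      proof (rule ccontr)
        assume "a \<notin> Y \<union> bad t"
        then have "int j * \<bar>centred p (t * a)\<bar> < 2 * p" using a unfolding bad_def by auto
        then have "real_of_int (int j * \<bar>centred p (t * a)\<bar>) < real_of_int (2 * p)" by (simp only: of_int_less_iff)
        then have x: "real j * real_of_int \<bar>centred p (t * a)\<bar> < 2 * P" unfolding P_def by simp
        have "real_of_int (int (C * card A)) < real_of_int \<bar>centred p (t * a)\<bar>" using a by (simp only: of_int_less_iff) simp
        then have "real j * (real C * real k) \<le> real j * real_of_int \<bar>centred p (t * a)\<bar>"
          unfolding k_def by (intro mult_left_mono) auto
        then have y: "real j * real C * real k < 2 * P" using x by simp
        have "real k \<le> 16 * real E * (128 * real E * real c0 * real j)"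
          using hk mult_left_mono[OF jl, of "16 * real E"] by linarith
        also have "16 * real E * (128 * real E * real c0 * real j) * 2 = real C * real j"
          unfolding C_def by (simp add: power2_eq_square)
        then have "16 * real E * (128 * real E * real c0 * real j) = real C * real j / 2" by simp
        finally have "2 * real k \<le> real C * real j" by simp
        then have "2 * real k * real k \<le> real j * real C * real k"
          by (intro mult_right_mono) (auto simp: mult.commute)
        then show False using y Pk by linarith
      qed
    qed
    have "card {a \<in> A. int (C * card A) < \<bar>centred p (t * a)\<bar>} \<le> card (Y \<union> bad t)"
      by (rule card_mono[OF _ sub]) (use fA Y finite_subset in \<open>auto simp: bad_def\<close>)
    also have "\<dots> \<le> 4 * h + card (bad t)" using card_Un_le[of Y "bad t"] Y(2) by linarith
    finally have "E * card {a \<in> A. int (C * card A) < \<bar>centred p (t * a)\<bar>} \<le> E * (4 * h + card (bad t))"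
      by (rule mult_le_mono2)
    also have "\<dots> \<le> k" using hk3 b2 by (simp add: algebra_simps)
    finally show ?thesis using t(1) unfolding k_def by blast
  qed
  moreover have "C \<ge> 1" unfolding C_def using E c0 by simp
  ultimately show ?thesis by (intro exI[of _ C] exI[of _ "k0\<^sup>2"]) blast
qed

subsection \<open>Arithmetic progressions of subset sums\<close>

text \<open>\<open>R\<close> counts steps, so the progression has R + 1 terms. The sums are nonempty
  so that zero-freeness applies to them.\<close>

definition covers :: "int set \<Rightarrow> int \<Rightarrow> int \<Rightarrow> nat \<Rightarrow> bool" where
  "covers Y x d R \<longleftrightarrow> (\<forall>i\<le>R. \<exists>Z\<subseteq>Y. Z \<noteq> {} \<and> \<Sum>Z = x + d * int i)"

lemma covers_mono: "covers Y x d R \<Longrightarrow> R' \<le> R \<Longrightarrow> Y \<subseteq> Y' \<Longrightarrow> covers Y' x d R'"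
  unfolding covers_def by (meson order_trans)

text \<open>Exactly one of the two new elements is used: the first gives the offsets 0..R, the
  second q..R + q, and q <= R + 1 leaves no gap.\<close>

lemma covers_pair:
  assumes c: "covers Y x d R" and Y: "finite Y" "y \<notin> Y" "y + d * int q \<notin> Y" and q: "q \<le> R + 1"
  shows "covers (insert y (insert (y + d * int q) Y)) (x + y) d (R + q)"
  unfolding covers_def
proof (intro allI impI)
  fix i assume i: "i \<le> R + q"
  show "\<exists>Z\<subseteq>insert y (insert (y + d * int q) Y). Z \<noteq> {} \<and> \<Sum>Z = x + y + d * int i"
  proof (cases "i \<le> R")
    case True
    then obtain Z where Z: "Z \<subseteq> Y" "\<Sum>Z = x + d * int i" using c unfolding covers_def by blast
    then have "finite Z" "y \<notin> Z" using Y finite_subset by auto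
    then show ?thesis using Z by (intro exI[of _ "insert y Z"]) auto
  next
    case False
    then have iq: "i - q \<le> R" "q \<le> i" using i q by auto
    then obtain Z where Z: "Z \<subseteq> Y" "\<Sum>Z = x + d * int (i - q)" using c unfolding covers_def by blast
    then have "finite Z" "y + d * int q \<notin> Z" using Y finite_subset by auto
    then show ?thesis using Z iq
      by (intro exI[of _ "insert (y + d * int q) Z"]) (auto simp: algebra_simps of_nat_diff)
  qed
qed

lemma covers_pairs:
  assumes "finite T" "T \<noteq> {}" "d > 0" "\<And>y. y \<in> T \<Longrightarrow> y + d \<notin> T"
  shows "\<exists>x. covers (T \<union> (\<lambda>y. y + d) ` T) x d (card T)"
  using assms
proof (induction T rule: finite_ne_induct)
  case (singleton y)
  have "covers {y, y + d} y d 1"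
    unfolding covers_def
  proof (intro allI impI)
    fix i :: nat assume "i \<le> 1"
    then consider "i = 0" | "i = 1" by linarith
    then show "\<exists>Z\<subseteq>{y, y + d}. Z \<noteq> {} \<and> \<Sum>Z = y + d * int i"
    proof cases
      case 1 then show ?thesis by (intro exI[of _ "{y}"]) auto
    next
      case 2 then show ?thesis by (intro exI[of _ "{y + d}"]) auto
    qed
  qed
  then show ?case by (intro exI[of _ y]) (simp add: insert_commute)
next
  case (insert y T)
  then obtain x where x: "covers (T \<union> (\<lambda>y. y + d) ` T) x d (card T)" by auto
  have "covers (insert y (insert (y + d * int 1) (T \<union> (\<lambda>y. y + d) ` T))) (x + y) d (card T + 1)"
  proof (rule covers_pair[OF x])
    show "finite (T \<union> (\<lambda>y. y + d) ` T)" using insert by auto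
    show "y \<notin> T \<union> (\<lambda>y. y + d) ` T" using insert by auto
    show "y + d * int 1 \<notin> T \<union> (\<lambda>y. y + d) ` T" using insert by auto
  qed simp
  then have "covers (insert y T \<union> (\<lambda>y. y + d) ` insert y T) (x + y) d (card (insert y T))"
    using insert by (simp add: insert_commute)
  then show ?case by blast
qed

lemma card_interval_div:
  fixes L l :: int
  assumes "l > 0" "L \<ge> 0"
  shows "(\<lambda>x. x div l) ` {- L..L} \<subseteq> {(- L) div l..L div l}"
    and "int (card {(- L) div l..L div l}) \<le> 2 * L div l + 2"
proof -
  show "(\<lambda>x. x div l) ` {- L..L} \<subseteq> {(- L) div l..L div l}"
    using assms by (auto intro: zdiv_mono1)
  have 1: "L div l * l + (L mod l) = L" "0 \<le> L mod l" using assms by simp_all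
  have 2: "(-L) div l * l + ((-L) mod l) = -L" "(-L) mod l < l" using assms by simp_all
  have a: "(L div l) * l \<le> L" and b: "- L < ((-L) div l) * l + l" using 1 2 by linarith+
  have "(L div l - (-L) div l) * l < 2 * L + l" unfolding left_diff_distrib using a b by linarith
  then have "(L div l - (-L) div l - 1) * l \<le> 2 * L" by (simp add: algebra_simps)
  then have "((L div l - (-L) div l - 1) * l) div l \<le> 2 * L div l" by (rule zdiv_mono1[OF _ assms(1)])
  then have "L div l - (-L) div l - 1 \<le> 2 * L div l" using assms(1) by simp
  moreover have "(-L) div l \<le> L div l" by (rule zdiv_mono1) (use assms in auto)
  then have "int (card {(- L) div l..L div l}) = L div l - (-L) div l + 1" by simp
  ultimately show "int (card {(- L) div l..L div l}) \<le> 2 * L div l + 2" by linarith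
qed

text \<open>
  Restricting to one parity of \<open>y div d\<close> makes the pairs \<open>{y, y + d}\<close> disjoint, so that each of them can
  contribute a step \<open>d\<close> independently.
\<close>

lemma exists_common_difference:
  fixes w :: nat and L :: int
  assumes X: "finite X" "X \<subseteq> {- L..L}" "L \<ge> 0" and w: "w > 0"
  shows "\<exists>d\<in>{1..int w}. \<exists>T\<subseteq>X. (\<forall>y\<in>T. y + d \<in> X \<and> y + d \<notin> T) \<and>
     int (card X) \<le> 2 * int w * int (card T) + 2 * L div int w + 2"
proof -
  define G where "G = {x \<in> X. \<exists>d\<in>{1..int w}. x + d \<in> X}"
  define H where "H = (\<lambda>d. {x \<in> X. x + d \<in> X})"
  have fG: "finite G" unfolding G_def using X by simp
  \<comment> \<open>Of two elements in one block of length \<open>w\<close>, the smaller lies in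
    \<open>G\<close>; hence at most one element per block is outside \<open>G\<close>.\<close>
  have inj: "inj_on (\<lambda>x. x div int w) (X - G)"
  proof -
    have "x = y" if "x \<in> X - G" "y \<in> X - G" "x div int w = y div int w" "x \<le> y" for x y
    proof (rule ccontr)
      assume "x \<noteq> y"
      have "x = int w * (x div int w) + x mod int w" "y = int w * (x div int w) + y mod int w"
        using that(3) by (metis mult_div_mod_eq)+
      moreover have "0 \<le> x mod int w" "y mod int w < int w" using w by auto
      ultimately have "y - x < int w" by linarith
      then have "y - x \<in> {1..int w}" using \<open>x \<noteq> y\<close> that by auto
      moreover have "x + (y - x) \<in> X" using that by simp
      ultimately have "x \<in> G" unfolding G_def using that by blast
      then show False using that by simp
    qed
    then show ?thesis by (intro inj_onI) (metis linear)
  qed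
  have "card (X - G) \<le> card {(- L) div int w..L div int w}"
    by (rule card_inj_on_le[OF inj]) (use card_interval_div(1)[of "int w" L] X w in auto)
  then have 1: "int (card (X - G)) \<le> 2 * L div int w + 2"
    using card_interval_div(2)[of "int w" L] X w by linarith
  have "G = (\<Union>d\<in>{1..int w}. H d)" unfolding G_def H_def by auto
  then have "card G \<le> (\<Sum>d\<in>{1..int w}. card (H d))" using card_UN_le[of "{1..int w}" H] by simp
  moreover have "\<exists>d\<in>{1..int w}. card G \<le> w * card (H d)"
  proof (rule ccontr)
    assume "\<not> ?thesis"
    then have "\<And>d. d \<in> {1..int w} \<Longrightarrow> w * card (H d) < card G" by (auto simp: not_le)
    then have "(\<Sum>d\<in>{1..int w}. w * card (H d)) < (\<Sum>d\<in>{1..int w}. card G)"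
      by (intro sum_strict_mono) (use w in auto)
    then have "w * (\<Sum>d\<in>{1..int w}. card (H d)) < w * card G" by (simp add: sum_distrib_left)
    then show False using \<open>card G \<le> (\<Sum>d\<in>{1..int w}. card (H d))\<close> by simp
  qed
  then obtain d where d: "d \<in> {1..int w}" "card G \<le> w * card (H d)" by auto
  have fH: "finite (H d)" unfolding H_def using X by simp
  define T0 where "T0 = {x \<in> H d. even (x div d)}"
  define T1 where "T1 = {x \<in> H d. odd (x div d)}"
  have "H d = T0 \<union> T1" "T0 \<inter> T1 = {}" unfolding T0_def T1_def by auto
  then have c: "card (H d) = card T0 + card T1"
    using fH card_Un_disjoint[of T0 T1] unfolding T0_def T1_def by simp
  have dd: "(y + d) div d = y div d + 1" for y using d by simp
  define T where "T = (if card T0 \<ge> card T1 then T0 else T1)"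
  have cT: "card (H d) \<le> 2 * card T" unfolding T_def using c by auto
  have T: "T \<subseteq> X" "\<forall>y\<in>T. y + d \<in> X \<and> y + d \<notin> T"
    unfolding T_def T0_def T1_def H_def using dd by auto
  have "card X = card G + card (X - G)"
    using card_Diff_subset[OF fG, of X] card_mono[OF X(1), of G] unfolding G_def by auto
  then have 2: "int (card X) \<le> int (w * card (H d)) + (2 * L div int w + 2)" using 1 d(2) by linarith
  have "w * card (H d) \<le> w * (2 * card T)" using cT by (rule mult_le_mono2)
  then have "int (w * card (H d)) \<le> 2 * int w * int (card T)"
    by (metis (mono_tags, lifting) mult.assoc mult.commute of_nat_le_iff of_nat_mult of_nat_numeral)
  then have "int (card X) \<le> 2 * int w * int (card T) + 2 * L div int w + 2" using 2 by linarith
  then show ?thesis using d(1) T by (intro bexI[of _ d] exI[of _ T]) auto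
qed

text \<open>Pigeonhole over pairs (block of length \<open>l\<close>, residue modulo
  \<open>d\<close>): some class has more than \<open>q\<close> elements, so its extremes differ by a
  multiple of \<open>d\<close> that is at least d * q and below \<open>l\<close>.\<close>

lemma exists_long_difference:
  fixes L l d :: int
  assumes X: "finite X" "X \<subseteq> {- L..L}" "L \<ge> 0" and d: "d > 0" and l: "l > 0"
    and q: "(2 * L div l + 2) * d * int q < int (card X)"
  shows "\<exists>y r. y \<in> X \<and> y + d * int r \<in> X \<and> q \<le> r \<and> d * int r < l"
proof -
  define f where "f = (\<lambda>x. (x div l, x mod d))"
  define Bl where "Bl = {(- L) div l..L div l}"
  have im: "f ` X \<subseteq> Bl \<times> {0..<d}"
    unfolding f_def Bl_def using card_interval_div(1)[OF l X(3)] X(2) d by auto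
  have "int (card (Bl \<times> {0..<d})) \<le> (2 * L div l + 2) * d"
    unfolding Bl_def card_cartesian_product using card_interval_div(2)[OF l X(3)] d
    by (simp add: mult_right_mono)
  moreover have "card (f ` X) \<le> card (Bl \<times> {0..<d})"
    by (rule card_mono[OF _ im]) (auto simp: Bl_def)
  ultimately have cf: "int (card (f ` X)) \<le> (2 * L div l + 2) * d" by linarith
  have "\<exists>z\<in>f ` X. q < card {x \<in> X. f x = z}"
  proof (rule ccontr)
    assume "\<not> ?thesis"
    then have h: "\<And>z. z \<in> f ` X \<Longrightarrow> card {x \<in> X. f x = z} \<le> q" by (auto simp: not_less)
    have "card X = (\<Sum>z\<in>f ` X. card {x \<in> X. f x = z})"
      using sum.image_gen[OF X(1), of "\<lambda>_. 1::nat" f] by simp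
    also have "\<dots> \<le> (\<Sum>z\<in>f ` X. q)" by (rule sum_mono[OF h])
    finally have "int (card X) \<le> int (card (f ` X)) * int q" by (simp flip: of_nat_mult)
    also have "\<dots> \<le> (2 * L div l + 2) * d * int q" by (rule mult_right_mono[OF cf]) simp
    finally show False using q by simp
  qed
  then obtain z where z: "q < card {x \<in> X. f x = z}" by blast
  define F where "F = {x \<in> X. f x = z}"
  have fF: "finite F" unfolding F_def using X by simp
  have "card F \<noteq> 0" using z unfolding F_def by linarith
  then have Fn: "F \<noteq> {}" by auto
  define a where "a = Min F"
  define b where "b = Max F"
  have a: "a \<in> F" and b: "b \<in> F" unfolding a_def b_def using fF Fn by auto
  have ab: "a \<le> x" "x \<le> b" if "x \<in> F" for x unfolding a_def b_def using fF that by auto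
  have dv: "d dvd (x - a)" if "x \<in> F" for x
  proof -
    have "x mod d = a mod d" using that a unfolding F_def f_def by auto
    then show ?thesis by (simp add: mod_eq_dvd_iff)
  qed
  define r where "r = nat ((b - a) div d)"
  have br: "b = a + d * int r" unfolding r_def using dv[OF b] ab(1)[OF b] d
    by (simp add: pos_imp_zdiv_nonneg_iff)
  have "F \<subseteq> (\<lambda>i. a + d * int i) ` {0..r}"
  proof
    fix x assume x: "x \<in> F"
    obtain c where c: "x - a = d * c" using dv[OF x] by auto
    have "0 \<le> d * c" "d * c \<le> d * int r" using ab[OF x] c br by auto
    then have "0 \<le> c" "c \<le> int r" using d by (auto simp: zero_le_mult_iff)
    then have "nat c \<in> {0..r}" "x = a + d * int (nat c)" using c by auto
    then show "x \<in> (\<lambda>i. a + d * int i) ` {0..r}" by blast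
  qed
  then have "card F \<le> card ((\<lambda>i. a + d * int i) ` {0..r})" by (intro card_mono) auto
  also have "\<dots> \<le> card {0..r}" by (rule card_image_le) simp
  finally have "q \<le> r" using z unfolding F_def by simp
  moreover have "d * int r < l"
  proof -
    have "a div l = b div l" using a b unfolding F_def f_def by auto
    then have "a = l * (a div l) + a mod l" "b = l * (a div l) + b mod l" by (metis mult_div_mod_eq)+
    moreover have "0 \<le> a mod l" "b mod l < l" using l by auto
    ultimately have "b - a < l" by linarith
    then show ?thesis using br by simp
  qed
  ultimately show ?thesis using a b br unfolding F_def by auto
qed

text \<open>Each round spends two elements with difference d * r where q <= r < R: below the initial
  length, so that \<open>covers_pair\<close> leaves no gap, and long enough to gain
  \<open>q\<close>. As \<open>q\<close> can be taken proportional to the size of \<open>X\<close>,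
  boundedly many rounds suffice later.\<close>

lemma covers_extend:
  fixes L d :: int
  assumes X: "finite X" "X \<subseteq> {- L..L}" "L \<ge> 0" and d: "d > 0"
    and Y0: "Y0 \<subseteq> X" "covers Y0 x0 d R" "R > 0" and q: "q > 0"
  shows "(2 * L div (d * int R) + 2) * d * int q + int (card Y0) + 2 * int J < int (card X) \<Longrightarrow>
    \<exists>Y x. Y0 \<subseteq> Y \<and> Y \<subseteq> X \<and> card Y \<le> card Y0 + 2 * J \<and> covers Y x d (R + J * q)"
proof (induction J)
  case 0
  then show ?case using Y0 by (intro exI[of _ Y0] exI[of _ x0]) auto
next
  case (Suc J)
  then obtain Y x where Y: "Y0 \<subseteq> Y" "Y \<subseteq> X" "card Y \<le> card Y0 + 2 * J" "covers Y x d (R + J * q)"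
    by auto
  have fY: "finite Y" using Y X finite_subset by blast
  have "card (X - Y) + card Y = card X"
    using card_Diff_subset[OF fY Y(2)] card_mono[OF X(1) Y(2)] by linarith
  then have "int (card (X - Y)) + int (card Y) = int (card X)" by (metis of_nat_add)
  moreover have "int (card Y) \<le> int (card Y0) + 2 * int J" using Y(3) by linarith
  moreover define Q where "Q = (2 * L div (d * int R) + 2) * d * int q"
  ultimately have "Q < int (card (X - Y))" using Suc.prems[folded Q_def] by simp
  then obtain y r where yr: "y \<in> X - Y" "y + d * int r \<in> X - Y" "q \<le> r" "d * int r < d * int R"
    unfolding Q_def using exists_long_difference[of "X - Y" L d "d * int R" q] X d Y0(3) by auto
  have rR: "r < R" using yr(4) d by simp
  have "covers (insert y (insert (y + d * int r) Y)) (x + y) d (R + J * q + r)"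
    by (rule covers_pair[OF Y(4) fY]) (use yr rR in auto)
  then have "covers (insert y (insert (y + d * int r) Y)) (x + y) d (R + Suc J * q)"
    by (rule covers_mono) (use yr in auto)
  moreover have "card (insert y (insert (y + d * int r) Y)) \<le> card Y0 + 2 * Suc J"
    using Y(3) card_insert_le_m1 fY by (simp add: card_insert_if)
  ultimately show ?case using Y yr by (intro exI[of _ "insert y (insert (y + d * int r) Y)"] exI[of _ "x + y"]) auto
qed

text \<open>
  If \<open>Z\<close> maximises the number of residues of its subset sums among the sets smaller than that number,
  every other element stabilises these residues; \<open>g\<close> generates the stabiliser.
\<close>

lemma exists_stabilised_sums:
  fixes d :: int
  assumes X: "finite X" and d: "d > 0"
  shows "\<exists>Z g. Z \<subseteq> X \<and> int (card Z) < d \<and> 0 < g \<and> g dvd d \<and> (\<forall>x\<in>X - Z. g dvd x)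
     \<and> (\<forall>i. (g * int i) mod d \<in> sums_mod d Z)"
proof -
  define good where "good = (\<lambda>Z. Z \<subseteq> X \<and> card Z < card (sums_mod d Z))"
  have SS0: "0 \<in> sums_mod d Z" for Z unfolding sums_mod_def by (rule image_eqI[of _ _ "{}"]) auto
  have "good {}" unfolding good_def using SS0[of "{}"] sums_mod_finite[OF d] by (auto simp: card_gt_0_iff)
  moreover have bound: "card (sums_mod d Z) \<le> nat d" for Z by (rule card_sums_mod_le[OF d])
  ultimately obtain Z where Z: "good Z" "\<And>Z'. good Z' \<Longrightarrow> card (sums_mod d Z') \<le> card (sums_mod d Z)"
    using ex_has_greatest_nat[of good "{}" "\<lambda>Z. card (sums_mod d Z)" "Suc (nat d)"] by (auto simp: less_Suc_eq_le)
  have ZX: "Z \<subseteq> X" "card Z < card (sums_mod d Z)" using Z unfolding good_def by auto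
  have fZ: "finite Z" using ZX X finite_subset by blast
  define S where "S = sums_mod d Z"
  have sums_mod: "S \<subseteq> {0..<d}" unfolding S_def by (rule sums_mod_range[OF d])
  have fS: "finite S" using sums_mod finite_subset by blast
  have lam0: "shift_gain d S x = 0" if "x \<in> X - Z" for x
  proof (rule ccontr)
    assume "shift_gain d S x \<noteq> 0"
    then have "card (sums_mod d Z) < card (sums_mod d (insert x Z))"
      using card_sums_mod_insert[OF d fZ, of x] that unfolding S_def by auto
    moreover from this have "good (insert x Z)" unfolding good_def using ZX that fZ by auto
    ultimately show False using Z(2) by fastforce
  qed
  define st where "st = (\<lambda>n. n > 0 \<and> shift_gain d S (int n) = 0)"
  have "shift_gain d S d = shift_gain d S 0" by (rule shift_gain_cong) simp
  then have lamd: "shift_gain d S d = 0" using shift_gain_0[OF sums_mod] by simp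
  then have "st (nat d)" unfolding st_def using d by simp
  define g where "g = (LEAST n. st n)"
  have g: "st g" unfolding g_def by (rule LeastI[of st, OF \<open>st (nat d)\<close>])
  have gl: "g \<le> n" if "st n" for n unfolding g_def by (rule Least_le[of st, OF that])
  have div: "int g dvd x" if "shift_gain d S x = 0" for x
  proof (rule ccontr)
    assume nd: "\<not> int g dvd x"
    define r where "r = x mod int g"
    have gp: "int g > 0" using g unfolding st_def by simp
    have "r \<noteq> 0" using nd unfolding r_def by (simp add: dvd_eq_mod_eq_0)
    moreover have "0 \<le> r" "r < int g" unfolding r_def using gp by simp_all
    ultimately have r: "0 < r" "r < int g" by linarith+
    \<comment> \<open>Represents minus the quotient modulo \<open>d\<close> by a natural number,
      since \<open>shift_gain_mult\<close> is about natural multiples; this is the Euclidean step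
      that makes the remainder stabilising as well.\<close>
    define i where "i = nat ((- (x div int g)) mod d)"
    have "[int i = - (x div int g)] (mod d)" unfolding i_def using d by (simp add: cong_def)
    then have "[x + int i * int g = x + (- (x div int g)) * int g] (mod d)"
      by (intro cong_add cong_mult cong_refl)
    then have "(x + int i * int g) mod d = (x + (- (x div int g)) * int g) mod d"
      by (simp only: cong_def)
    also have "x + (- (x div int g)) * int g = r" unfolding r_def by (simp add: minus_div_mult_eq_mod)
    finally have "shift_gain d S r = shift_gain d S (x + int i * int g)" by (intro shift_gain_cong) simp
    also have "\<dots> \<le> shift_gain d S x + shift_gain d S (int i * int g)" by (rule shift_gain_add[OF sums_mod])
    also have "\<dots> \<le> shift_gain d S x + i * shift_gain d S (int g)" using shift_gain_mult[OF sums_mod] by simp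
    also have "\<dots> = 0" using that g unfolding st_def by simp
    finally have "st (nat r)" unfolding st_def using r by simp
    then have "g \<le> nat r" by (rule gl)
    then show False using r by linarith
  qed
  have "(int g * int i) mod d \<in> S" for i
  proof -
    have "shift_gain d S (int i * int g) \<le> i * shift_gain d S (int g)" by (rule shift_gain_mult[OF sums_mod])
    then have "shift_gain d S (int g * int i) = 0" using g unfolding st_def by (simp add: mult.commute)
    then have "{s \<in> S. (s + int g * int i) mod d \<notin> S} = {}" unfolding shift_gain_def using fS by simp
    moreover have "0 \<in> S" unfolding S_def by (rule SS0)
    ultimately show ?thesis by force
  qed
  moreover have "int (card Z) < d" using ZX bound[of Z] d by linarith
  ultimately show ?thesis using ZX div[OF lamd] div lam0 g unfolding S_def st_def
    by (intro exI[of _ Z] exI[of _ "int g"]) auto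
qed

lemma abs_sum_le:
  fixes Z :: "int set"
  assumes "Z \<subseteq> {- L..L}"
  shows "\<bar>\<Sum>Z\<bar> \<le> int (card Z) * L"
proof -
  have "\<bar>\<Sum>Z\<bar> \<le> (\<Sum>z\<in>Z. \<bar>z\<bar>)" by (rule sum_abs)
  also have "\<dots> \<le> (\<Sum>z\<in>Z. L)" by (rule sum_mono) (use assms in \<open>force simp: abs_le_iff\<close>)
  finally show ?thesis by simp
qed

lemma mult_div_le:
  fixes a w :: int
  assumes "w > 0"
  shows "w * (a div w) \<le> a"
proof -
  have "w * (a div w) + a mod w = a" "0 \<le> a mod w" using assms by simp_all
  then show ?thesis by linarith
qed

text \<open>Close pairs give a progression whose length is a small fraction of \<open>n\<close>,
  distant pairs lengthen it, and finally the stabilised sums of fewer than \<open>d\<close> further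
  elements refine the difference from \<open>d\<close> to its divisor \<open>g\<close>. Together
  these elements are at most a fraction 1/E of \<open>n\<close>.\<close>

lemma exists_progression:
  fixes C E :: nat
  assumes C: "C \<ge> 1" and E: "E \<ge> 1"
  shows "\<exists>n0. \<forall>n X L. n0 \<le> n \<longrightarrow> finite X \<longrightarrow> X \<subseteq> {- int L..int L} \<longrightarrow> n \<le> card X \<longrightarrow> L \<le> C * n \<longrightarrow>
    (\<exists>B x g. B \<subseteq> X \<and> E * card B \<le> n \<and> 0 < g \<and> g \<le> 8 * int C \<and> covers B x g L \<and> (\<forall>y\<in>X - B. g dvd y))"
proof -
  \<comment> \<open>Independent of \<open>n\<close>, and large enough that J * q >= 3 * C * n: the
    factor is 3 * C * 2 * 4000 * C^3 * E.\<close>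
  define J where "J = 24000 * C ^ 4 * E"
  define n0 where "n0 = 8 + 32 * C * E + 4000 * C ^ 3 * E + 4 * E * (2 * J + 8 * C)"
  have "\<exists>B x g. B \<subseteq> X \<and> E * card B \<le> n \<and> 0 < g \<and> g \<le> 8 * int C \<and> covers B x g L \<and> (\<forall>y\<in>X - B. g dvd y)"
    if n: "n0 \<le> n" and X: "finite X" "X \<subseteq> {- int L..int L}" "n \<le> card X" and L: "L \<le> C * n" for n X L
  proof -
    define R where "R = n div (32 * C * E)"
    define q where "q = n div (4000 * C ^ 3 * E)"
    have n8: "8 \<le> n" "32 * C * E \<le> n" "4000 * C ^ 3 * E \<le> n" "4 * E * (2 * J + 8 * C) \<le> n"
      using n unfolding n0_def by auto
    have pos: "32 * C * E > 0" "4000 * C ^ 3 * E > 0" using C E by auto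
    have Ru: "32 * C * E * R \<le> n" unfolding R_def by simp
    have Rl: "n \<le> 2 * (32 * C * E) * R"
    proof -
      have "real n \<le> real (2 * (32 * C * E) * R)" using nat_div_lower[OF pos(1) n8(2)] unfolding R_def by simp
      then show ?thesis by (simp only: of_nat_le_iff)
    qed
    have qu: "4000 * C ^ 3 * E * q \<le> n" unfolding q_def by simp
    have ql: "n \<le> 2 * (4000 * C ^ 3 * E) * q"
    proof -
      have "real n \<le> real (2 * (4000 * C ^ 3 * E) * q)" using nat_div_lower[OF pos(2) n8(3)] unfolding q_def by simp
      then show ?thesis by (simp only: of_nat_le_iff)
    qed
    have R0: "R > 0" unfolding R_def using n8(2) pos by (simp add: div_greater_zero_iff)
    have q0: "q > 0" unfolding q_def using n8(3) pos by (simp add: div_greater_zero_iff)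
    \<comment> \<open>For L <= C * n this leaves at most n / 4 + 2 elements without a neighbour
      within distance \<open>w\<close>.\<close>
    define w where "w = 8 * C"
    have w0: "w > 0" unfolding w_def using C by simp
    obtain d T where d: "d \<in> {1..int w}" and T: "T \<subseteq> X" "\<forall>y\<in>T. y + d \<in> X \<and> y + d \<notin> T"
        "int (card X) \<le> 2 * int w * int (card T) + 2 * int L div int w + 2"
      using exists_common_difference[OF X(1,2) _ w0] by auto
    have d0: "d > 0" and d8: "d \<le> 8 * int C" using d unfolding w_def by auto
    define a where "a = 2 * int L div int w"
    have "int w * a \<le> 2 * int L" unfolding a_def by (rule mult_div_le) (use w0 in simp)
    also have "\<dots> \<le> 2 * int (C * n)" using L by linarith
    finally have "(2 * int C) * (4 * a) \<le> (2 * int C) * int n" unfolding w_def by simp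
    then have a4: "4 * a \<le> int n" using C by simp
    have "int n \<le> 16 * (int C * int (card T)) + a + 2" using T(3) X(3) unfolding a_def w_def by simp
    then have "int n \<le> 32 * (int C * int (card T))" using a4 n8(1) by linarith
    then have "int n \<le> int (32 * (C * card T))" by simp
    then have nT: "n \<le> 32 * (C * card T)" by (simp only: of_nat_le_iff)
    have RT: "R \<le> card T"
    proof -
      have "(32 * C) * R \<le> 32 * C * E * R" using E by simp
      then have "(32 * C) * R \<le> (32 * C) * card T" using Ru nT by linarith
      then show ?thesis using C by simp
    qed
    then obtain T0 where T0: "T0 \<subseteq> T" "card T0 = R" using obtain_subset_with_card_n by metis
    have fT0: "finite T0" using T0 R0 card_gt_0_iff by force
    define Y0 where "Y0 = T0 \<union> (\<lambda>y. y + d) ` T0"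
    obtain x0 where x0: "covers Y0 x0 d R"
      using covers_pairs[of T0 d] fT0 T0 T R0 d0 unfolding Y0_def by fastforce
    have Y0X: "Y0 \<subseteq> X" unfolding Y0_def using T0 T by auto
    have cY0: "card Y0 \<le> 2 * R"
      unfolding Y0_def using card_Un_le[of T0 "(\<lambda>y. y + d) ` T0"] card_image_le[OF fT0, of "\<lambda>y. y + d"] T0 by linarith
    define b where "b = 2 * int L div (d * int R)"
    have "(d * int R) * b \<le> 2 * int L" unfolding b_def by (rule mult_div_le) (use d0 R0 in simp)
    also have "2 * int L \<le> 2 * int (C * (2 * (32 * C * E) * R))"
      using L mult_le_mono2[OF Rl, of C] by linarith
    finally have "int R * (d * b) \<le> int R * int (128 * C ^ 2 * E)"
      by (simp add: power2_eq_square algebra_simps)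
    then have db: "d * b \<le> int (128 * C ^ 2 * E)" using R0 by simp
    have "16 * C \<le> 16 * C ^ 2 * E"
    proof -
      have "16 * C * (1 * 1) \<le> 16 * C * (C * E)" using C E by (intro mult_le_mono2 mult_le_mono)
      then show ?thesis by (simp add: power2_eq_square)
    qed
    then have "16 * int C \<le> int (16 * C ^ 2 * E)" by linarith
    moreover have "(b + 2) * d = d * b + 2 * d" by (simp add: algebra_simps)
    ultimately have "(b + 2) * d \<le> int (144 * C ^ 2 * E)" using db d8 by (simp add: algebra_simps)
    then have "(b + 2) * d * int q \<le> int (144 * C ^ 2 * E) * int q" by (rule mult_right_mono) simp
    moreover have "int (27 * (144 * C ^ 2 * E * q)) \<le> int n"
    proof -
      have "27 * (144 * C ^ 2 * E * q) = 3888 * 1 * (C ^ 2 * E * q)" by simp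
      also have "\<dots> \<le> 4000 * C * (C ^ 2 * E * q)" using C by (intro mult_le_mono) auto
      also have "\<dots> = 4000 * C ^ 3 * E * q" by (simp add: power3_eq_cube power2_eq_square)
      finally show ?thesis using qu by linarith
    qed
    then have "27 * (int (144 * C ^ 2 * E) * int q) \<le> int n" by simp
    ultimately have bq: "27 * ((b + 2) * d * int q) \<le> int n" by linarith
    have R32: "32 * R \<le> n"
    proof -
      have "1 * 1 * R \<le> C * E * R" using C E by (intro mult_le_mono) auto
      moreover have "32 * C * E * R = 32 * (C * E * R)" by simp
      ultimately show ?thesis using Ru by linarith
    qed
    have ER: "32 * (E * R) \<le> n"
    proof -
      have "1 * (E * R) \<le> C * (E * R)" using C by (intro mult_le_mono) auto
      moreover have "32 * C * E * R = 32 * (C * (E * R))" by simp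
      ultimately show ?thesis using Ru by linarith
    qed
    have EJ: "4 * (E * (2 * J + 8 * C)) \<le> n" using n8(4) by simp
    have "1 * (2 * J + 8 * C) \<le> E * (2 * J + 8 * C)" using E by (intro mult_le_mono) auto
    then have "4 * (2 * J + 8 * C) \<le> n" using EJ by (metis le_trans mult_le_mono2 nat_mult_1)
    then have J8: "8 * J \<le> n" by simp
    have "(b + 2) * d * int q + int (card Y0) + 2 * int J < int (card X)"
    proof -
      define Q where "Q = (b + 2) * d * int q"
      have "27 * Q \<le> int n" "int (card Y0) \<le> 2 * int R" "32 * int R \<le> int n" "8 * int J \<le> int n" "int n \<le> int (card X)" "8 \<le> int n"
        using bq cY0 R32 J8 X(3) n8(1) unfolding Q_def by linarith+
      then show ?thesis unfolding Q_def[symmetric] by linarith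
    qed
    then obtain Y x where Y: "Y0 \<subseteq> Y" "Y \<subseteq> X" "card Y \<le> card Y0 + 2 * J" "covers Y x d (R + J * q)"
      using covers_extend[OF X(1,2) _ d0 Y0X x0 R0 q0, of J] unfolding b_def by auto
    \<comment> \<open>A target g * i in [0, d * L] is corrected by a sum of \<open>Z\<close> of
      absolute value at most d * L. The result lies in [- d * L, 2 * d * L], whence the shift of the
      starting point by d * L and the length 3 * L.\<close>
    have H: "3 * L \<le> R + J * q"
    proof -
      have "C * n \<le> C * (2 * (4000 * C ^ 3 * E) * q)" using ql by (rule mult_le_mono2)
      moreover have "C * (2 * (4000 * C ^ 3 * E) * q) * 3 = J * q"
        unfolding J_def by (simp add: power3_eq_cube power4_eq_xxxx algebra_simps)
      ultimately have "3 * (C * n) \<le> J * q" by linarith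
      then show ?thesis using L by linarith
    qed
    have fXY: "finite (X - Y)" using X by simp
    obtain Z g where Z: "Z \<subseteq> X - Y" "int (card Z) < d" and g: "0 < g" "g dvd d"
        "\<forall>x\<in>(X - Y) - Z. g dvd x" "\<forall>i. (g * int i) mod d \<in> sums_mod d Z"
      using exists_stabilised_sums[OF fXY d0] by blast
    have gd: "g \<le> d" using g d0 by (simp add: zdvd_imp_le)
    define B where "B = Y \<union> Z"
    have fY: "finite Y" and fZ: "finite Z" using finite_subset[OF Y(2) X(1)] finite_subset[OF Z(1) fXY] by auto
    have "covers B (x + d * int L) g L"
      unfolding covers_def
    proof (intro allI impI)
      fix i assume i: "i \<le> L"
      obtain Z' where Z': "Z' \<subseteq> Z" "(g * int i) mod d = (\<Sum>Z') mod d"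
        using g(4) unfolding sums_mod_def by blast
      define z where "z = \<Sum>Z'"
      have "d dvd g * int i - z" using Z'(2) unfolding z_def by (simp add: mod_eq_dvd_iff)
      then obtain c where c: "g * int i - z = d * c" by auto
      have "\<bar>z\<bar> \<le> int (card Z') * int L" unfolding z_def
        by (rule abs_sum_le) (use Z' Z X in auto)
      also have "\<dots> \<le> d * int L"
        by (rule mult_right_mono) (use card_mono[OF fZ Z'(1)] Z(2) in auto)
      finally have z: "\<bar>z\<bar> \<le> d * int L" .
      have gi: "0 \<le> g * int i" "g * int i \<le> d * int L"
        using g gd i by (auto intro: mult_mono)
      have "0 \<le> d * (int L + c)" "d * (int L + c) \<le> d * (3 * int L)"
        using c z gi unfolding ring_distribs by linarith+
      then have "0 \<le> int L + c" "int L + c \<le> 3 * int L"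
        using d0 by (simp_all add: zero_le_mult_iff mult_le_cancel_left_pos)
      then have m: "int (nat (int L + c)) = int L + c" "nat (int L + c) \<le> R + J * q" using H by linarith+
      then obtain Z'' where Z'': "Z'' \<subseteq> Y" "Z'' \<noteq> {}" "\<Sum>Z'' = x + d * (int L + c)"
        using Y(4) unfolding covers_def by metis
      have "finite Z'" "finite Z''" using fZ fY Z' Z'' finite_subset by auto
      moreover have "Z'' \<inter> Z' = {}" using Z' Z'' Z by auto
      ultimately have "\<Sum>(Z'' \<union> Z') = x + d * int L + g * int i"
        using Z'' c unfolding z_def by (simp add: sum.union_disjoint algebra_simps)
      then show "\<exists>Z\<subseteq>B. Z \<noteq> {} \<and> \<Sum>Z = x + d * int L + g * int i"
        using Z' Z'' unfolding B_def by (intro exI[of _ "Z'' \<union> Z'"]) auto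
    qed
    moreover have "E * card B \<le> n"
    proof -
      have "card Z \<le> 8 * C" using Z(2) d8 by linarith
      then have "card B \<le> 2 * R + (2 * J + 8 * C)"
        unfolding B_def using card_Un_le[of Y Z] Y(3) cY0 by linarith
      then have "E * card B \<le> E * (2 * R + (2 * J + 8 * C))" by (rule mult_le_mono2)
      also have "\<dots> = 2 * (E * R) + E * (2 * J + 8 * C)" by (simp add: algebra_simps)
      finally show ?thesis using ER EJ by linarith
    qed
    moreover have "B \<subseteq> X" unfolding B_def using Y Z by auto
    moreover have "\<forall>y\<in>X - B. g dvd y" unfolding B_def using g(3) by auto
    ultimately show ?thesis using g(1) gd d8 by (intro exI[of _ B] exI[of _ "x + d * int L"] exI[of _ g]) auto
  qed
  then show ?thesis by blast
qed

subsection \<open>Dilates of small total size\<close>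

text \<open>For \<open>p = 0\<close> the congruence is an equality of integers.\<close>

definition covers_mod :: "int \<Rightarrow> int set \<Rightarrow> int \<Rightarrow> nat \<Rightarrow> bool" where
  "covers_mod p Y x H \<longleftrightarrow> (\<forall>i\<le>H. \<exists>Z\<subseteq>Y. Z \<noteq> {} \<and> p dvd (\<Sum>Z - (x + int i)))"

lemma zero_free_modD: "zero_free_mod p A \<Longrightarrow> Z \<subseteq> A \<Longrightarrow> Z \<noteq> {} \<Longrightarrow> \<not> p dvd \<Sum>Z"
  unfolding zero_free_mod_def by simp

text \<open>The interval and its translate by \<open>a\<close> overlap or adjoin, so their union is
  an interval again; it grows to the left when \<open>a\<close> is negative.\<close>

lemma covers_mod_insert:
  assumes c: "covers_mod p Y x H" and Y: "finite Y" "a \<notin> Y" and a: "\<bar>a\<bar> \<le> int H + 1"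
  shows "covers_mod p (insert a Y) (x + min a 0) (H + nat \<bar>a\<bar>)"
  unfolding covers_mod_def
proof (intro allI impI)
  fix i assume i: "i \<le> H + nat \<bar>a\<bar>"
  have old: "\<exists>Z\<subseteq>insert a Y. Z \<noteq> {} \<and> p dvd (\<Sum>Z - y)" if "x \<le> y" "y \<le> x + int H" for y
  proof -
    have "nat (y - x) \<le> H" "x + int (nat (y - x)) = y" using that by auto
    then show ?thesis using c unfolding covers_mod_def by (metis subset_insertI2)
  qed
  have new: "\<exists>Z\<subseteq>insert a Y. Z \<noteq> {} \<and> p dvd (\<Sum>Z - y)" if y: "x \<le> y - a" "y - a \<le> x + int H" for y
  proof -
    have "nat (y - a - x) \<le> H" "x + int (nat (y - a - x)) = y - a" using that by auto
    then obtain Z where Z: "Z \<subseteq> Y" "Z \<noteq> {}" "p dvd (\<Sum>Z - (y - a))" using c unfolding covers_mod_def by metis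
    then have "finite Z" "a \<notin> Z" using Y finite_subset by auto
    then have "\<Sum>(insert a Z) - y = \<Sum>Z - (y - a)" by simp
    then have "p dvd (\<Sum>(insert a Z) - y)" using Z(3) by (simp only:)
    then show ?thesis using Z(1) by (intro exI[of _ "insert a Z"]) blast
  qed
  define y where "y = x + min a 0 + int i"
  have "(x \<le> y \<and> y \<le> x + int H) \<or> (x \<le> y - a \<and> y - a \<le> x + int H)"
    using i a unfolding y_def min_def by (auto split: if_splits)
  then show "\<exists>Z\<subseteq>insert a Y. Z \<noteq> {} \<and> p dvd (\<Sum>Z - (x + min a 0 + int i))"
    using old new unfolding y_def by blast
qed

lemma covers_mod_extend:
  assumes "finite D" and c: "covers_mod p Y x H" and Y: "finite Y"
  shows "Y \<inter> D = {} \<Longrightarrow> (\<forall>a\<in>D. \<bar>a\<bar> \<le> int H + 1) \<Longrightarrow>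
    covers_mod p (Y \<union> D) (x + (\<Sum>a\<in>D. min a 0)) (H + nat (\<Sum>a\<in>D. \<bar>a\<bar>))"
  using assms(1)
proof (induction D rule: finite_induct)
  case empty
  then show ?case using c by simp
next
  case (insert a D)
  have "covers_mod p (insert a (Y \<union> D)) (x + (\<Sum>a\<in>D. min a 0) + min a 0) (H + nat (\<Sum>a\<in>D. \<bar>a\<bar>) + nat \<bar>a\<bar>)"
  proof (rule covers_mod_insert)
    have "0 \<le> (\<Sum>a\<in>D. \<bar>a\<bar>)" by (simp add: sum_nonneg)
    moreover have "\<bar>a\<bar> \<le> int H + 1" using insert.prems by simp
    ultimately show "\<bar>a\<bar> \<le> int (H + nat (\<Sum>a\<in>D. \<bar>a\<bar>)) + 1" by linarith
  qed (use insert Y in auto)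
  moreover have "nat (\<Sum>a\<in>insert a D. \<bar>a\<bar>) = nat (\<Sum>a\<in>D. \<bar>a\<bar>) + nat \<bar>a\<bar>"
    using insert by (simp add: nat_add_distrib sum_nonneg)
  ultimately show ?case using insert by (simp add: algebra_simps)
qed

lemma covers_mod_zero_free_mod:
  assumes "zero_free_mod p A" "covers_mod p A x H" "i \<le> H"
  shows "\<not> p dvd (x + int i)"
proof
  assume d: "p dvd (x + int i)"
  obtain Z where Z: "Z \<subseteq> A" "Z \<noteq> {}" "p dvd (\<Sum>Z - (x + int i))"
    using assms(2,3) unfolding covers_mod_def by blast
  then have "p dvd \<Sum>Z" using d dvd_add[of p "\<Sum>Z - (x + int i)" "x + int i"] by simp
  then show False using assms(1) Z unfolding zero_free_mod_def by blast
qed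

lemma covers_mod_zero_free_mod_length:
  assumes p: "p > 0" and z: "zero_free_mod p A" "covers_mod p A x H"
  shows "int H < p"
proof (rule ccontr)
  assume "\<not> ?thesis"
  define i where "i = nat ((- x) mod p)"
  have i: "int i = (- x) mod p" unfolding i_def using p by simp
  then have "int i < p" using p by simp
  then have "i \<le> H" using \<open>\<not> int H < p\<close> by linarith
  moreover have "p dvd (x + int i)" unfolding i by (simp add: dvd_eq_mod_eq_0 mod_simps)
  ultimately show False using covers_mod_zero_free_mod[OF z] by blast
qed

lemma zero_free_mod_dilate:
  assumes p: "prime p" and A: "zero_free_mod p A" and t: "\<not> p dvd t" and f: "\<And>a. a \<in> A \<Longrightarrow> p dvd (f a - t * a)"
  shows "zero_free_mod p (f ` A)" "inj_on f A"
proof -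
  have inj: "a = b" if "a \<in> A" "b \<in> A" "f a mod p = f b mod p" for a b
  proof -
    have "p dvd (f a - f b)" using that by (simp add: mod_eq_dvd_iff)
    then have "p dvd (f a - f b) - (f a - t * a) + (f b - t * b)"
      by (intro dvd_add dvd_diff[of p "f a - f b"] f that)
    also have "(f a - f b) - (f a - t * a) + (f b - t * b) = t * (a - b)" by (simp add: algebra_simps)
    finally have "p dvd (a - b)" using p t prime_dvd_mult_iff by blast
    then have "a mod p = b mod p" by (simp add: mod_eq_dvd_iff)
    then show ?thesis using A that unfolding zero_free_mod_def inj_on_def by blast
  qed
  show i: "inj_on f A" using inj by (auto intro: inj_onI)
  have "\<not> p dvd \<Sum>Z" if Z: "Z \<subseteq> f ` A" "Z \<noteq> {}" for Z
  proof
    assume d: "p dvd \<Sum>Z"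
    obtain W where W: "W \<subseteq> A" "Z = f ` W" using Z by (auto simp: subset_image_iff)
    have "\<Sum>Z = (\<Sum>a\<in>W. f a)" unfolding W(2) using inj_on_subset[OF i W(1)] by (simp add: sum.reindex)
    moreover have "p dvd (\<Sum>a\<in>W. f a - t * a)" by (rule dvd_sum) (use f W in auto)
    ultimately have "p dvd (\<Sum>a\<in>W. f a) - (\<Sum>a\<in>W. f a - t * a)" using d by (simp only: dvd_diff)
    then have "p dvd t * \<Sum>W" by (simp add: sum_subtractf sum_distrib_left)
    then have "p dvd \<Sum>W" using p t prime_dvd_mult_iff by blast
    then show False using A W Z unfolding zero_free_mod_def by blast
  qed
  moreover have "inj_on (\<lambda>y. y mod p) (f ` A)" using inj by (auto simp: inj_on_def)
  ultimately show "zero_free_mod p (f ` A)" using A unfolding zero_free_mod_def by auto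
qed

lemma centred_dvd: "p dvd (centred p x - x)"
  using centred_cong[of p x] by (simp add: mod_eq_dvd_iff)

lemma centred_unique:
  assumes "p > 0" "odd p" "2 * \<bar>y\<bar> < p" "p dvd (y - x)"
  shows "centred p x = y"
proof -
  have "p dvd (centred p x - x) - (y - x)" using centred_dvd assms(4) by (rule dvd_diff)
  then have d: "p dvd centred p x - y" by simp
  have "\<bar>centred p x - y\<bar> < p" using centred_bounds[OF assms(1,2), of x] assms(3) by linarith
  then have "centred p x - y = 0" using d dvd_imp_le_int[of "centred p x - y" p] assms(1) by linarith
  then show ?thesis by simp
qed

lemma centred_image_zero_free_mod:
  assumes p: "prime p" and A: "zero_free_mod p A" and t: "\<not> p dvd t"
  shows "zero_free_mod p ((\<lambda>a. centred p (t * a)) ` A)" "inj_on (\<lambda>a. centred p (t * a)) A"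
  using zero_free_mod_dilate[OF p A t, of "\<lambda>a. centred p (t * a)"] centred_dvd by blast+

lemma zero_free_mod_abs_inj:
  assumes "zero_free_mod p X" "p > 2"
  shows "inj_on abs X"
proof (rule inj_onI, rule ccontr)
  fix x y assume xy: "x \<in> X" "y \<in> X" "\<bar>x\<bar> = \<bar>y\<bar>" "x \<noteq> y"
  then have "x + y = 0" by linarith
  then have "\<Sum>{x, y} = 0" using xy by simp
  moreover have "\<not> p dvd \<Sum>{x, y}" by (rule zero_free_modD[OF assms(1)]) (use xy in auto)
  ultimately show False by simp
qed

text \<open>\<open>u\<close> is the inverse of \<open>g\<close> modulo \<open>p\<close>. An element
  y = g * c of \<open>D\<close> becomes \<open>c\<close> as an integer, not just modulo
  \<open>p\<close>, since |c| <= |y| < p / 2. In particular it is no longer than the interval that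
  it has to prolong.\<close>

lemma progression_total:
  assumes p: "prime p" "odd p" and X: "zero_free_mod p X" and B: "B \<subseteq> X" "covers B x g L"
    and g: "0 < g" "g < p" and D: "D \<subseteq> X - B" "\<And>y. y \<in> D \<Longrightarrow> g dvd y \<and> \<bar>y\<bar> \<le> int L \<and> 2 * \<bar>y\<bar> < p"
  shows "\<exists>u. \<not> p dvd u \<and> (\<Sum>y\<in>D. \<bar>centred p (u * y)\<bar>) < p"
proof -
  have p0: "p > 0" using p prime_gt_0_int by blast
  have "\<not> p dvd g" using g zdvd_not_zless by auto
  then have "coprime g p" using prime_imp_coprime[OF p(1)] by (simp add: coprime_commute)
  then obtain u where u: "[g * u = 1] (mod p)" using cong_solve_coprime_int by blast
  have gu: "p dvd (g * u - 1)" using u by (simp add: cong_iff_dvd_diff)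
  have pu: "\<not> p dvd u"
  proof
    assume "p dvd u"
    then have "p dvd g * u - (g * u - 1)" by (rule dvd_diff[OF dvd_mult gu])
    then have "p dvd 1" by simp
    then show False using p(1) not_prime_unit by blast
  qed
  define f where "f = (\<lambda>y. centred p (u * y))"
  have zero_free_mod: "zero_free_mod p (f ` X)" and inj: "inj_on f X"
    using centred_image_zero_free_mod[OF p(1) X pu] unfolding f_def by auto
  have fX: "finite X" using X unfolding zero_free_mod_def by auto
  have fD: "\<bar>f y\<bar> \<le> int L" if y: "y \<in> D" for y
  proof -
    obtain c where c: "y = g * c" using D(2)[OF y] by auto
    have cy: "\<bar>c\<bar> \<le> \<bar>y\<bar>" unfolding c using g by (simp add: abs_mult mult_le_cancel_right1)
    have "p dvd (c - u * y)"
    proof -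
      have "c - u * y = - ((g * u - 1) * c)" unfolding c by (simp add: algebra_simps)
      then show ?thesis using gu by simp
    qed
    then have "f y = c" unfolding f_def using centred_unique[OF p0 p(2)] D(2)[OF y] cy by auto
    then show ?thesis using cy D(2)[OF y] by linarith
  qed
  have "covers_mod p (f ` B) (u * x) L"
    unfolding covers_mod_def
  proof (intro allI impI)
    fix i assume "i \<le> L"
    then obtain Z where Z: "Z \<subseteq> B" "Z \<noteq> {}" "\<Sum>Z = x + g * int i" using B(2) unfolding covers_def by blast
    have "\<Sum>(f ` Z) = (\<Sum>y\<in>Z. f y)" using inj_on_subset[OF inj, of Z] Z B by (simp add: sum.reindex)
    moreover have "p dvd (\<Sum>y\<in>Z. f y - u * y)" by (rule dvd_sum) (simp add: f_def centred_dvd)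
    then have "p dvd (\<Sum>y\<in>Z. f y) - u * \<Sum>Z" by (simp add: sum_subtractf sum_distrib_left)
    ultimately have "p dvd \<Sum>(f ` Z) - u * (x + g * int i)" using Z by simp
    then have "p dvd (\<Sum>(f ` Z) - u * (x + g * int i)) + (g * u - 1) * int i" using gu by (intro dvd_add) auto
    then have "p dvd \<Sum>(f ` Z) - (u * x + int i)" by (simp add: algebra_simps)
    then show "\<exists>Z\<subseteq>f ` B. Z \<noteq> {} \<and> p dvd \<Sum>Z - (u * x + int i)" using Z by (intro exI[of _ "f ` Z"]) auto
  qed
  moreover have "f ` B \<inter> f ` D = {}" using inj B D unfolding inj_on_def by blast
  ultimately have "covers_mod p (f ` B \<union> f ` D) (u * x + (\<Sum>a\<in>f ` D. min a 0)) (L + nat (\<Sum>a\<in>f ` D. \<bar>a\<bar>))"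
    using covers_mod_extend[of "f ` D" p "f ` B" "u * x" L] fD fX finite_subset[OF B(1)] finite_subset[of D X] D(1) by fastforce
  moreover have "zero_free_mod p (f ` B \<union> f ` D)" by (rule zero_free_mod_subset[OF zero_free_mod]) (use B D in auto)
  ultimately have "int (L + nat (\<Sum>a\<in>f ` D. \<bar>a\<bar>)) < p" using covers_mod_zero_free_mod_length[OF p0] by blast
  moreover have "(\<Sum>a\<in>f ` D. \<bar>a\<bar>) = (\<Sum>y\<in>D. \<bar>f y\<bar>)"
    using inj_on_subset[OF inj, of D] D by (simp add: sum.reindex subset_iff)
  ultimately show ?thesis using pu unfolding f_def by (intro exI[of _ u]) auto
qed

text \<open>The dilation is the product of the concentrating one and the division by
  \<open>g\<close>. The elements outside the interval and those spent on the progression number at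
  most k / (4E) each.\<close>

lemma small_total_dilation:
  fixes E :: nat
  assumes E: "E \<ge> 1"
  shows "\<exists>N. \<forall>p A. prime p \<longrightarrow> int N \<le> p \<longrightarrow> odd p \<longrightarrow> zero_free_mod p A \<longrightarrow> p \<le> (int (card A))\<^sup>2 \<longrightarrow>
     (\<exists>t D. \<not> p dvd t \<and> D \<subseteq> A \<and> E * card (A - D) \<le> card A \<and> (\<Sum>a\<in>D. \<bar>centred p (t * a)\<bar>) < p)"
proof -
  have E4: "4 * E \<ge> 1" using E by simp
  from zero_free_dilation[OF this] obtain C N where C: "C \<ge> 1" and N: "\<forall>p A. prime p \<longrightarrow> int N \<le> p \<longrightarrow> odd p \<longrightarrow> zero_free_mod p A \<longrightarrow>
     p \<le> (int (card A))\<^sup>2 \<longrightarrow> (\<exists>t\<in>{1..<p}. (4 * E) * card {a \<in> A. int (C * card A) < \<bar>centred p (t * a)\<bar>} \<le> card A)"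
    by blast
  \<comment> \<open>At least half of \<open>A\<close> survives the concentration, so the radius C *
    k is at most 2 * C times the number of survivors.\<close>
  have C2: "2 * C \<ge> 1" using C by simp
  from exists_progression[OF this E4] obtain n0 where n0: "\<forall>n X L. n0 \<le> n \<longrightarrow> finite X \<longrightarrow> X \<subseteq> {- int L..int L} \<longrightarrow>
      n \<le> card X \<longrightarrow> L \<le> (2 * C) * n \<longrightarrow>
    (\<exists>B x g. B \<subseteq> X \<and> (4 * E) * card B \<le> n \<and> 0 < g \<and> g \<le> 8 * int (2 * C) \<and> covers B x g L \<and> (\<forall>y\<in>X - B. g dvd y))"
    by blast
  have "\<exists>t D. \<not> p dvd t \<and> D \<subseteq> A \<and> E * card (A - D) \<le> card A \<and> (\<Sum>a\<in>D. \<bar>centred p (t * a)\<bar>) < p"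
    if p: "prime p" "int (N + (2 * n0)\<^sup>2 + 16 * C + 1) \<le> p" "odd p" and A: "zero_free_mod p A" and kp: "p \<le> (int (card A))\<^sup>2" for p A
  proof -
    have p0: "p > 0" using p prime_gt_0_int by blast
    have fA: "finite A" using A unfolding zero_free_mod_def by auto
    define k where "k = card A"
    obtain t where t: "t \<in> {1..<p}" "(4 * E) * card {a \<in> A. int (C * k) < \<bar>centred p (t * a)\<bar>} \<le> k"
      using N[rule_format, OF p(1) _ p(3) A kp] p(2) unfolding k_def by auto
    have "int ((2 * n0)\<^sup>2) \<le> p" using p(2) by linarith
    then have "int ((2 * n0)\<^sup>2) \<le> (int k)\<^sup>2" using kp unfolding k_def by linarith
    then have "(2 * n0)\<^sup>2 \<le> k\<^sup>2" by (metis of_nat_le_iff of_nat_power)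
    then have k: "2 * n0 \<le> k" by (simp only: power2_nat_le_eq_le)
    have pt: "\<not> p dvd t" using t(1) zdvd_not_zless by auto
    define f where "f = (\<lambda>a. centred p (t * a))"
    define bad where "bad = {a \<in> A. int (C * k) < \<bar>f a\<bar>}"
    define A1 where "A1 = A - bad"
    have zX: "zero_free_mod p (f ` A)" and inj: "inj_on f A" using centred_image_zero_free_mod[OF p(1) A pt] unfolding f_def by auto
    have cbad: "4 * (E * card bad) \<le> k" using t(2) unfolding bad_def f_def by simp
    have badA: "bad \<subseteq> A" unfolding bad_def by auto
    then have cA: "card A1 + card bad = k"
      unfolding A1_def k_def using card_Diff_subset[OF finite_subset[OF badA fA] badA] card_mono[OF fA badA] by linarith
    have "1 * card bad \<le> E * card bad" using E by (intro mult_le_mono) auto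
    then have A1k: "k \<le> 2 * card A1" using cbad cA by linarith
    define X where "X = f ` A1"
    have injA1: "inj_on f A1" by (rule inj_on_subset[OF inj]) (simp add: A1_def)
    have cX: "card X = card A1" unfolding X_def by (rule card_image[OF injA1])
    have fX: "finite X" unfolding X_def A1_def using fA by simp
    have Xr: "X \<subseteq> {- int (C * k)..int (C * k)}" unfolding X_def A1_def bad_def by (auto simp: abs_le_iff not_less)
    have "C * k \<le> (2 * C) * card X" using mult_le_mono2[OF A1k, of C] cX by simp
    then obtain B x g where B: "B \<subseteq> X" "(4 * E) * card B \<le> card X" "0 < g" "g \<le> 8 * int (2 * C)"
        "covers B x g (C * k)" "\<forall>y\<in>X - B. g dvd y"
      using n0[rule_format, of "card X" X "C * k"] fX Xr k A1k cX by auto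
    have "int (16 * C) < p" using p(2) by linarith
    then have gp: "g < p" using B(4) by simp
    have XA: "X \<subseteq> f ` A" unfolding X_def A1_def by auto
    have "\<exists>u. \<not> p dvd u \<and> (\<Sum>y\<in>X - B. \<bar>centred p (u * y)\<bar>) < p"
    proof (rule progression_total[OF p(1,3) zX _ B(5,3) gp])
      show "B \<subseteq> f ` A" using B XA by auto
      show "X - B \<subseteq> f ` A - B" using XA by auto
      fix y assume y: "y \<in> X - B"
      moreover have "2 * \<bar>y\<bar> < p" using y centred_bounds[OF p0 p(3)] unfolding X_def f_def by auto
      moreover have "\<bar>y\<bar> \<le> int (C * k)" using y Xr by (auto simp: abs_le_iff)
      ultimately show "g dvd y \<and> \<bar>y\<bar> \<le> int (C * k) \<and> 2 * \<bar>y\<bar> < p" using B(6) by blast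
    qed
    then obtain u where u: "\<not> p dvd u" "(\<Sum>y\<in>X - B. \<bar>centred p (u * y)\<bar>) < p" by auto
    define D where "D = {a \<in> A1. f a \<notin> B}"
    have fD: "f ` D = X - B" unfolding D_def X_def by auto
    have centred_eq: "centred p (u * f a) = centred p (u * t * a)" for a
    proof (rule centred_unique[OF p0 p(3)])
      show "2 * \<bar>centred p (u * t * a)\<bar> < p" by (rule centred_bounds[OF p0 p(3)])
      have "p dvd (centred p (u * t * a) - u * t * a) - u * (f a - t * a)"
        unfolding f_def by (intro dvd_diff dvd_mult centred_dvd)
      then show "p dvd centred p (u * t * a) - u * f a" by (simp add: algebra_simps)
    qed
    have injD: "inj_on f D" by (rule inj_on_subset[OF injA1]) (simp add: D_def)
    have "(\<Sum>a\<in>D. \<bar>centred p (u * t * a)\<bar>) = (\<Sum>y\<in>f ` D. \<bar>centred p (u * y)\<bar>)"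
      using injD by (simp add: sum.reindex centred_eq)
    then have tot: "(\<Sum>a\<in>D. \<bar>centred p (u * t * a)\<bar>) < p" using u fD by simp
    have DA: "D \<subseteq> A" unfolding D_def A1_def by auto
    have cD: "card D = card X - card B"
      using card_image[OF injD] fD card_Diff_subset[OF finite_subset[OF B(1) fX] B(1)] by simp
    moreover have "card B \<le> card X" by (rule card_mono[OF fX B(1)])
    moreover have "card (A - D) + card D = k"
      unfolding k_def using card_Diff_subset[OF finite_subset[OF DA fA] DA] card_mono[OF fA DA] by linarith
    ultimately have "card (A - D) = card B + card bad" using cX cA by linarith
    then have "E * card (A - D) = E * card B + E * card bad" by (simp add: algebra_simps)
    moreover have "4 * (E * card B) \<le> k" using B(2) cX cA by simp
    ultimately have "E * card (A - D) \<le> card A" using cbad unfolding k_def by linarith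
    moreover have "\<not> p dvd u * t" using u pt p(1) prime_dvd_mult_iff by blast
    ultimately show ?thesis using DA tot by (intro exI[of _ "u * t"] exI[of _ D]) auto
  qed
  then show ?thesis by (intro exI[of _ "N + (2 * n0)\<^sup>2 + 16 * C + 1"]) blast
qed

section \<open>Distinct integers of small total\<close>

lemma sum_distinct_ge:
  fixes Q :: "int set"
  shows "finite Q \<Longrightarrow> (\<And>x. x \<in> Q \<Longrightarrow> a < x) \<Longrightarrow> int (card Q) * (2 * a + int (card Q) + 1) \<le> 2 * \<Sum>Q"
proof (induction "card Q" arbitrary: Q)
  case 0
  then show ?case by simp
next
  case (Suc n)
  then have "Q \<noteq> {}" by auto
  define m where "m = Max Q"
  have m: "m \<in> Q" "\<And>x. x \<in> Q \<Longrightarrow> x \<le> m" unfolding m_def using Suc.prems \<open>Q \<noteq> {}\<close> by auto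
  have c: "card (Q - {m}) = n" using Suc m by simp
  define W where "W = int n * (2 * a + int n + 1)"
  define S where "S = \<Sum>(Q - {m})"
  have "W \<le> 2 * S"
    unfolding W_def S_def using Suc.hyps(1)[of "Q - {m}"] c Suc.prems by simp
  moreover have QS: "\<Sum>Q = m + S" unfolding S_def using Suc.prems m by (simp add: sum.remove)
  moreover have "Q \<subseteq> {a + 1..m}" using m Suc.prems by force
  then have "card Q \<le> nat (m - a)" using card_mono[of "{a + 1..m}" Q] by simp
  then have "a + int (Suc n) \<le> m" using Suc.hyps(2) by linarith
  ultimately have "W + 2 * (a + int (Suc n)) \<le> 2 * (m + S)" by (simp add: algebra_simps)
  then have "W + 2 * (a + int (Suc n)) \<le> 2 * \<Sum>Q" unfolding QS .
  then show ?case unfolding W_def Suc.hyps(2)[symmetric] by (simp add: algebra_simps)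
qed

text \<open>\<open>Q\<close> has k - m elements up to \<open>k\<close> and m - e beyond it. The
  least possible total of such a set is at least about (k^2 + m^2)/2 - k e, so a total near k^2 / 2
  makes m^2 small compared with k^2 once \<open>e\<close> is small compared with
  \<open>k\<close>.\<close>

lemma missing_bound:
  fixes Q :: "int set" and k m e :: int
  assumes Q: "finite Q" "\<And>x. x \<in> Q \<Longrightarrow> 0 < x" and k: "k \<ge> 0"
    and m: "int (card (Q \<inter> {1..k})) = k - m" and e: "int (card Q) = k - e" and s: "2 * \<Sum>Q < k * k + 3 * k"
    and e0: "e \<ge> 0" "m \<le> k"
  shows "m * m \<le> 3 * k + 2 * e * k"
proof -
  define P where "P = Q \<inter> {1..k}"
  define R where "R = Q - {1..k}"
  have QPR: "Q = P \<union> R" "P \<inter> R = {}" unfolding P_def R_def by auto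
  have fin: "finite P" "finite R" using Q unfolding P_def R_def by auto
  have "card Q = card P + card R" using card_Un_disjoint[OF fin QPR(2)] QPR(1) by simp
  then have cR: "int (card R) = m - e" using m e unfolding P_def by linarith
  have sQ: "\<Sum>Q = \<Sum>P + \<Sum>R" unfolding QPR(1) by (rule sum.union_disjoint[OF fin QPR(2)])
  have "(k - m) * (k - m + 1) \<le> 2 * \<Sum>P"
    using sum_distinct_ge[of P 0] fin m unfolding P_def by simp
  moreover have "(m - e) * (2 * k + (m - e) + 1) \<le> 2 * \<Sum>R"
    using sum_distinct_ge[of R k] fin cR Q unfolding R_def by force
  moreover have "(k - m) * (k - m + 1) = k * k - 2 * k * m + m * m + (k - m)" by (simp add: algebra_simps)
  moreover have "(m - e) * (2 * k + (m - e) + 1) = 2 * k * m - 2 * k * e + (m - e) * (m - e) + (m - e)" by (simp add: algebra_simps)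
  moreover have "0 \<le> (m - e) * (m - e)" by simp
  moreover have "0 \<le> m - e" using cR by linarith
  ultimately have "m * m \<le> 3 * k + 2 * k * e" using s sQ e0 by linarith
  then show ?thesis by (simp add: algebra_simps)
qed

subsection \<open>Filling an initial interval\<close>

text \<open>Serves to force g = 1: more than half of the absolute values up to \<open>k\<close>
  cannot share a divisor g >= 2.\<close>

lemma multiples_sparse:
  fixes D :: "int set" and g k :: int
  assumes D: "finite D" "inj_on abs D" "\<And>y. y \<in> D \<Longrightarrow> y \<noteq> 0 \<and> \<bar>y\<bar> \<le> k \<and> g dvd y" and g: "2 \<le> g"
  shows "2 * int (card D) \<le> max k 0"
proof -
  have "abs ` D \<subseteq> (\<lambda>i. g * i) ` {1..k div g}"
  proof
    fix z assume "z \<in> abs ` D"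
    then obtain y where y: "y \<in> D" "z = \<bar>y\<bar>" by auto
    then have "g dvd z" using D(3) by auto
    then obtain i where i: "z = g * i" by auto
    have z: "0 < z" "z \<le> k" using D(3)[OF y(1)] y by auto
    then have "0 < i" using g i by (simp add: zero_less_mult_iff)
    moreover have "(g * i) div g \<le> k div g" by (rule zdiv_mono1) (use z i g in auto)
    then have "i \<le> k div g" using g by simp
    ultimately show "z \<in> (\<lambda>i. g * i) ` {1..k div g}" using i by auto
  qed
  then have "card (abs ` D) \<le> card ((\<lambda>i. g * i) ` {1..k div g})" by (rule card_mono[rotated]) simp
  also have "\<dots> \<le> card {1..k div g}" by (rule card_image_le) simp
  finally have c: "card D \<le> nat (k div g)" using card_image[OF D(2)] by simp
  show ?thesis
  proof (cases "k \<ge> 0")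
    case True
    then have "0 \<le> k div g" using g by (simp add: pos_imp_zdiv_nonneg_iff)
    then have "2 * int (card D) \<le> 2 * (k div g)" using c by linarith
    also have "\<dots> \<le> g * (k div g)" by (rule mult_right_mono) (use g \<open>0 \<le> k div g\<close> in auto)
    also have "\<dots> \<le> k" by (rule mult_div_le) (use g in simp)
    finally show ?thesis by simp
  next
    case False
    then have "k div g < 0" using g by (simp add: pos_imp_zdiv_neg_iff)
    then show ?thesis using c by simp
  qed
qed

lemma centred_minus:
  assumes "p > 0" "odd p"
  shows "centred p (- x) = - centred p x"
proof (rule centred_unique[OF assms])
  show "2 * \<bar>- centred p x\<bar> < p" using centred_bounds[OF assms, of x] by simp
  have "- centred p x - (- x) = - (centred p x - x)" by simp
  then show "p dvd - centred p x - (- x)" using centred_dvd by (simp only: dvd_minus_iff)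
qed

lemma square_le_imp: "a * a \<le> b * b \<Longrightarrow> 0 \<le> b \<Longrightarrow> a \<le> b" for a b :: int
  by (metis abs_le_square_iff abs_of_nonneg abs_le_D1 power2_eq_square)

lemma sum_min_0:
  fixes D :: "int set"
  assumes "finite D"
  shows "(\<Sum>a\<in>D. min a 0) = - (\<Sum>a\<in>{a\<in>D. a < 0}. \<bar>a\<bar>)"
    and "(\<Sum>a\<in>D. min a 0) + (\<Sum>a\<in>D. \<bar>a\<bar>) = (\<Sum>a\<in>{a\<in>D. 0 < a}. \<bar>a\<bar>)"
proof -
  have "(\<Sum>a\<in>D. min a 0) = (\<Sum>a\<in>D. if a < 0 then - \<bar>a\<bar> else 0)" by (rule sum.cong) auto
  then show "(\<Sum>a\<in>D. min a 0) = - (\<Sum>a\<in>{a\<in>D. a < 0}. \<bar>a\<bar>)"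
    by (simp only: sum.inter_filter[OF assms, symmetric] sum_negf)
  have "(\<Sum>a\<in>D. min a 0) + (\<Sum>a\<in>D. \<bar>a\<bar>) = (\<Sum>a\<in>D. if 0 < a then \<bar>a\<bar> else 0)"
    unfolding sum.distrib[symmetric] by (rule sum.cong) auto
  then show "(\<Sum>a\<in>D. min a 0) + (\<Sum>a\<in>D. \<bar>a\<bar>) = (\<Sum>a\<in>{a\<in>D. 0 < a}. \<bar>a\<bar>)"
    by (simp only: sum.inter_filter[OF assms])
qed

text \<open>There are three losses of at most k / M each: \<open>m\<close> absolute values missing
  from {1..k}, \<open>b\<close> elements spent on a second progression, and \<open>nu\<close>
  elements of the wrong sign.\<close>

lemma mostly_interval:
  fixes M :: nat
  assumes M: "M \<ge> 5"
  shows "\<exists>N. \<forall>p A. prime p \<longrightarrow> int N \<le> p \<longrightarrow> odd p \<longrightarrow> zero_free_mod p A \<longrightarrow>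
     2 * p < int (card A) * int (card A) + 3 * int (card A) \<longrightarrow>
     (\<exists>t. \<not> p dvd t \<and> int M * (int (card A) - int (card ((\<lambda>a. centred p (t * a)) ` A \<inter> {1..int (card A)}))) \<le> 3 * int (card A))"
proof -
  \<comment> \<open>\<open>m\<close> and \<open>nu\<close> are controlled through m^2 <= 3 k + 2 e k
    and nu^2 <= 2 b k, so a precision 1/M for them needs \<open>e\<close> and \<open>b\<close> at
    most k / (4 M^2).\<close>
  define E where "E = 4 * M\<^sup>2"
  have E1: "E \<ge> 1" unfolding E_def using M by simp
  from small_total_dilation[OF this] obtain N where N: "\<forall>p A. prime p \<longrightarrow> int N \<le> p \<longrightarrow> odd p \<longrightarrow> zero_free_mod p A \<longrightarrow> p \<le> (int (card A))\<^sup>2 \<longrightarrow>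
     (\<exists>t D. \<not> p dvd t \<and> D \<subseteq> A \<and> E * card (A - D) \<le> card A \<and> (\<Sum>a\<in>D. \<bar>centred p (t * a)\<bar>) < p)" by blast
  have two: "(2::nat) \<ge> 1" by simp
  from exists_progression[OF two E1] obtain n0 where n0: "\<forall>n X L. n0 \<le> n \<longrightarrow> finite X \<longrightarrow> X \<subseteq> {- int L..int L} \<longrightarrow> n \<le> card X \<longrightarrow> L \<le> 2 * n \<longrightarrow>
    (\<exists>B x g. B \<subseteq> X \<and> E * card B \<le> n \<and> 0 < g \<and> g \<le> 8 * int 2 \<and> covers B x g L \<and> (\<forall>y\<in>X - B. g dvd y))"
    by blast
  define K0 where "K0 = 2 * n0 + 6 * M\<^sup>2"
  have "\<exists>t. \<not> p dvd t \<and> int M * (int (card A) - int (card ((\<lambda>a. centred p (t * a)) ` A \<inter> {1..int (card A)}))) \<le> 3 * int (card A)"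
    if p: "prime p" "int (N + K0\<^sup>2 + 5) \<le> p" "odd p" and A: "zero_free_mod p A"
      and kp: "2 * p < int (card A) * int (card A) + 3 * int (card A)" for p A
  proof -
    have p0: "p > 0" using p prime_gt_0_int by blast
    have fA: "finite A" using A unfolding zero_free_mod_def by auto
    define k where "k = int (card A)"
    have kn: "k \<ge> 0" unfolding k_def by simp
    have kp': "2 * p < k * k + 3 * k" using kp unfolding k_def .
    have "k \<ge> 3"
    proof (rule ccontr)
      assume "\<not> k \<ge> 3"
      then have "k = 0 \<or> k = 1 \<or> k = 2" using kn by linarith
      then have "k * k + 3 * k \<le> 10" by auto
      then show False using kp' p(2) by linarith
    qed
    then have "3 * k \<le> k * k" by (intro mult_right_mono) auto
    then have "p \<le> k * k" using kp' by linarith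
    then have pk: "p \<le> (int (card A))\<^sup>2" unfolding k_def power2_eq_square .
    obtain t D where t: "\<not> p dvd t" "D \<subseteq> A" "E * card (A - D) \<le> card A" "(\<Sum>a\<in>D. \<bar>centred p (t * a)\<bar>) < p"
      using N[rule_format, OF p(1) _ p(3) A pk] p(2) by auto
    have "int (K0\<^sup>2) \<le> (int (card A))\<^sup>2" using pk p(2) by linarith
    then have "K0\<^sup>2 \<le> (card A)\<^sup>2" by (metis of_nat_le_iff of_nat_power)
    then have K0: "K0 \<le> card A" by (simp only: power2_nat_le_eq_le)
    have kn0: "2 * int n0 \<le> k" and kM: "6 * (int M * int M) \<le> k"
    proof -
      have "int K0 = 2 * int n0 + 6 * (int M * int M)" unfolding K0_def by (simp add: power2_eq_square)
      moreover have "int K0 \<le> k" using K0 unfolding k_def by simp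
      moreover have "0 \<le> int M * int M" by simp
      ultimately show "2 * int n0 \<le> k" "6 * (int M * int M) \<le> k" by linarith+
    qed
    define f where "f = (\<lambda>a. centred p (t * a))"
    define X where "X = f ` A"
    have zX: "zero_free_mod p X" and inj: "inj_on f A" using centred_image_zero_free_mod[OF p(1) A t(1)] unfolding f_def X_def by auto
    have p2: "p > 2" using p(2) by linarith
    have absX: "inj_on abs X" by (rule zero_free_mod_abs_inj[OF zX p2])
    have X0: "0 \<notin> X"
    proof
      assume "0 \<in> X"
      then have "\<not> p dvd \<Sum>{0::int}" by (intro zero_free_modD[OF zX]) auto
      then show False by simp
    qed
    have fX: "finite X" unfolding X_def using fA by simp
    define e where "e = int (card (A - D))"
    have e: "0 \<le> e" "4 * (int M * int M) * e \<le> k"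
    proof -
      have "int (E * card (A - D)) \<le> int (card A)" using t(3) by (simp only: of_nat_le_iff)
      then show "4 * (int M * int M) * e \<le> k" unfolding e_def k_def E_def by (simp add: power2_eq_square)
    qed (simp add: e_def)
    define X4 where "X4 = f ` D"
    have X4X: "X4 \<subseteq> X" unfolding X4_def X_def using t(2) by auto
    have injD: "inj_on f D" by (rule inj_on_subset[OF inj t(2)])
    have cD: "int (card D) = k - e"
      unfolding e_def k_def using card_Diff_subset[OF finite_subset[OF t(2) fA] t(2)] card_mono[OF fA t(2)] by simp
    then have cX4: "int (card X4) = k - e" unfolding X4_def using card_image[OF injD] by simp
    have absX4: "inj_on abs X4" by (rule inj_on_subset[OF absX X4X])
    define Q where "Q = abs ` X4"
    have fX4: "finite X4" using X4X fX finite_subset by blast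
    have fQ: "finite Q" unfolding Q_def using fX4 by simp
    have cQ: "int (card Q) = k - e" unfolding Q_def using card_image[OF absX4] cX4 by simp
    have Qpos: "0 < x" if "x \<in> Q" for x using that X0 X4X unfolding Q_def by auto
    have "\<Sum>Q = (\<Sum>y\<in>X4. \<bar>y\<bar>)" unfolding Q_def using absX4 by (simp add: sum.reindex)
    also have "\<dots> = (\<Sum>a\<in>D. \<bar>f a\<bar>)" unfolding X4_def using injD by (simp add: sum.reindex)
    finally have "2 * \<Sum>Q < k * k + 3 * k" using t(4) kp' unfolding f_def by linarith
    define m where "m = k - int (card (Q \<inter> {1..k}))"
    have mk: "m \<le> k" unfolding m_def by simp
    have "card (Q \<inter> {1..k}) \<le> card {1..k}" by (rule card_mono) auto
    then have m0: "0 \<le> m" unfolding m_def using kn by simp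
    have mb: "m * m \<le> 3 * k + 2 * e * k"
      by (rule missing_bound[OF fQ Qpos kn _ cQ \<open>2 * \<Sum>Q < _\<close> e(1) mk]) (simp_all add: m_def)
    define mu where "mu = int M"
    have mu4: "mu \<ge> 5" unfolding mu_def using M by simp
    have mm: "mu * m \<le> k"
    proof (rule square_le_imp[OF _ kn])
      have "(mu * m) * (mu * m) = (mu * mu) * (m * m)" by simp
      also have "\<dots> \<le> (mu * mu) * (3 * k + 2 * e * k)" by (rule mult_left_mono[OF mb]) simp
      also have "2 * \<dots> = (6 * (mu * mu)) * k + (4 * (mu * mu) * e) * k" by (simp add: algebra_simps)
      also have "\<dots> \<le> k * k + k * k"
        using kM e(2) kn unfolding mu_def by (intro add_mono mult_right_mono) auto
      finally show "(mu * m) * (mu * m) \<le> k * k"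
        by (metis mult_2 mult_le_cancel_left_pos zero_less_numeral dual_order.trans order_refl)
    qed
    define X5 where "X5 = {y \<in> X4. \<bar>y\<bar> \<le> k}"
    have X5X: "X5 \<subseteq> X" unfolding X5_def using X4X by auto
    have fX5: "finite X5" using X5X fX finite_subset by blast
    have "abs ` X5 = Q \<inter> {1..k}"
    proof
      show "abs ` X5 \<subseteq> Q \<inter> {1..k}"
      proof
        fix z assume "z \<in> abs ` X5"
        then obtain y where y: "y \<in> X4" "\<bar>y\<bar> \<le> k" "z = \<bar>y\<bar>" unfolding X5_def by auto
        then have "z \<in> Q" unfolding Q_def by blast
        then show "z \<in> Q \<inter> {1..k}" using y Qpos[of z] by auto
      qed
      show "Q \<inter> {1..k} \<subseteq> abs ` X5" unfolding X5_def Q_def by auto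
    qed
    then have cX5: "int (card X5) = k - m"
      using card_image[OF inj_on_subset[OF absX X5X]] unfolding m_def by simp
    have m4: "5 * m \<le> k"
    proof -
      have "5 * m \<le> mu * m" using mu4 m0 by (rule mult_right_mono)
      then show ?thesis using mm by linarith
    qed
    have "\<exists>B x g. B \<subseteq> X5 \<and> E * card B \<le> card X5 \<and> 0 < g \<and> g \<le> 8 * int 2 \<and> covers B x g (card A) \<and> (\<forall>y\<in>X5 - B. g dvd y)"
    proof (rule n0[rule_format])
      show "n0 \<le> card X5" using cX5 m4 kn0 kn m0 by linarith
      show "X5 \<subseteq> {- int (card A)..int (card A)}" unfolding X5_def k_def by (auto simp: abs_le_iff)
      show "card A \<le> 2 * card X5" using cX5 m4 kn m0 unfolding k_def by linarith
    qed (use fX5 in auto)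
    then obtain B x g where B: "B \<subseteq> X5" "E * card B \<le> card X5" "0 < g"
        "covers B x g (card A)" "\<forall>y\<in>X5 - B. g dvd y" by blast
    define b where "b = int (card B)"
    have b: "0 \<le> b" "4 * (mu * mu) * b \<le> k"
    proof -
      have "int (E * card B) \<le> int (card X5)" using B(2) by (simp only: of_nat_le_iff)
      then show "4 * (mu * mu) * b \<le> k" using cX5 m0 unfolding b_def mu_def E_def by (simp add: power2_eq_square)
    qed (simp add: b_def)
    have mub: "mu * b \<le> k"
    proof -
      have "1 * (mu * b) \<le> (4 * mu) * (mu * b)" using mu4 b(1) by (intro mult_right_mono) auto
      also have "\<dots> = 4 * (mu * mu) * b" by simp
      finally show ?thesis using b(2) by linarith
    qed
    have b4: "5 * b \<le> k"
    proof -
      have "5 * b \<le> mu * b" using mu4 b(1) by (rule mult_right_mono)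
      then show ?thesis using mub by linarith
    qed
    define G where "G = X5 - B"
    have fG: "finite G" unfolding G_def using fX5 by simp
    have cG: "int (card G) = k - m - b"
      unfolding G_def b_def using card_Diff_subset[OF finite_subset[OF B(1) fX5] B(1)] card_mono[OF fX5 B(1)] cX5 by simp
    have GX: "G \<subseteq> X" unfolding G_def using X5X by auto
    have Gk: "y \<noteq> 0 \<and> \<bar>y\<bar> \<le> k \<and> g dvd y" if "y \<in> G" for y
      using that B(5) GX X0 unfolding G_def X5_def by auto
    have "g = 1"
    proof (rule ccontr)
      assume "g \<noteq> 1"
      then have "2 \<le> g" using B(3) by linarith
      from multiples_sparse[OF fG inj_on_subset[OF absX GX] Gk this]
      have "2 * int (card G) \<le> max k 0" .
      then have "2 * k - 2 * m - 2 * b \<le> k" using cG kn by (simp add: algebra_simps)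
      then show False using m4 b4 \<open>k \<ge> 3\<close> by linarith
    qed
    have c0: "covers_mod p B x (card A)"
      using B(4) unfolding \<open>g = 1\<close> covers_def covers_mod_def by (metis diff_self dvd_0_right mult_1)
    have fB: "finite B" using B(1) fX5 finite_subset by blast
    define lo where "lo = x + (\<Sum>a\<in>G. min a 0)"
    define H where "H = card A + nat (\<Sum>a\<in>G. \<bar>a\<bar>)"
    have c1: "covers_mod p (B \<union> G) lo H"
      unfolding lo_def H_def
    proof (rule covers_mod_extend[OF fG c0 fB])
      show "\<forall>a\<in>G. \<bar>a\<bar> \<le> int (card A) + 1" using Gk unfolding k_def by fastforce
    qed (auto simp: G_def)
    have z1: "zero_free_mod p (B \<union> G)" by (rule zero_free_mod_subset[OF zX]) (use B(1) X5X GX in auto)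
    \<comment> \<open>With g = 1 the interval consists of actual integers, and it avoids 0. Its left
      end is \<open>x\<close> minus the total of the negative elements of \<open>G\<close>, its
      right end at least \<open>x\<close> plus the total of the positive ones, and \<open>x\<close>
      is a sum over \<open>B\<close>. So one of the two totals is at most |x| <= b * k.\<close>
    have side: "0 < lo \<or> lo + int H < 0"
    proof (rule ccontr)
      assume "\<not> ?thesis"
      then have "nat (- lo) \<le> H" "lo + int (nat (- lo)) = 0" by auto
      then show False using covers_mod_zero_free_mod[OF z1 c1, of "nat (- lo)"] by simp
    qed
    have xb: "\<bar>x\<bar> \<le> b * k"
    proof -
      obtain Z where Z: "Z \<subseteq> B" "\<Sum>Z = x" using B(4)[unfolded covers_def, rule_format, of 0] by auto
      have "\<bar>\<Sum>Z\<bar> \<le> int (card Z) * k" by (rule abs_sum_le) (use Z B(1) in \<open>auto simp: X5_def abs_le_iff\<close>)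
      also have "\<dots> \<le> b * k" by (rule mult_right_mono) (use card_mono[OF fB Z(1)] kn in \<open>auto simp: b_def\<close>)
      finally show ?thesis using Z by simp
    qed
    have key: "mu * (k - int (card ((\<lambda>y. s * y) ` X \<inter> {1..k}))) \<le> 3 * k"
      if s: "s = 1 \<or> s = -1" and sm: "(\<Sum>y\<in>{y\<in>G. s * y < 0}. \<bar>y\<bar>) \<le> b * k" for s :: int
    proof -
      define V where "V = {y \<in> G. s * y < 0}"
      have VG: "V \<subseteq> G" unfolding V_def by auto
      have fV: "finite V" unfolding V_def using fG by simp
      have absV: "inj_on abs V" by (rule inj_on_subset[OF absX]) (use VG GX in auto)
      define nu where "nu = int (card V)"
      have "int (card (abs ` V)) * (2 * 0 + int (card (abs ` V)) + 1) \<le> 2 * \<Sum>(abs ` V)"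
        by (rule sum_distinct_ge) (use fV Gk VG in auto)
      also have "\<Sum>(abs ` V) = (\<Sum>y\<in>V. \<bar>y\<bar>)" using absV by (simp add: sum.reindex)
      finally have "nu * nu + nu \<le> 2 * (b * k)"
        using sm card_image[OF absV] unfolding nu_def V_def by (simp add: algebra_simps)
      then have nub: "nu * nu \<le> 2 * (b * k)" unfolding nu_def by linarith
      have "mu * nu \<le> k"
      proof (rule square_le_imp[OF _ kn])
        have "(mu * nu) * (mu * nu) = (mu * mu) * (nu * nu)" by simp
        also have "\<dots> \<le> (mu * mu) * (2 * (b * k))" by (rule mult_left_mono[OF nub]) simp
        also have "2 * \<dots> = (4 * (mu * mu) * b) * k" by simp
        also have "\<dots> \<le> k * k" by (rule mult_right_mono[OF b(2) kn])
        finally have "2 * ((mu * nu) * (mu * nu)) \<le> k * k" by simp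
        moreover have "0 \<le> (mu * nu) * (mu * nu)" by simp
        ultimately show "(mu * nu) * (mu * nu) \<le> k * k" by linarith
      qed
      have sub: "(\<lambda>y. s * y) ` (G - V) \<subseteq> (\<lambda>y. s * y) ` X \<inter> {1..k}"
      proof
        fix z assume "z \<in> (\<lambda>y. s * y) ` (G - V)"
        then obtain y where y: "y \<in> G" "\<not> s * y < 0" "z = s * y" unfolding V_def by auto
        then have "z \<noteq> 0" "\<bar>z\<bar> \<le> k" using Gk[OF y(1)] s by auto
        then have "1 \<le> z" "z \<le> k" using y(2) unfolding y(3) by linarith+
        then show "z \<in> (\<lambda>y. s * y) ` X \<inter> {1..k}" using y GX by auto
      qed
      have "card ((\<lambda>y. s * y) ` (G - V)) = card (G - V)"
        by (rule card_image) (use s in \<open>auto simp: inj_on_def\<close>)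
      then have "card (G - V) \<le> card ((\<lambda>y. s * y) ` X \<inter> {1..k})"
        using card_mono[OF _ sub] by simp
      moreover have "int (card (G - V)) = k - m - b - nu"
        unfolding nu_def using card_Diff_subset[OF fV VG] card_mono[OF fG VG] cG by simp
      ultimately have "k - int (card ((\<lambda>y. s * y) ` X \<inter> {1..k})) \<le> m + b + nu" by linarith
      then have "mu * (k - int (card ((\<lambda>y. s * y) ` X \<inter> {1..k}))) \<le> mu * (m + b + nu)"
        by (rule mult_left_mono) (use mu4 in simp)
      also have "\<dots> = mu * m + mu * b + mu * nu" by (simp add: algebra_simps)
      finally show ?thesis using mm mub \<open>mu * nu \<le> k\<close> by linarith
    qed
    have "\<exists>s::int. (s = 1 \<or> s = -1) \<and> (\<Sum>y\<in>{y\<in>G. s * y < 0}. \<bar>y\<bar>) \<le> b * k"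
      using side
    proof
      assume "0 < lo"
      then have "(\<Sum>y\<in>{y\<in>G. y < 0}. \<bar>y\<bar>) \<le> b * k"
        unfolding lo_def sum_min_0(1)[OF fG] using xb by linarith
      then show ?thesis by (intro exI[of _ 1]) simp
    next
      assume "lo + int H < 0"
      moreover have "0 \<le> (\<Sum>a\<in>G. \<bar>a\<bar>)" by (rule sum_nonneg) simp
      ultimately have "x + ((\<Sum>a\<in>G. min a 0) + (\<Sum>a\<in>G. \<bar>a\<bar>)) < 0" unfolding lo_def H_def by simp
      then have "(\<Sum>y\<in>{y\<in>G. 0 < y}. \<bar>y\<bar>) \<le> b * k"
        unfolding sum_min_0(2)[OF fG] using xb by linarith
      then show ?thesis by (intro exI[of _ "-1"]) simp
    qed
    then obtain s :: int where s: "s = 1 \<or> s = -1" "(\<Sum>y\<in>{y\<in>G. s * y < 0}. \<bar>y\<bar>) \<le> b * k" by blast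
    have "(\<lambda>y. s * y) ` X = (\<lambda>a. centred p (s * t * a)) ` A"
      unfolding X_def f_def image_image using s(1) centred_minus[OF p0 p(3)] by auto
    moreover have "\<not> p dvd s * t" using s(1) t(1) by auto
    ultimately show ?thesis using key[OF s] unfolding mu_def k_def by (intro exI[of _ "s * t"]) simp
  qed
  then show ?thesis by (intro exI[of _ "N + K0\<^sup>2 + 5"]) blast
qed

text \<open>Each missing element spoils at most one of the pairs \<open>(i, n - i)\<close>.\<close>

lemma two_term_sum:
  fixes P :: "int set" and j h n :: int
  assumes h: "int (card ({1..j} - P)) \<le> h" and n: "2 * h + 3 \<le> n" "n \<le> 2 * j - 2 * h - 1" and j: "j \<ge> 0"
  shows "\<exists>i. i \<in> P \<and> n - i \<in> P \<and> 1 \<le> i \<and> i < n - i \<and> n - i \<le> j"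
proof (rule ccontr)
  assume no: "\<not> ?thesis"
  define I where "I = {max 1 (n - j)..(n - 1) div 2}"
  have I: "1 \<le> i \<and> n - j \<le> i \<and> i < n - i" if "i \<in> I" for i using that unfolding I_def by auto
  define f where "f = (\<lambda>i. if i \<in> P then n - i else i)"
  have "inj_on f I" unfolding f_def inj_on_def using I by (smt (verit))
  moreover have "f ` I \<subseteq> {1..j} - P"
  proof
    fix z assume "z \<in> f ` I"
    then obtain i where i: "i \<in> I" "z = f i" by auto
    then show "z \<in> {1..j} - P" using I[OF i(1)] no unfolding f_def by (auto split: if_splits)
  qed
  ultimately have "card I \<le> card ({1..j} - P)" by (intro card_inj_on_le) auto
  then have "int (card I) \<le> h" using h by linarith
  moreover have "int (card I) \<ge> h + 1"
  proof -
    have "(n - 1) div 2 - max 1 (n - j) + 1 \<ge> h + 1" using n by (simp add: max_def; linarith)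
    then show ?thesis unfolding I_def by simp
  qed
  ultimately show False by simp
qed

subsection \<open>Near-extremal sets\<close>

lemma sum_atLeast1_int: "2 * \<Sum>{1..int j} = int j * (int j + 1)"
proof (induction j)
  case (Suc j)
  have "{1..int (Suc j)} = insert (int (Suc j)) {1..int j}" by auto
  then have "\<Sum>{1..int (Suc j)} = int (Suc j) + \<Sum>{1..int j}" by simp
  then have "2 * \<Sum>{1..int (Suc j)} = 2 * int (Suc j) + int j * (int j + 1)" using Suc by simp
  then show ?case by (simp add: algebra_simps)
qed simp

text \<open>Pairs of small elements already yield an interval of length about \<open>k\<close>, and
  the large elements prolong it one by one. The upper part of the range follows by complementation,
  n to \<Sum>P - n.\<close>

lemma interval_sums:
  fixes P :: "int set" and k h n :: int
  assumes P: "P \<subseteq> {1..k}" and h: "int (card ({1..k} - P)) = h" "100 * h \<le> k" and k: "k \<ge> 1000"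
    and n: "2 * h + 3 \<le> n" "n \<le> \<Sum>P - (2 * h + 3)"
  shows "\<exists>Z\<subseteq>P. \<Sum>Z = n"
proof -
  define u where "u = 2 * h + 3"
  have h0: "0 \<le> h" using h by simp
  have fP: "finite P" using P finite_subset by blast
  define c where "c = int (card P)"
  have c: "c = k - h"
    using h(1) card_Diff_subset[OF fP P] card_mono[OF _ P] k unfolding c_def by simp
  \<comment> \<open>The ratio 3/5 lies between 1/2 and 1/sqrt 2: pair sums from {1..j} must span a
    length of about \<open>k\<close>, while the elements up to \<open>j\<close> must make up less
    than half of the total.\<close>
  define j where "j = 3 * k div 5"
  have j: "5 * j \<le> 3 * k" "3 * k < 5 * j + 5" "0 \<le> j" unfolding j_def using k by auto
  define P1 where "P1 = P \<inter> {1..j}"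
  define D where "D = P \<inter> {j + 1..k}"
  have "P = P1 \<union> D" unfolding P1_def D_def using P j k by auto
  moreover have disj: "P1 \<inter> D = {}" unfolding P1_def D_def by auto
  moreover have fin: "finite P1" "finite D" unfolding P1_def D_def using fP by auto
  ultimately have PD: "P1 \<union> D = P" "\<Sum>P = \<Sum>P1 + \<Sum>D" by (auto simp: sum.union_disjoint)
  have "card ({1..j} - P1) \<le> card ({1..k} - P)"
    by (rule card_mono) (use j k in \<open>auto simp: P1_def\<close>)
  then have h1: "int (card ({1..j} - P1)) \<le> h" using h by simp
  define H where "H = 2 * j - 2 * h - 1 - u"
  have "k \<le> 2 * j - 4 * h - 3" using j h(2) k by linarith
  then have H: "k \<le> H + 1" unfolding H_def u_def by (simp add: algebra_simps)
  have c0: "covers_mod 0 P1 u (nat H)"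
    unfolding covers_mod_def
  proof (intro allI impI)
    fix i assume i: "i \<le> nat H"
    have "2 * h + 3 \<le> u + int i" "u + int i \<le> 2 * j - 2 * h - 1"
      using i H k unfolding H_def u_def by auto
    from two_term_sum[OF h1 this j(3)] obtain y where
      y: "y \<in> P1" "u + int i - y \<in> P1" "y < u + int i - y" by auto
    then have "{y, u + int i - y} \<subseteq> P1" "\<Sum>{y, u + int i - y} = u + int i" by auto
    then show "\<exists>Z\<subseteq>P1. Z \<noteq> {} \<and> 0 dvd \<Sum>Z - (u + int i)" by (intro exI[of _ "{y, u + int i - y}"]) auto
  qed
  have "\<forall>a\<in>D. \<bar>a\<bar> \<le> int (nat H) + 1" unfolding D_def using H j by auto
  from covers_mod_extend[OF fin(2) c0 fin(1) disj this]
  have c1: "covers_mod 0 P (u + (\<Sum>a\<in>D. min a 0)) (nat H + nat (\<Sum>a\<in>D. \<bar>a\<bar>))" unfolding PD(1) .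
  have "(\<Sum>a\<in>D. min a 0) = 0" by (rule sum.neutral) (use j in \<open>auto simp: D_def min_def\<close>)
  moreover have "(\<Sum>a\<in>D. \<bar>a\<bar>) = \<Sum>D" by (rule sum.cong) (use j in \<open>auto simp: D_def\<close>)
  ultimately have c2: "covers_mod 0 P u (nat H + nat (\<Sum>D))" using c1 by simp
  have low: "\<exists>Z\<subseteq>P. \<Sum>Z = y" if y: "u \<le> y" "y \<le> \<Sum>D" for y
  proof -
    have "nat (y - u) \<le> nat H + nat (\<Sum>D)" using y h0 unfolding u_def by linarith
    then obtain Z where "Z \<subseteq> P" "\<Sum>Z - (u + int (nat (y - u))) = 0"
      using c2[unfolded covers_mod_def, rule_format, of "nat (y - u)"] by auto
    then show ?thesis using y by (intro exI[of _ Z]) auto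
  qed
  have "n \<le> \<Sum>D \<or> \<Sum>P - n \<le> \<Sum>D"
  proof (rule ccontr)
    assume "\<not> ?thesis"
    then have 1: "\<Sum>P < 2 * \<Sum>P1" using PD(2) by linarith
    have "\<Sum>P1 \<le> \<Sum>{1..j}" by (rule sum_mono2) (auto simp: P1_def)
    then have 2: "2 * \<Sum>P1 \<le> j * j + j" using sum_atLeast1_int[of "nat j"] j(3) by (simp add: algebra_simps)
    have "c * (2 * 0 + c + 1) \<le> 2 * \<Sum>P" unfolding c_def by (rule sum_distinct_ge[OF fP]) (use P in auto)
    then have 3: "c * c + c \<le> 2 * \<Sum>P" by (simp add: algebra_simps)
    have 4: "c * c + c < 2 * (j * j) + 2 * j" using 1 2 3 by linarith
    have "(5 * j) * (5 * j) \<le> (3 * k) * (3 * k)" using mult_mono[OF j(1) j(1)] j(3) k by simp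
    then have 5: "25 * (j * j) \<le> 9 * (k * k)" by simp
    have ck: "99 * k \<le> 100 * c" using c h(2) by linarith
    have "0 \<le> k" using k by simp
    then have "(99 * k) * (99 * k) \<le> (100 * c) * (100 * c)" using mult_mono[OF ck ck] ck by simp
    then have 6: "9801 * (k * k) \<le> 10000 * (c * c)" by simp
    have 7: "1000 * k \<le> k * k" using k by (intro mult_right_mono) auto
    have "0 \<le> c" unfolding c_def by simp
    then show False using 4 5 6 7 j k by linarith
  qed
  then show ?thesis
  proof
    assume "n \<le> \<Sum>D"
    then show ?thesis using low n unfolding u_def by blast
  next
    assume "\<Sum>P - n \<le> \<Sum>D"
    then obtain Z where Z: "Z \<subseteq> P" "\<Sum>Z = \<Sum>P - n" using low[of "\<Sum>P - n"] n unfolding u_def by auto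
    have "\<Sum>(P - Z) = \<Sum>P - \<Sum>Z" by (rule sum_diff[OF fP Z(1)])
    then show ?thesis using Z(2) by (intro exI[of _ "P - Z"]) auto
  qed
qed

text \<open>The sums of \<open>P\<close> fill an interval of length H >= (k^2 + 3k)/4 > p / 2, so
  every other centred element can prolong it, whatever its size. For all of \<open>X\<close> the
  interval runs from u - Sn to Sp - u. It can contain neither 0 nor \<open>p\<close>, and it starts
  below \<open>p\<close> and ends at or above 0, hence it lies strictly between them.\<close>

lemma total_bounds:
  fixes p k h :: int
  assumes p: "p > 0" and X: "zero_free_mod p X" "\<And>x. x \<in> X \<Longrightarrow> 2 * \<bar>x\<bar> < p" and k: "k \<ge> 1000" "2 * p < k * k + 3 * k"
    and h: "int (card (X \<inter> {1..k})) = k - h" "100 * h \<le> k"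
  shows "(\<Sum>x\<in>{x\<in>X. x < 0}. \<bar>x\<bar>) < 2 * h + 3" "(\<Sum>x\<in>{x\<in>X. 0 < x}. \<bar>x\<bar>) < p + (2 * h + 3)"
proof -
  define u where "u = 2 * h + 3"
  have fX: "finite X" using X(1) unfolding zero_free_mod_def by auto
  define P where "P = X \<inter> {1..k}"
  have P: "P \<subseteq> {1..k}" unfolding P_def by auto
  have fP: "finite P" unfolding P_def using fX by simp
  have h1: "int (card ({1..k} - P)) = h"
    using h(1) card_Diff_subset[OF fP P] card_mono[OF _ P] k unfolding P_def by simp
  then have h0: "0 \<le> h" by simp
  define c where "c = int (card P)"
  have c: "c = k - h" unfolding c_def P_def using h(1) .
  have "c * (2 * 0 + c + 1) \<le> 2 * \<Sum>P" unfolding c_def by (rule sum_distinct_ge[OF fP]) (use P in auto)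
  then have 3: "c * c + c \<le> 2 * \<Sum>P" by (simp add: algebra_simps)
  have ck: "99 * k \<le> 100 * c" using c h(2) by linarith
  have "0 \<le> k" using k by simp
  then have "(99 * k) * (99 * k) \<le> (100 * c) * (100 * c)" using mult_mono[OF ck ck] ck by simp
  then have 6: "9801 * (k * k) \<le> 10000 * (c * c)" by simp
  have 7: "1000 * k \<le> k * k" using k by (intro mult_right_mono) auto
  define H where "H = \<Sum>P - 2 * u"
  have "k * k + 3 * k + 16 * h + 24 \<le> 4 * \<Sum>P" using 3 6 7 h(2) k(1) ck by linarith
  then have H: "k * k + 3 * k \<le> 4 * H" unfolding H_def u_def by (simp add: algebra_simps)
  have Hu: "u \<le> H" using H 7 k(1) h(2) unfolding u_def by linarith
  have u0: "0 < u" unfolding u_def using h0 by simp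
  have c0: "covers_mod p P u (nat H)"
    unfolding covers_mod_def
  proof (intro allI impI)
    fix i assume i: "i \<le> nat H"
    have "2 * h + 3 \<le> u + int i" "u + int i \<le> \<Sum>P - (2 * h + 3)"
      using i Hu u0 unfolding H_def u_def by auto
    from interval_sums[OF P h1 h(2) k(1) this] obtain Z where Z: "Z \<subseteq> P" "\<Sum>Z = u + int i" by auto
    moreover have "Z \<noteq> {}" using Z u0 by auto
    ultimately show "\<exists>Z\<subseteq>P. Z \<noteq> {} \<and> p dvd \<Sum>Z - (u + int i)" by (intro exI[of _ Z]) auto
  qed
  have Hp: "int (nat H) < p" by (rule covers_mod_zero_free_mod_length[OF p zero_free_mod_subset[OF X(1)] c0]) (simp add: P_def)
  define R where "R = X - P"
  have fR: "finite R" unfolding R_def using fX by simp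
  have "\<forall>a\<in>R. \<bar>a\<bar> \<le> int (nat H) + 1"
  proof
    fix a assume "a \<in> R"
    then have "2 * \<bar>a\<bar> < p" using X(2) unfolding R_def by simp
    then show "\<bar>a\<bar> \<le> int (nat H) + 1" using k(2) H by linarith
  qed
  then have "covers_mod p (P \<union> R) (u + (\<Sum>a\<in>R. min a 0)) (nat H + nat (\<Sum>a\<in>R. \<bar>a\<bar>))"
    by (rule covers_mod_extend[OF fR c0 fP, rotated]) (simp add: R_def)
  moreover have "P \<union> R = X" unfolding P_def R_def by auto
  moreover define lo where "lo = u + (\<Sum>a\<in>R. min a 0)"
  moreover define T where "T = nat H + nat (\<Sum>a\<in>R. \<bar>a\<bar>)"
  ultimately have cX: "covers_mod p X lo T" by simp
  define Sn where "Sn = (\<Sum>x\<in>{x\<in>X. x < 0}. \<bar>x\<bar>)"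
  define Sp where "Sp = (\<Sum>x\<in>{x\<in>X. 0 < x}. \<bar>x\<bar>)"
  have "{a \<in> R. a < 0} = {x \<in> X. x < 0}" unfolding R_def P_def by auto
  then have lo: "lo = u - Sn" unfolding lo_def Sn_def sum_min_0(1)[OF fR] by simp
  have "{x \<in> X. 0 < x} = P \<union> {a \<in> R. 0 < a}" "P \<inter> {a \<in> R. 0 < a} = {}" unfolding R_def P_def by auto
  then have "Sp = (\<Sum>x\<in>P. \<bar>x\<bar>) + (\<Sum>a\<in>{a\<in>R. 0 < a}. \<bar>a\<bar>)"
    unfolding Sp_def using fP fR by (simp add: sum.union_disjoint)
  moreover have "(\<Sum>x\<in>P. \<bar>x\<bar>) = \<Sum>P" by (rule sum.cong) (use P in auto)
  ultimately have Sp: "Sp = \<Sum>P + (\<Sum>a\<in>{a\<in>R. 0 < a}. \<bar>a\<bar>)" by simp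
  have "0 \<le> (\<Sum>a\<in>R. \<bar>a\<bar>)" by (rule sum_nonneg) simp
  then have "lo + int T = u + H + ((\<Sum>a\<in>R. min a 0) + (\<Sum>a\<in>R. \<bar>a\<bar>))"
    unfolding lo_def T_def using Hu u0 by simp
  then have hi: "lo + int T = Sp - u" unfolding sum_min_0(2)[OF fR] Sp H_def by simp
  have "0 \<le> (\<Sum>a\<in>{a\<in>R. 0 < a}. \<bar>a\<bar>)" by (rule sum_nonneg) simp
  then have hi0: "0 \<le> Sp - u" using Sp Hu u0 unfolding H_def by linarith
  have notin: "\<not> p dvd y" if "lo \<le> y" "y \<le> lo + int T" for y
    using covers_mod_zero_free_mod[OF X(1) cX, of "nat (y - lo)"] that by simp
  have "0 < lo" using notin[of 0] hi hi0 by force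
  then show "Sn < 2 * h + 3" using lo unfolding u_def by simp
  have "0 \<le> Sn" unfolding Sn_def by (rule sum_nonneg) simp
  then have "lo \<le> p" using lo Hu Hp by linarith
  then have "Sp - u < p" using notin[of p] hi by force
  then show "Sp < p + (2 * h + 3)" unfolding u_def by simp
qed

text \<open>
  Here \<open>N\<close> is the set of absolute values of the negative elements and \<open>Q\<close> the set of positive ones.
  The sum \<open>s\<close> of \<open>N\<close> is not a subset sum of \<open>Q\<close>, so one of \<open>i, s - i\<close> is outside \<open>Q\<close> whenever \<open>i \<noteq> s - i\<close>.
\<close>

lemma negative_part:
  fixes N Q :: "int set" and K :: int
  assumes fin: "finite N" "finite Q" and pos: "\<And>x. x \<in> N \<union> Q \<Longrightarrow> 0 < x"
    and F: "\<And>Y Z. Y \<subseteq> Q \<Longrightarrow> Z \<subseteq> N \<Longrightarrow> \<Sum>Y = \<Sum>Z \<Longrightarrow> Y = {} \<and> Z = {}"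
    and s: "\<Sum>N \<le> K" and m: "card ({1..K} - (N \<union> Q)) \<le> 1"
  shows "card N \<le> 2 \<and> \<Sum>N \<le> 4 \<and> (card ({1..K} - (N \<union> Q)) = 0 \<longrightarrow> card N \<le> 1 \<and> \<Sum>N \<le> 2)"
proof (cases "N = {}")
  case True
  then show ?thesis by simp
next
  case False
  define s where "s = \<Sum>N"
  have disj: "x \<notin> N" if "x \<in> Q" for x using F[of "{x}" "{x}"] that by auto
  have sQ: "s \<notin> Q" using F[of "{s}" N] unfolding s_def by auto
  have s0: "0 < s" unfolding s_def using fin(1) False pos by (intro sum_pos) auto
  have le: "\<Sum>Z \<le> s" if "Z \<subseteq> N" for Z unfolding s_def
    by (rule sum_mono2[OF fin(1) that]) (use pos in force)
  have no2: False if "i \<in> Q" "s - i \<in> Q" "2 * i \<noteq> s" for i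
  proof -
    have "\<Sum>{i, s - i} = \<Sum>N" using that unfolding s_def by simp
    then show False using F[of "{i, s - i}" N] that by auto
  qed
  define mis where "mis = {1..K} - (N \<union> Q)"
  have fm: "finite mis" unfolding mis_def by simp
  show ?thesis
  proof (cases "s \<in> N")
    case True
    have "N = {s}"
    proof (rule ccontr)
      assume "N \<noteq> {s}"
      then obtain y where y: "y \<in> N" "y \<noteq> s" using True by auto
      then have "\<Sum>{y, s} \<le> s" by (intro le) (use True in auto)
      then show False using y pos[of y] by simp
    qed
    \<comment> \<open>Folding i and s - i together shows that \<open>Q\<close> has at most s div 2
      elements below \<open>s\<close>. As N = {s}, the others are missing, so s - 1 <= s div 2 +
      card mis.\<close>
    define f where "f = (\<lambda>i. if 2 * i \<le> s then i else s - i)"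
    have "inj_on f (Q \<inter> {1..s - 1})"
      unfolding f_def inj_on_def using no2 by (smt (verit) IntD1 diff_diff_eq2 add_diff_cancel_left')
    moreover have "f ` (Q \<inter> {1..s - 1}) \<subseteq> {1..s div 2}" unfolding f_def by auto
    ultimately have "card (Q \<inter> {1..s - 1}) \<le> card {1..s div 2}" by (intro card_inj_on_le) auto
    then have 1: "int (card (Q \<inter> {1..s - 1})) \<le> s div 2" using s0 by simp
    have "{1..s - 1} \<subseteq> (Q \<inter> {1..s - 1}) \<union> mis"
      using s \<open>N = {s}\<close> unfolding mis_def s_def[symmetric] by auto
    then have "card {1..s - 1} \<le> card ((Q \<inter> {1..s - 1}) \<union> mis)" by (intro card_mono) (use fm in auto)
    also have "\<dots> \<le> card (Q \<inter> {1..s - 1}) + card mis" by (rule card_Un_le)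
    finally have "s - 1 \<le> s div 2 + int (card mis)" using 1 s0 by simp
    then have "s \<le> 4" "card mis = 0 \<longrightarrow> s \<le> 2" using m unfolding mis_def[symmetric] by linarith+
    moreover have "card N = 1" using \<open>N = {s}\<close> by simp
    ultimately show ?thesis unfolding mis_def[symmetric] s_def[symmetric] by simp
  next
    \<comment> \<open>Here \<open>s\<close> itself is the one missing number. \<open>N\<close> turns
      out to be symmetric under a to s - a, because s - a is the sum of the other elements of
      \<open>N\<close> and so is not in \<open>Q\<close>; then \<open>N\<close> contains every i < s
      except possibly s / 2.\<close>
    case sN: False
    have "s \<in> mis" unfolding mis_def using s s0 sQ sN unfolding s_def[symmetric] by auto
    then have mis: "mis = {s}" using m unfolding mis_def[symmetric]
      using card_le_Suc0_iff_eq[OF fm] by auto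
    have all: "i \<in> N \<or> i \<in> Q" if "1 \<le> i" "i < s" for i
    proof (rule ccontr)
      assume "\<not> ?thesis"
      then have "i \<in> mis" unfolding mis_def using that s unfolding s_def[symmetric] by auto
      then show False using mis that by simp
    qed
    have refl: "s - a \<in> N" if a: "a \<in> N" for a
    proof -
      have W: "\<Sum>(N - {a}) = s - a" unfolding s_def using fin(1) a by (simp add: sum_diff1)
      have "N - {a} \<noteq> {}" using a sN unfolding s_def by (cases "N = {a}") auto
      then have "0 < \<Sum>(N - {a})" using fin(1) pos by (intro sum_pos) auto
      then have "s - a \<in> N \<or> s - a \<in> Q" using W pos[of a] a by (intro all) auto
      moreover have "s - a \<notin> Q" using F[of "{s - a}" "N - {a}"] W by auto
      ultimately show ?thesis by simp
    qed
    have inN: "i \<in> N" if i: "1 \<le> i" "i < s" "2 * i \<noteq> s" for i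
    proof (rule ccontr)
      assume "i \<notin> N"
      then have "i \<in> Q" using all i by blast
      moreover have "s - i \<notin> N" using refl[of "s - i"] \<open>i \<notin> N\<close> by auto
      then have "s - i \<in> Q" using all[of "s - i"] i by auto
      ultimately show False using no2 i by blast
    qed
    have s4: "s \<le> 4"
    proof (rule ccontr)
      assume "\<not> s \<le> 4"
      then have "{1, 2, s - 1} \<subseteq> N" using inN[of 1] inN[of 2] inN[of "s - 1"] by auto
      from le[OF this] show False using \<open>\<not> s \<le> 4\<close> by simp
    qed
    have "card N \<le> 2"
    proof (rule ccontr)
      assume "\<not> card N \<le> 2"
      then have "3 \<le> int (card N)" by linarith
      then have "3 * (2 * 0 + 3 + 1) \<le> int (card N) * (2 * 0 + int (card N) + 1)" by (intro mult_mono) auto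
      also have "\<dots> \<le> 2 * \<Sum>N" by (rule sum_distinct_ge[OF fin(1)]) (use pos in auto)
      finally show False using s4 unfolding s_def by simp
    qed
    then show ?thesis using s4 mis unfolding mis_def[symmetric] s_def[symmetric] by simp
  qed
qed

text \<open>
  The alternatives correspond to none or one of the numbers up to \<open>k / 4\<close> missing among the absolute
  values; two missing ones would make the total too large. If \<open>v = \<Sum>Ps - p\<close> were a subset sum of the
  absolute values, reversing the summands in question would give \<open>p\<close>.
\<close>

lemma near_extremal_structure:
  fixes p k h :: int
  assumes p: "p > 0" and X: "zero_free_mod p X" "\<And>x. x \<in> X \<Longrightarrow> 2 * \<bar>x\<bar> < p" "p > 2" and k: "k = int (card X)" "k \<ge> 1000" "2 * p < k * k + 3 * k"
    and h: "int (card (X \<inter> {1..k})) = k - h" "100 * h \<le> k"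
  defines "Ng \<equiv> {x \<in> X. x < 0}" and "Ps \<equiv> {x \<in> X. 0 < x}"
  shows "(card Ng \<le> 1 \<and> (\<Sum>x\<in>Ng. \<bar>x\<bar>) \<le> 2 \<and> \<Sum>Ps \<le> p - 1 \<and> k * k + k \<le> 2 * (\<Sum>Ps + (\<Sum>x\<in>Ng. \<bar>x\<bar>))) \<or>
     (card Ng \<le> 2 \<and> (\<Sum>x\<in>Ng. \<bar>x\<bar>) \<le> 4 \<and> \<Sum>Ps \<le> p + 2 \<and> 2 * (k * k) + 5 * k \<le> 4 * (\<Sum>Ps + (\<Sum>x\<in>Ng. \<bar>x\<bar>)))"
proof -
  have fX: "finite X" using X(1) unfolding zero_free_mod_def by auto
  have X0: "0 \<notin> X"
  proof
    assume "0 \<in> X"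
    then have "\<not> p dvd \<Sum>{0::int}" by (intro zero_free_modD[OF X(1)]) auto
    then show False by simp
  qed
  define u where "u = 2 * h + 3"
  define N where "N = uminus ` Ng"
  define Q where "Q = N \<union> Ps"
  have fN: "finite N" "finite Ng" and fP: "finite Ps" unfolding N_def Ng_def Ps_def using fX by auto
  have cN: "card N = card Ng" unfolding N_def by (rule card_image) (simp add: inj_on_def)
  have sN: "\<Sum>N = (\<Sum>x\<in>Ng. \<bar>x\<bar>)"
  proof -
    have "\<Sum>N = (\<Sum>x\<in>Ng. - x)" unfolding N_def by (subst sum.reindex) (auto simp: inj_on_def)
    also have "\<dots> = (\<Sum>x\<in>Ng. \<bar>x\<bar>)" by (rule sum.cong) (auto simp: Ng_def)
    finally show ?thesis .
  qed
  have sP: "\<Sum>Ps = (\<Sum>x\<in>Ps. \<bar>x\<bar>)" by (rule sum.cong) (auto simp: Ps_def)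
  have Npos: "0 < x" if "x \<in> N" for x using that unfolding N_def Ng_def by auto
  have Ppos: "0 < x" if "x \<in> Ps" for x using that unfolding Ps_def by auto
  have tb: "\<Sum>N < u" "\<Sum>Ps < p + u"
    using total_bounds[OF p X(1,2) k(2,3) h] unfolding sN sP u_def Ng_def Ps_def by auto
  have u4: "4 * u < k" unfolding u_def using h(2) k(2) by (simp add: algebra_simps)
  have key: "\<not> p dvd \<Sum>Y - \<Sum>Z" if YZ: "Y \<subseteq> Ps" "Z \<subseteq> N" "Y \<noteq> {} \<or> Z \<noteq> {}" for Y Z
  proof -
    have "finite Y" "finite Z" using YZ fP fN finite_subset by auto
    moreover have "Y \<inter> uminus ` Z = {}" using YZ Npos Ppos by force
    ultimately have "\<Sum>(Y \<union> uminus ` Z) = \<Sum>Y - \<Sum>Z"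
      by (simp add: sum.union_disjoint sum.reindex inj_on_def sum_negf)
    moreover have "Y \<union> uminus ` Z \<subseteq> X" using YZ unfolding N_def Ng_def Ps_def by auto
    ultimately show ?thesis using zero_free_modD[OF X(1), of "Y \<union> uminus ` Z"] YZ(3) by auto
  qed
  have F: "Y = {} \<and> Z = {}" if "Y \<subseteq> Ps" "Z \<subseteq> N" "\<Sum>Y = \<Sum>Z" for Y Z
    using key[OF that(1,2)] that(3) by auto
  have disj: "N \<inter> Ps = {}" using F[of "{x}" "{x}" for x] by auto
  have cQ: "int (card Q) = k"
  proof -
    have "x < 0 \<or> 0 < x" if "x \<in> X" for x using X0 that by (metis linorder_less_linear)
    then have "X = Ng \<union> Ps" "Ng \<inter> Ps = {}" unfolding Ng_def Ps_def by auto
    then have "card X = card Ng + card Ps" using card_Un_disjoint[OF fN(2) fP] by simp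
    then show ?thesis unfolding k(1) Q_def using card_Un_disjoint[OF fN(1) fP disj] cN by simp
  qed
  have fQ: "finite Q" unfolding Q_def using fN fP by simp
  have Qpos: "0 < x" if "x \<in> Q" for x using that Npos Ppos unfolding Q_def by auto
  have sQ: "\<Sum>Q = \<Sum>Ps + \<Sum>N" unfolding Q_def using sum.union_disjoint[OF fN(1) fP disj, of "\<lambda>x. x"] by simp
  have excess: "(k + int (card W)) * (k + int (card W) + 1) \<le> 2 * (\<Sum>Q + \<Sum>W)"
    if W: "finite W" "W \<inter> Q = {}" "\<And>x. x \<in> W \<Longrightarrow> 0 < x" for W
  proof -
    have "int (card (Q \<union> W)) * (2 * 0 + int (card (Q \<union> W)) + 1) \<le> 2 * \<Sum>(Q \<union> W)"
      by (rule sum_distinct_ge) (use fQ W Qpos in auto)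
    moreover have "card (Q \<union> W) = card Q + card W" using W fQ by (intro card_Un_disjoint) auto
    moreover have "\<Sum>(Q \<union> W) = \<Sum>Q + \<Sum>W" using W fQ by (intro sum.union_disjoint) auto
    ultimately show ?thesis using cQ by simp
  qed
  \<comment> \<open>\<open>K\<close> exceeds \<open>u\<close>, which bounds both the sum of
    \<open>N\<close> and the excess of \<Sum>Ps over \<open>p\<close>. Yet two missing numbers up to
    k / 4 would give k^2 + 5k + 6 <= 2 \<Sum>Q + k, while 2 \<Sum>Q < 2p + 4u < k^2 + 4k.\<close>
  define K where "K = k div 4"
  have K: "4 * K \<le> k" "k < 4 * K + 4" unfolding K_def by auto
  define mis where "mis = {1..K} - (N \<union> Ps)"
  have fm: "finite mis" unfolding mis_def by simp
  have misQ: "0 < y \<and> 4 * y \<le> k \<and> y \<notin> Q" if "y \<in> mis" for y using that K unfolding mis_def Q_def by auto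
  have mis1: "card mis \<le> 1"
  proof (rule ccontr)
    assume "\<not> card mis \<le> 1"
    then obtain a b where ab: "a \<in> mis" "b \<in> mis" "a \<noteq> b" using card_le_Suc0_iff_eq[OF fm] by auto
    have "(k + int (card {a, b})) * (k + int (card {a, b}) + 1) \<le> 2 * (\<Sum>Q + \<Sum>{a, b})"
      by (rule excess) (use ab misQ in auto)
    then have "k * k + 5 * k + 6 \<le> 2 * \<Sum>Q + 2 * a + 2 * b" using ab(3) by (simp add: algebra_simps)
    then show False using misQ[OF ab(1)] misQ[OF ab(2)] sQ tb u4 k(3) by linarith
  qed
  have Ku: "u \<le> K" using K u4 by linarith
  have neg: "card N \<le> 2 \<and> \<Sum>N \<le> 4 \<and> (card mis = 0 \<longrightarrow> card N \<le> 1 \<and> \<Sum>N \<le> 2)"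
    unfolding mis_def
  proof (rule negative_part[OF fN(1) fP _ F])
    show "\<Sum>N \<le> K" using tb Ku by linarith
    show "card ({1..K} - (N \<union> Ps)) \<le> 1" using mis1 unfolding mis_def .
  qed (use Npos Ppos in auto)
  define v where "v = \<Sum>Ps - p"
  have noW: "\<Sum>W \<noteq> v" if W: "W \<subseteq> Q" for W
  proof
    assume Wv: "\<Sum>W = v"
    have fW: "finite W" using W fQ finite_subset by blast
    have "W = (W \<inter> Ps) \<union> (W \<inter> N)" using W unfolding Q_def by auto
    then have "\<Sum>W = \<Sum>(W \<inter> Ps) + \<Sum>(W \<inter> N)"
      using fW disj by (metis (no_types, lifting) finite_Int inf_commute inf_left_commute inf_bot_right sum.union_disjoint)
    moreover have "\<Sum>(Ps - (W \<inter> Ps)) = \<Sum>Ps - \<Sum>(W \<inter> Ps)" by (rule sum_diff[OF fP]) auto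
    ultimately have e: "\<Sum>(Ps - (W \<inter> Ps)) - \<Sum>(W \<inter> N) = p" using Wv unfolding v_def by linarith
    have "Ps - (W \<inter> Ps) \<noteq> {} \<or> W \<inter> N \<noteq> {}"
    proof (rule ccontr)
      assume "\<not> ?thesis"
      then have "Ps - (W \<inter> Ps) = {}" "W \<inter> N = {}" by blast+
      then have "\<Sum>(Ps - (W \<inter> Ps)) - \<Sum>(W \<inter> N) = 0" by (simp only: sum.empty diff_self)
      then show False using e p by simp
    qed
    then show False using key[of "Ps - (W \<inter> Ps)" "W \<inter> N"] e by auto
  qed
  have v0: "v \<noteq> 0" using noW[of "{}"] by auto
  have vm: "v \<in> mis" if "0 \<le> v"
  proof -
    have "v \<notin> Q" using noW[of "{v}"] by auto
    moreover have "v < u" using tb unfolding v_def by linarith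
    ultimately show ?thesis using that v0 Ku unfolding mis_def Q_def by auto
  qed
  show ?thesis
  proof (cases "card mis = 0")
    case True
    then have "mis = {}" using fm by simp
    then have "\<Sum>Ps \<le> p - 1" using vm unfolding v_def by fastforce
    moreover have "k * k + k \<le> 2 * \<Sum>Q" using excess[of "{}"] by (simp add: algebra_simps)
    ultimately show ?thesis using neg True cN sN sQ by simp
  next
    case False
    then have "card mis = 1" using mis1 by simp
    then obtain y where y: "mis = {y}" using card_1_singletonE by blast
    have "(k + int (card {y})) * (k + int (card {y}) + 1) \<le> 2 * (\<Sum>Q + \<Sum>{y})"
      by (rule excess) (use misQ y in auto)
    then have "k * k + 3 * k + 2 \<le> 2 * \<Sum>Q + 2 * y" by (simp add: algebra_simps)
    then have ex: "2 * (k * k) + 5 * k \<le> 4 * \<Sum>Q" using misQ[of y] y by simp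
    \<comment> \<open>Otherwise \<open>v\<close> is the only missing number, and 1 and v - 1 are two
      distinct elements of \<open>Q\<close> with sum \<open>v\<close>.\<close>
    have "v \<le> 2"
    proof (rule ccontr)
      assume "\<not> v \<le> 2"
      then have "v \<in> mis" using vm by simp
      then have vy: "v = y" "v \<le> K" using y unfolding mis_def by auto
      have "1 \<in> Q" "v - 1 \<in> Q"
      proof -
        have "1 \<notin> mis" "v - 1 \<notin> mis" using y vy \<open>\<not> v \<le> 2\<close> by auto
        then show "1 \<in> Q" "v - 1 \<in> Q" using vy(2) \<open>\<not> v \<le> 2\<close> unfolding mis_def Q_def by auto
      qed
      moreover have "\<Sum>{1, v - 1} = v" using \<open>\<not> v \<le> 2\<close> by simp
      ultimately show False using noW[of "{1, v - 1}"] by simp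
    qed
    then show ?thesis using neg ex cN sN sQ unfolding v_def by simp
  qed
qed

subsection \<open>Zero-free subsets of the residue ring\<close>

lemma finsum_ZMod:
  assumes p: "p > 1" and B: "B \<subseteq> {0..<int p}"
  shows "(\<Oplus>\<^bsub>ZMod p\<^esub>b\<in>B. b) = \<Sum>B mod int p"
proof -
  interpret residues "int p" "ZMod p" using p by (simp add: residues_def)
  have fB: "finite B" using B finite_subset by blast
  have "(\<Oplus>\<^bsub>ZMod p\<^esub>b\<in>B. b) = (\<Oplus>\<^bsub>ZMod p\<^esub>b\<in>B. b mod int p)"
    by (rule finsum_cong') (use B in \<open>auto simp: res_carrier_eq subset_iff\<close>)
  also have "\<dots> = \<Sum>B mod int p" by (rule sum_cong[OF fB])
  finally show ?thesis .
qed

lemma carrier_ZMod: "p > 1 \<Longrightarrow> carrier (ZMod p) = {0..<int p}"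
  by (auto simp: residue_ring_def)

lemma zero_ZMod: "\<zero>\<^bsub>ZMod p\<^esub> = 0"
  by (simp add: residue_ring_def)

lemma mult_ZMod: "x \<otimes>\<^bsub>ZMod p\<^esub> y = (x * y) mod int p"
  by (simp add: residue_ring_def)

lemma uminus_ZMod: "p > 1 \<Longrightarrow> \<ominus>\<^bsub>ZMod p\<^esub> x = (- x) mod int p"
  by (rule residues.res_neg_eq) (simp add: residues_def)

lemma zero_free_ZMod_iff:
  assumes p: "p > 1"
  shows "zero_free (ZMod p) A \<longleftrightarrow> A \<subseteq> {0..<int p} \<and> zero_free_mod (int p) A"
proof (cases "A \<subseteq> {0..<int p}")
  case True
  have fA: "finite A" using True finite_subset by blast
  have inj: "inj_on (\<lambda>y. y mod int p) A" using True by (auto simp: inj_on_def subset_iff)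
  have eq: "(\<Oplus>\<^bsub>ZMod p\<^esub>b\<in>B. b) = 0 \<longleftrightarrow> int p dvd \<Sum>B" if "B \<subseteq> A" for B
    using finsum_ZMod[OF p, of B] that True by (auto simp: dvd_eq_mod_eq_0)
  have "0 \<in> subset_sums (ZMod p) A \<longleftrightarrow> (\<exists>B\<subseteq>A. B \<noteq> {} \<and> int p dvd \<Sum>B)"
  proof
    assume "0 \<in> subset_sums (ZMod p) A"
    then obtain B where "0 = (\<Oplus>\<^bsub>ZMod p\<^esub>b\<in>B. b)" "B \<noteq> {}" "B \<subseteq> A" unfolding subset_sums_def by blast
    then show "\<exists>B\<subseteq>A. B \<noteq> {} \<and> int p dvd \<Sum>B" using eq by metis
  next
    assume "\<exists>B\<subseteq>A. B \<noteq> {} \<and> int p dvd \<Sum>B"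
    then obtain B where B: "B \<subseteq> A" "B \<noteq> {}" "int p dvd \<Sum>B" by blast
    then have "0 = (\<Oplus>\<^bsub>ZMod p\<^esub>b\<in>B. b)" "finite B" using eq fA finite_subset by metis+
    then show "0 \<in> subset_sums (ZMod p) A" using B unfolding subset_sums_def by blast
  qed
  then show ?thesis using True fA inj unfolding zero_free_def zero_free_mod_def carrier_ZMod[OF p] zero_ZMod by auto
next
  case False
  then show ?thesis unfolding zero_free_def carrier_ZMod[OF p] by simp
qed

section \<open>Lower bound for the maximal size\<close>

lemma zero_free_mod_interval:
  assumes "n * (n + 1) < 2 * p"
  shows "zero_free_mod (int p) {1..int n}"
proof -
  have sm: "\<not> int p dvd \<Sum>Z" if Z: "Z \<subseteq> {1..int n}" "Z \<noteq> {}" for Z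
  proof
    assume d: "int p dvd \<Sum>Z"
    have "finite Z" using Z finite_subset by blast
    then have "0 < \<Sum>Z" using Z by (intro sum_pos) auto
    moreover have "\<Sum>Z \<le> \<Sum>{1..int n}" by (rule sum_mono2) (use Z in auto)
    then have "2 * \<Sum>Z \<le> int n * (int n + 1)" using sum_atLeast1_int[of n] by linarith
    moreover have "int n * (int n + 1) < 2 * int p"
    proof -
      have "int (n * (n + 1)) < int (2 * p)" using assms by (simp only: of_nat_less_iff)
      then show ?thesis by (simp add: algebra_simps)
    qed
    ultimately show False using d zdvd_not_zless[of "\<Sum>Z" "int p"] by simp
  qed
  have "inj_on (\<lambda>y. y mod int p) {1..int n}"
  proof (cases "n < p")
    case True
    then show ?thesis by (auto simp: inj_on_def)
  next
    case False
    have "n \<le> 1"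
    proof (rule ccontr)
      assume "\<not> n \<le> 1"
      then have "n * 2 \<le> n * (n + 1)" by (intro mult_le_mono) auto
      then show False using assms False by linarith
    qed
    then have "{1..int n} \<subseteq> {1}" by auto
    then show ?thesis by (rule inj_on_subset[rotated]) simp
  qed
  then show ?thesis unfolding zero_free_mod_def using sm by simp
qed

text \<open>Otherwise the total of {1..card A + 1} is below \<open>p\<close>, and this set is a
  larger zero-free one.\<close>

lemma card_max_zero_free:
  assumes p: "p > 1" and A: "max_zero_free (ZMod p) A"
  shows "2 * p \<le> (card A + 1) * (card A + 2)"
proof (rule ccontr)
  assume "\<not> ?thesis"
  then have lt: "(card A + 1) * ((card A + 1) + 1) < 2 * p" by simp
  have "(card A + 1) * 2 \<le> (card A + 1) * ((card A + 1) + 1)" by (intro mult_le_mono) auto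
  then have "(card A + 1) * 2 < 2 * p" using lt by (rule le_less_trans)
  then have "card A + 1 < p" by simp
  then have "{1..int (card A + 1)} \<subseteq> {0..<int p}" by auto
  then have "zero_free (ZMod p) {1..int (card A + 1)}"
    using zero_free_mod_interval[OF lt] zero_free_ZMod_iff[OF p] by blast
  then have "card {1..int (card A + 1)} \<le> card A" using A unfolding max_zero_free_def by blast
  then show False by simp
qed

lemma centered_rep_mod:
  assumes p: "odd p" "p > 1" and x: "2 * \<bar>x\<bar> < int p"
  shows "centered_rep p (x mod int p) = x"
  unfolding centered_rep_def
proof (rule the_equality)
  show "- real p / 2 < real_of_int x \<and> real_of_int x \<le> real p / 2 \<and> proj p x = x mod int p"
    using x unfolding proj_def by linarith
next
  fix n assume n: "- real p / 2 < real_of_int n \<and> real_of_int n \<le> real p / 2 \<and> proj p n = x mod int p"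
  then have "- int p < 2 * n" "2 * n \<le> int p" by linarith+
  moreover have "2 * n \<noteq> int p" using p by presburger
  ultimately have "2 * \<bar>n\<bar> < int p" by linarith
  moreover have "int p dvd n - x" using n unfolding proj_def by (simp add: mod_eq_dvd_iff)
  then have "int p dvd n - x" "int p dvd x - x" by auto
  ultimately show "n = x"
    using centred_unique[of "int p" n x] centred_unique[of "int p" x x] x p by simp
qed

text \<open>Neither \<open>2p\<close> nor \<open>2(p + 1)\<close> is of the form \<open>m(m + 1)\<close> for large \<open>m\<close>.\<close>

lemma no_boundary_case:
  fixes p k :: int
  assumes p: "prime p" and k: "k \<ge> 3" "2 * p \<le> (k + 1) * (k + 2)"
  shows "2 * p < k * k + 3 * k"
proof (rule ccontr)
  assume "\<not> ?thesis"
  then have ge: "k * k + 3 * k \<le> 2 * p" by simp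
  have le: "2 * p \<le> k * k + 3 * k + 2" using k(2) by (simp add: algebra_simps)
  have "even (k * k + 3 * k)" by simp
  then obtain e where e: "k * k + 3 * k = 2 * e" by (rule evenE)
  have "p = e \<or> p = e + 1" using ge le e by linarith
  then have "2 * p = k * (k + 3) \<or> 2 * p = (k + 1) * (k + 2)"
    using e by (auto simp: algebra_simps)
  then obtain a b where ab: "2 * p = a * b" "0 < a" "0 < b" "a \<le> k + 3" "b \<le> k + 3"
    using that[of k "k + 3"] that[of "k + 1" "k + 2"] k(1) by auto
  have "p dvd a * b" unfolding ab(1)[symmetric] by simp
  then have "p dvd a \<or> p dvd b" using p prime_dvd_mult_iff by blast
  then have "p \<le> k + 3" using ab zdvd_imp_le[of p a] zdvd_imp_le[of p b] by auto
  moreover have "3 * k \<le> k * k" using k(1) by (intro mult_right_mono) auto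
  ultimately show False using ge k(1) by linarith
qed

lemma floor_sqrt_int:
  fixes m :: int and y :: real
  assumes "0 \<le> m" "(real_of_int m)\<^sup>2 \<le> y" "y < (real_of_int m + 1)\<^sup>2"
  shows "\<lfloor>sqrt y\<rfloor> = m"
proof (rule floor_unique)
  show "real_of_int m \<le> sqrt y" by (rule real_le_rsqrt[OF assms(2)])
  show "sqrt y < real_of_int m + 1" by (rule real_less_lsqrt) (use assms in auto)
qed

theorem theorem3:
  "\<exists>(N::nat) (\<delta>::nat \<Rightarrow> nat). \<forall>p \<A>.
     N \<le> p \<longrightarrow> prime p \<longrightarrow> max_zero_free (ZMod p) \<A> \<longrightarrow>
       (real (card \<A>) * (real (card \<A>) + 1) / 2 \<le> real p + 1
         \<and> (\<forall>k::int. real_of_int k * (real_of_int k + 1) / 2 \<le> real p + 1 \<longrightarrow> k \<le> int (card \<A>)))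
     \<and> int (card \<A>) = \<lfloor>sqrt (2 * real p + 9 / 4) - 1 / 2\<rfloor>
     \<and> int (card \<A>) = \<lfloor>sqrt (2 * real p)\<rfloor> - int (\<delta> p)
     \<and> \<delta> p \<in> {0, 1}
     \<and> (\<exists>d \<in> carrier (ZMod p). d \<noteq> \<zero>\<^bsub>ZMod p\<^esub> \<and>
         (\<exists>\<A>' \<A>''. dilate p d \<A> = \<A>' \<union> \<A>''
            \<and> \<A>' \<subseteq> interval_mod p (- 2 * (1 + real (\<delta> p))) (- 1)
            \<and> \<A>'' \<subseteq> interval_mod p 1 (real p / 2)
            \<and> \<A>'' \<inter> (\<lambda>a. \<ominus>\<^bsub>ZMod p\<^esub> a) ` \<A>' = {}
            \<and> card \<A>' \<le> 1 + \<delta> p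
            \<and> (\<Sum>a'\<in>\<A>'. abs_mod p a') \<le> 2 * (1 + int (\<delta> p))
            \<and> (\<Sum>a''\<in>\<A>''. abs_mod p a'') \<le> int p - 1 + 3 * int (\<delta> p)))"
proof -
  \<comment> \<open>Three losses of k / 300 add up to the bound h <= k / 100 required by the
    near-extremal analysis.\<close>
  have M: "(300::nat) \<ge> 5" by simp
  from mostly_interval[OF M] obtain N where N: "\<forall>p A. prime p \<longrightarrow> int N \<le> p \<longrightarrow> odd p \<longrightarrow> zero_free_mod p A \<longrightarrow>
     2 * p < int (card A) * int (card A) + 3 * int (card A) \<longrightarrow>
     (\<exists>t. \<not> p dvd t \<and> int 300 * (int (card A) - int (card ((\<lambda>a. centred p (t * a)) ` A \<inter> {1..int (card A)}))) \<le> 3 * int (card A))"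
    by blast
  define \<delta> where "\<delta> = (\<lambda>p. nat (\<lfloor>sqrt (2 * real p)\<rfloor> - \<lfloor>sqrt (2 * real p + 9 / 4) - 1 / 2\<rfloor>))"
  show ?thesis
  proof (intro exI[of _ "N + 2000000"] exI[of _ \<delta>] allI impI)
    fix p :: nat and \<A> :: "int set"
    assume pN: "N + 2000000 \<le> p" and pp: "prime p" and max: "max_zero_free (ZMod p) \<A>"
    have p1: "p > 1" and p2: "p > 2" using pN by auto
    have podd: "odd p" using prime_odd_nat[OF pp p2] .
    define q where "q = int p"
    have q: "prime q" "odd q" "q > 2" "int N \<le> q" "q \<ge> 2000000" "q > 0"
      unfolding q_def using pp podd p2 pN by auto
    have zfA: "zero_free_mod q \<A>" and Ar: "\<A> \<subseteq> {0..<q}"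
      using max zero_free_ZMod_iff[OF p1] unfolding max_zero_free_def q_def by auto
    define k where "k = int (card \<A>)"
    have k0: "0 \<le> k" unfolding k_def by simp
    have "int (2 * p) \<le> int ((card \<A> + 1) * (card \<A> + 2))"
      using card_max_zero_free[OF p1 max] by (simp only: of_nat_le_iff)
    then have kq: "2 * q \<le> (k + 1) * (k + 2)" unfolding q_def k_def by (simp add: algebra_simps)
    have k1000: "k \<ge> 1000"
    proof (rule ccontr)
      assume "\<not> k \<ge> 1000"
      then have "(k + 1) * (k + 2) \<le> 1000 * 1002" using k0 by (intro mult_mono) auto
      then show False using kq q(5) by linarith
    qed
    have kq2: "2 * q < k * k + 3 * k" by (rule no_boundary_case[OF q(1) _ kq]) (use k1000 in simp)
    obtain t where t: "\<not> q dvd t"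
      "int 300 * (k - int (card ((\<lambda>a. centred q (t * a)) ` \<A> \<inter> {1..k}))) \<le> 3 * k"
      using N[rule_format, OF q(1,4,2) zfA] kq2 unfolding k_def by blast
    define f where "f = (\<lambda>a. centred q (t * a))"
    define X where "X = f ` \<A>"
    have zX: "zero_free_mod q X" and injf: "inj_on f \<A>" using centred_image_zero_free_mod[OF q(1) zfA t(1)] unfolding f_def X_def by auto
    have Xb: "2 * \<bar>x\<bar> < q" if "x \<in> X" for x using that centred_bounds[OF q(6,2)] unfolding X_def f_def by auto
    have kX: "k = int (card X)" unfolding k_def X_def using card_image[OF injf] by simp
    define h where "h = k - int (card (X \<inter> {1..k}))"
    have h: "int (card (X \<inter> {1..k})) = k - h" "100 * h \<le> k"
      using t(2) unfolding h_def X_def f_def by auto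
    define Ng where "Ng = {x \<in> X. x < 0}"
    define Ps where "Ps = {x \<in> X. 0 < x}"
    define sn where "sn = (\<Sum>x\<in>Ng. \<bar>x\<bar>)"
    define sp where "sp = \<Sum>Ps"
    have cases: "(card Ng \<le> 1 \<and> sn \<le> 2 \<and> sp \<le> q - 1 \<and> k * k + k \<le> 2 * (sp + sn)) \<or>
        (card Ng \<le> 2 \<and> sn \<le> 4 \<and> sp \<le> q + 2 \<and> 2 * (k * k) + 5 * k \<le> 4 * (sp + sn))"
      unfolding sn_def sp_def Ng_def Ps_def
      by (rule near_extremal_structure[OF q(6) zX Xb q(3) kX k1000 kq2 h])
    \<comment> \<open>The upper bound on \<open>k\<close>: sp + sn is at most q + 1 in the first
      alternative and q + 6 in the second, where the surplus 3k / 2 on the left absorbs the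
      difference.\<close>
    have kk: "k * k + k \<le> 2 * q + 2"
      using cases k1000 by (elim disjE) (auto simp: algebra_simps)
    define r where "r = real_of_int k"
    have r: "r = real (card \<A>)" unfolding r_def k_def by simp
    have rq: "real p = real_of_int q" unfolding q_def by simp
    have r1000: "r \<ge> 1000" unfolding r_def using k1000 by linarith
    have ru: "2 * real p < r * r + 3 * r"
    proof -
      have "real_of_int (2 * q) < real_of_int (k * k + 3 * k)" using kq2 by (simp only: of_int_less_iff)
      then show ?thesis unfolding rq r_def by simp
    qed
    have rl: "r * r + r \<le> 2 * real p + 2"
    proof -
      have "real_of_int (k * k + k) \<le> real_of_int (2 * q + 2)" using kk by (simp only: of_int_le_iff)
      then show ?thesis unfolding rq r_def by simp
    qed
    have c1: "real (card \<A>) * (real (card \<A>) + 1) / 2 \<le> real p + 1"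
      using rl unfolding r by (simp add: field_simps)
    have c2: "j \<le> int (card \<A>)" if j: "real_of_int j * (real_of_int j + 1) / 2 \<le> real p + 1" for j :: int
    proof (rule ccontr)
      assume "\<not> ?thesis"
      then have "k + 1 \<le> j" unfolding k_def by simp
      then have jr: "r + 1 \<le> real_of_int j" unfolding r_def by linarith
      have "(r + 1) * (r + 1 + 1) \<le> real_of_int j * (real_of_int j + 1)"
        by (rule mult_mono) (use jr r1000 in auto)
      then show False using j ru by (simp add: algebra_simps)
    qed
    have c3: "\<lfloor>sqrt (2 * real p + 9 / 4) - 1 / 2\<rfloor> = k"
    proof (rule floor_unique)
      \<comment> \<open>Squared, this is k (k + 1) <= 2p + 2; in the same way the strict upper bound
        below is 2p < k^2 + 3k.\<close>
      have "r + 1 / 2 \<le> sqrt (2 * real p + 9 / 4)"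
        by (rule real_le_rsqrt) (use rl in \<open>simp add: power2_eq_square algebra_simps\<close>)
      then show "real_of_int k \<le> sqrt (2 * real p + 9 / 4) - 1 / 2" unfolding r_def by linarith
      have "sqrt (2 * real p + 9 / 4) < r + 3 / 2"
        by (rule real_less_lsqrt) (use ru r1000 in \<open>simp_all add: power2_eq_square algebra_simps\<close>)
      then show "sqrt (2 * real p + 9 / 4) - 1 / 2 < real_of_int k + 1" unfolding r_def by linarith
    qed
    have fl: "\<lfloor>sqrt (2 * real p)\<rfloor> = (if 2 * real p < (r + 1)\<^sup>2 then k else k + 1)"
    proof (cases "2 * real p < (r + 1)\<^sup>2")
      case True
      then show ?thesis using floor_sqrt_int[of k "2 * real p"] rl r1000 k0
        unfolding r_def by (simp add: power2_eq_square)
    next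
      case False
      then show ?thesis using floor_sqrt_int[of "k + 1" "2 * real p"] ru r1000 k0
        unfolding r_def by (simp add: power2_eq_square algebra_simps)
    qed
    have \<delta>: "int (\<delta> p) = \<lfloor>sqrt (2 * real p)\<rfloor> - k" "\<delta> p \<in> {0, 1}"
      unfolding \<delta>_def c3 fl by auto
    have c4: "int (card \<A>) = \<lfloor>sqrt (2 * real p + 9 / 4) - 1 / 2\<rfloor>" unfolding c3 k_def ..
    have c5: "int (card \<A>) = \<lfloor>sqrt (2 * real p)\<rfloor> - int (\<delta> p)" using \<delta>(1) unfolding k_def by simp
    define D where "D = int (\<delta> p)"
    have D01: "D = 0 \<or> D = 1" using \<delta>(2) unfolding D_def by auto
    \<comment> \<open>For D = 1 both alternatives satisfy the bounds. For D = 0 one has 2q < (k +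
      1)^2, whereas the second alternative would give 2q >= k^2 + 5k/2 - 12.\<close>
    have fin: "int (card Ng) \<le> 1 + D \<and> sn \<le> 2 * (1 + D) \<and> sp \<le> q - 1 + 3 * D"
    proof (cases "D = 1")
      case True
      then show ?thesis using cases by auto
    next
      case False
      then have "D = 0" using D01 by simp
      then have "2 * real p < (r + 1)\<^sup>2" using \<delta>(1) fl unfolding D_def by (auto split: if_splits)
      then have "real_of_int (2 * q) < real_of_int ((k + 1) * (k + 1))"
        unfolding rq r_def by (simp add: power2_eq_square)
      then have "2 * q < (k + 1) * (k + 1)" by (simp only: of_int_less_iff)
      then have "2 * q < k * k + 2 * k + 1" by (simp add: algebra_simps)
      then have "\<not> (sn \<le> 4 \<and> sp \<le> q + 2 \<and> 2 * (k * k) + 5 * k \<le> 4 * (sp + sn))"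
        using k1000 by (auto simp: algebra_simps)
      then show ?thesis using cases \<open>D = 0\<close> by auto
    qed
    have fX: "finite X" using zX unfolding zero_free_mod_def by auto
    have X0: "0 \<notin> X"
    proof
      assume "0 \<in> X"
      then have "\<not> q dvd \<Sum>{0::int}" by (intro zero_free_modD[OF zX]) auto
      then show False by simp
    qed
    have NP: "X = Ng \<union> Ps" unfolding Ng_def Ps_def using X0 by (auto simp: not_less order.order_iff_strict)
    have fNg: "finite Ng" unfolding Ng_def using fX by simp
    have injX: "inj_on (\<lambda>x. x mod q) X" using zX unfolding zero_free_mod_def by simp
    have absm: "abs_mod p (x mod q) = \<bar>x\<bar>" if "x \<in> X" for x
      using centered_rep_mod[OF podd p1, of x] Xb[OF that] unfolding abs_mod_def q_def by simp
    define A1 where "A1 = (\<lambda>x. x mod q) ` Ng"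
    define A2 where "A2 = (\<lambda>x. x mod q) ` Ps"
    define d where "d = t mod q"
    have dd: "d \<in> carrier (ZMod p)" "d \<noteq> \<zero>\<^bsub>ZMod p\<^esub>"
      unfolding d_def carrier_ZMod[OF p1] zero_ZMod using t(1) q(6) by (auto simp: q_def dvd_eq_mod_eq_0)
    have "dilate p d \<A> = (\<lambda>x. x mod q) ` X"
    proof -
      have "d \<otimes>\<^bsub>ZMod p\<^esub> a = f a mod q" for a
        unfolding mult_ZMod f_def centred_cong d_def unfolding q_def by (simp add: mod_simps)
      then show ?thesis unfolding dilate_def X_def image_image by simp
    qed
    then have b1: "dilate p d \<A> = A1 \<union> A2" unfolding A1_def A2_def NP image_Un .
    have b2: "A1 \<subseteq> interval_mod p (- 2 * (1 + real (\<delta> p))) (- 1)"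
    proof
      fix z assume "z \<in> A1"
      then obtain x where x: "x \<in> Ng" "z = x mod q" unfolding A1_def by auto
      have "\<bar>x\<bar> \<le> sn" unfolding sn_def by (rule member_le_sum[OF x(1)]) (use fNg in auto)
      then have "- 2 * (1 + D) \<le> x" using fin by linarith
      then have "real_of_int (- 2 * (1 + D)) \<le> real_of_int x" by (simp only: of_int_le_iff)
      moreover have "real_of_int x \<le> - 1" using x(1) unfolding Ng_def by auto
      ultimately show "z \<in> interval_mod p (- 2 * (1 + real (\<delta> p))) (- 1)"
        unfolding interval_mod_def proj_def x(2) q_def D_def by (intro imageI) simp
    qed
    have b3: "A2 \<subseteq> interval_mod p 1 (real p / 2)"
    proof
      fix z assume "z \<in> A2"
      then obtain x where x: "x \<in> Ps" "z = x mod q" unfolding A2_def by auto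
      have "2 * x < q" "1 \<le> x" using Xb[of x] x(1) unfolding Ps_def by auto
      then have "1 \<le> real_of_int x" "real_of_int x \<le> real p / 2" unfolding rq by linarith+
      then show "z \<in> interval_mod p 1 (real p / 2)"
        unfolding interval_mod_def proj_def x(2) q_def by (intro imageI) simp
    qed
    have b4: "A2 \<inter> (\<lambda>a. \<ominus>\<^bsub>ZMod p\<^esub> a) ` A1 = {}"
    proof (rule ccontr)
      assume "\<not> ?thesis"
      then obtain x y where xy: "x \<in> Ps" "y \<in> Ng" "x mod q = (- (y mod q)) mod q"
        unfolding A1_def A2_def uminus_ZMod[OF p1] q_def by auto
      then have "x mod q = (- y) mod q" by (simp add: mod_simps)
      then have "q dvd x - (- y)" by (simp only: mod_eq_dvd_iff)
      moreover have "x \<noteq> y" using xy unfolding Ps_def Ng_def by auto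
      then have "\<Sum>{x, y} = x - (- y)" by simp
      moreover have "\<not> q dvd \<Sum>{x, y}" by (rule zero_free_modD[OF zX]) (use xy in \<open>auto simp: Ps_def Ng_def\<close>)
      ultimately show False by simp
    qed
    have "card A1 \<le> card Ng" unfolding A1_def by (rule card_image_le[OF fNg])
    then have b5: "card A1 \<le> 1 + \<delta> p" using fin unfolding D_def by linarith
    have "(\<Sum>a\<in>A1. abs_mod p a) = sn"
      unfolding A1_def sn_def using inj_on_subset[OF injX, of Ng] absm by (simp add: sum.reindex Ng_def)
    then have b6: "(\<Sum>a\<in>A1. abs_mod p a) \<le> 2 * (1 + int (\<delta> p))" using fin unfolding D_def by simp
    have "(\<Sum>a\<in>A2. abs_mod p a) = (\<Sum>x\<in>Ps. \<bar>x\<bar>)"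
      unfolding A2_def using inj_on_subset[OF injX, of Ps] absm by (simp add: sum.reindex Ps_def)
    also have "\<dots> = sp" unfolding sp_def by (rule sum.cong) (auto simp: Ps_def)
    finally have b7: "(\<Sum>a\<in>A2. abs_mod p a) \<le> int p - 1 + 3 * int (\<delta> p)"
      using fin unfolding D_def q_def by simp
    show "(real (card \<A>) * (real (card \<A>) + 1) / 2 \<le> real p + 1
         \<and> (\<forall>k::int. real_of_int k * (real_of_int k + 1) / 2 \<le> real p + 1 \<longrightarrow> k \<le> int (card \<A>)))
     \<and> int (card \<A>) = \<lfloor>sqrt (2 * real p + 9 / 4) - 1 / 2\<rfloor>
     \<and> int (card \<A>) = \<lfloor>sqrt (2 * real p)\<rfloor> - int (\<delta> p)
     \<and> \<delta> p \<in> {0, 1}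
     \<and> (\<exists>d \<in> carrier (ZMod p). d \<noteq> \<zero>\<^bsub>ZMod p\<^esub> \<and>
         (\<exists>\<A>' \<A>''. dilate p d \<A> = \<A>' \<union> \<A>''
            \<and> \<A>' \<subseteq> interval_mod p (- 2 * (1 + real (\<delta> p))) (- 1)
            \<and> \<A>'' \<subseteq> interval_mod p 1 (real p / 2)
            \<and> \<A>'' \<inter> (\<lambda>a. \<ominus>\<^bsub>ZMod p\<^esub> a) ` \<A>' = {}
            \<and> card \<A>' \<le> 1 + \<delta> p
            \<and> (\<Sum>a'\<in>\<A>'. abs_mod p a') \<le> 2 * (1 + int (\<delta> p))
            \<and> (\<Sum>a''\<in>\<A>''. abs_mod p a'') \<le> int p - 1 + 3 * int (\<delta> p)))"
      by (intro conjI allI impI bexI[OF _ dd(1)] exI[of _ A1] exI[of _ A2]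
          c1 c2 c4 c5 \<delta>(2) dd(2) b1 b2 b3 b4 b5 b6 b7)
  qed
qed

end
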